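(* Fix $\tau\in X$. The map $z\mapsto\mathfrak i(v_z^{-1}(\Delta_z^1))$ establishes a bijection between $\widehat Z_\tau$ and $\mathcal S_\tau$, the set of $\mathfrak b_{\mathfrak k}$-submodules of $\mathfrak b_{\mathfrak p}$. Moreover, this map restricts to a bijection between $\widetilde Z_\tau$ and the set of abelian subspaces in $\mathcal S_\tau$. In particular, the number of abelian $\mathfrak b_{\mathfrak k}$-submodules of $\mathfrak b_{\mathfrak p}$ is $n_\tau$.
   Context: $\mathfrak g$ is a finite-dimensional complex simple Lie algebra, $\mathfrak b=\mathfrak h\oplus\mathfrak n$ a Borel subalgebra with Cartan subalgebra $\mathfrak h$, $\Delta$, $\Delta^+$, $\Pi=\{\alpha_1,\dots,\alpha_n\}$, $\theta$ the roots, positive roots, simple roots, highest root, $\mathfrak g_\alpha$ the root spaces, $W$ the Weyl group. $\mathfrak h_{\mathbb R}$ is the real span of the coroots, identified with its dual via the Killing form, $(\cdot,\cdot)$ the form/pairing; $P^\vee$ the coweight lattice. $X=\{x\in P^\vee\mid(x,\alpha_i)\ge0\ \forall i,\ (x,\theta)\le2\}$. For $z\in\mathfrak h_{\mathbb R}$: $v_z\in W$ is the unique element with $\{\alpha\in\Delta^+\mid v_z^{-1}(\alpha)<0\}=\{\alpha\in\Delta^+\mid(\alpha,z)<0\}$, $dom(z)=v_z^{-1}(z)$, $\Delta_z^i=\{\alpha\in\Delta^+\mid(\alpha,z)=i\}$. For $\Phi\subset\Delta^+$, $\mathfrak i(\Phi)=\bigoplus_{\alpha\in\Phi}\mathfrak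 g_\alpha$. $\widetilde Z=\{\sigma\in P^\vee\mid(\sigma,\alpha_i)\le1\ \forall i,\ (\sigma,\theta)\ge-2\}$, $\widetilde Z_{ab}=\{\sigma\in P^\vee\mid(\sigma,\beta)\in\{0,-1,1,-2\}\ \forall\beta\in\Delta^+\}$, $\widehat Z_\tau=\{z\in\widetilde Z\mid dom(z)=\tau\}$, $\widetilde Z_\tau=\{z\in\widetilde Z_{ab}\mid dom(z)=\tau\}$. For $\tau\in X$, $\mathfrak g=\mathfrak k\oplus\mathfrak p$ with $\mathfrak k=\mathfrak k_\tau$, $\mathfrak p=\mathfrak p_\tau$ the $+1$, $-1$ eigenspaces of $Ad(\exp(\sqrt{-1}\,\pi\tau))$; $\mathfrak b_{\mathfrak k}=\mathfrak b\cap\mathfrak k$, $\mathfrak b_{\mathfrak p}=\mathfrak b\cap\mathfrak p$ (a $\mathfrak b_{\mathfrak k}$-module under the bracket). A subspace $\mathfrak s\subset\mathfrak b_{\mathfrak p}$ is abelian if $[\mathfrak s,\mathfrak s]=0$. $W_\tau$ is the Weyl group of $(\mathfrak k_\tau,\mathfrak h)$, $n_\tau=[W:W_\tau]$. *)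

theory Defs
  imports Complex_Main "HOL-Algebra.Bij" "HOL-Algebra.Generated_Groups"
begin

locale complex_lie_algebra = vector_space scale
  for scale :: "complex \<Rightarrow> 'g::ab_group_add \<Rightarrow> 'g" (infixr \<open>*s\<close> 75) +
  fixes bracket :: "'g \<Rightarrow> 'g \<Rightarrow> 'g"
  assumes finite_dim: "\<exists>S. finite S \<and> span S = UNIV"
    and bracket_add_left: "bracket (x + y) z = bracket x z + bracket y z"
    and bracket_scale_left: "bracket (c *s x) y = c *s bracket x y"
    and bracket_add_right: "bracket x (y + z) = bracket x y + bracket x z"
    and bracket_scale_right: "bracket x (c *s y) = c *s bracket x y"
    and bracket_self: "bracket x x = 0"
    and jacobi: "bracket x (bracket y z) + bracket y (bracket z x) + bracket z (bracket x y) = 0"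
begin

definition subalgebra :: "'g set \<Rightarrow> bool" where
  "subalgebra K \<longleftrightarrow> subspace K \<and> (\<forall>x\<in>K. \<forall>y\<in>K. bracket x y \<in> K)"

definition lie_ideal :: "'g set \<Rightarrow> bool" where
  "lie_ideal I \<longleftrightarrow> subspace I \<and> (\<forall>x. \<forall>y\<in>I. bracket x y \<in> I)"

definition abelian :: "'g set \<Rightarrow> bool" where
  "abelian K \<longleftrightarrow> (\<forall>x\<in>K. \<forall>y\<in>K. bracket x y = 0)"

primrec derived_series :: "'g set \<Rightarrow> nat \<Rightarrow> 'g set" where
  "derived_series K 0 = K"
| "derived_series K (Suc n) =
     span {bracket x y | x y. x \<in> derived_series K n \<and> y \<in> derived_series K n}"

definition solvable :: "'g set \<Rightarrow> bool" where
  "solvable K \<longleftrightarrow> (\<exists>n. derived_series K n = {0})"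

definition borel_subalgebra :: "'g set \<Rightarrow> bool" where
  "borel_subalgebra B \<longleftrightarrow> subalgebra B \<and> solvable B \<and>
     (\<forall>K. subalgebra K \<and> solvable K \<and> B \<subseteq> K \<longrightarrow> K = B)"

definition ad_semisimple :: "'g \<Rightarrow> bool" where
  "ad_semisimple h \<longleftrightarrow> span {y. \<exists>c. bracket h y = c *s y} = UNIV"

(* The usual definition for semisimple complex Lie algebras: a maximal abelian subalgebra
   all of whose elements are ad-semisimple. *)
definition cartan_subalgebra :: "'g set \<Rightarrow> bool" where
  "cartan_subalgebra H \<longleftrightarrow> subalgebra H \<and> abelian H \<and>
     (\<forall>K. subalgebra K \<and> abelian K \<and> H \<subseteq> K \<longrightarrow> K = H) \<and>
     (\<forall>h\<in>H. ad_semisimple h)"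

(* The dual space of H. A functional on H is encoded as a function on the whole type that
   vanishes outside H, so that functionals are equal iff they agree on H and the pointwise
   operations are those of the dual space. Such a function is not linear outside H. *)
definition dual :: "'g set \<Rightarrow> ('g \<Rightarrow> complex) set" where
  "dual H = {\<alpha>. (\<forall>x\<in>H. \<forall>y\<in>H. \<alpha> (x + y) = \<alpha> x + \<alpha> y) \<and>
                (\<forall>c. \<forall>x\<in>H. \<alpha> (c *s x) = c * \<alpha> x) \<and>
                (\<forall>x. x \<notin> H \<longrightarrow> \<alpha> x = 0)}"

(* In the next five definitions L is a subalgebra containing H: it is the whole algebra or
   the fixed subalgebra of an inner involution. *)
definition root_space :: "'g set \<Rightarrow> 'g set \<Rightarrow> ('g \<Rightarrow> complex) \<Rightarrow> 'g set" where
  "root_space L H \<alpha> = {x \<in> L. \<forall>h\<in>H. bracket h x = \<alpha> h *s x}"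

definition roots :: "'g set \<Rightarrow> 'g set \<Rightarrow> ('g \<Rightarrow> complex) set" where
  "roots L H = {\<alpha> \<in> dual H. \<alpha> \<noteq> (\<lambda>x. 0) \<and> root_space L H \<alpha> \<noteq> {0}}"

definition coroot :: "'g set \<Rightarrow> 'g set \<Rightarrow> ('g \<Rightarrow> complex) \<Rightarrow> 'g" where
  "coroot L H \<alpha> = (THE h. \<alpha> h = 2 \<and>
     h \<in> span {bracket x y | x y. x \<in> root_space L H \<alpha> \<and> y \<in> root_space L H (\<lambda>x. - \<alpha> x)})"

(* Since roots vanish outside H, a reflection is the identity there; hence Weyl group
   elements, as permutations of the whole type, are determined by their action on H. *)
definition reflection :: "'g set \<Rightarrow> 'g set \<Rightarrow> ('g \<Rightarrow> complex) \<Rightarrow> 'g \<Rightarrow> 'g" where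
  "reflection L H \<alpha> x = x - \<alpha> x *s coroot L H \<alpha>"

definition weyl_group :: "'g set \<Rightarrow> 'g set \<Rightarrow> ('g \<Rightarrow> 'g) set" where
  "weyl_group L H = generate (BijGroup UNIV) (reflection L H ` roots L H)"

(* Ad (exp x) = exp (ad x). The exponential series is summed in the canonical topology of a
   finite-dimensional complex vector space, in which a series converges iff it does so under
   every linear functional. *)
definition Ad_exp :: "'g \<Rightarrow> 'g \<Rightarrow> 'g" where
  "Ad_exp x y = (THE z. \<forall>f. Vector_Spaces.linear scale (*) f \<longrightarrow>
     (\<lambda>n. f ((bracket x ^^ n) y) / fact n) sums f z)"

end

locale simple_lie_algebra = complex_lie_algebra +
  assumes not_abelian: "\<not> abelian UNIV"
    and simple: "lie_ideal I \<Longrightarrow> I = {0} \<or> I = UNIV"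

locale simple_lie_borel = simple_lie_algebra scale bracket
  for scale :: "complex \<Rightarrow> 'g::ab_group_add \<Rightarrow> 'g" (infixr \<open>*s\<close> 75) and bracket +
  fixes H B :: "'g set"
  assumes cartan: "cartan_subalgebra H"
    and borel: "borel_subalgebra B"
    and cartan_subset_borel: "H \<subseteq> B"
begin

definition Delta :: "('g \<Rightarrow> complex) set" where
  "Delta = roots UNIV H"

definition Delta_pos :: "('g \<Rightarrow> complex) set" where
  "Delta_pos = {\<alpha> \<in> Delta. root_space UNIV H \<alpha> \<subseteq> B}"

definition simple_roots :: "('g \<Rightarrow> complex) set" where
  "simple_roots = {\<alpha> \<in> Delta_pos. \<not> (\<exists>\<beta>\<in>Delta_pos. \<exists>\<gamma>\<in>Delta_pos. \<alpha> = (\<lambda>x. \<beta> x + \<gamma> x))}"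

definition highest_root :: "'g \<Rightarrow> complex" where
  "highest_root = (THE \<theta>. \<theta> \<in> Delta \<and>
     (\<forall>\<beta>\<in>Delta. \<exists>c :: ('g \<Rightarrow> complex) \<Rightarrow> nat.
        \<forall>x. \<theta> x - \<beta> x = (\<Sum>\<alpha>\<in>simple_roots. of_nat (c \<alpha>) * \<alpha> x)))"

definition W :: "('g \<Rightarrow> 'g) set" where
  "W = weyl_group UNIV H"

definition W_act :: "('g \<Rightarrow> 'g) \<Rightarrow> ('g \<Rightarrow> complex) \<Rightarrow> ('g \<Rightarrow> complex)" where
  "W_act w \<alpha> = \<alpha> \<circ> inv_into UNIV w"

definition h_real :: "'g set" where
  "h_real = module.span (\<lambda>r::real. scale (complex_of_real r)) (coroot UNIV H ` Delta)"

(* The form (x, \<alpha>). Under the Killing form identification of h_real with its dual it is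
   evaluation, and roots take real values on h_real. *)
definition pair :: "'g \<Rightarrow> ('g \<Rightarrow> complex) \<Rightarrow> real" where
  "pair x \<alpha> = Re (\<alpha> x)"

definition coweights :: "'g set" where
  "coweights = {x \<in> h_real. \<forall>\<alpha>\<in>Delta. pair x \<alpha> \<in> \<int>}"

definition X :: "'g set" where
  "X = {x \<in> coweights. (\<forall>\<alpha>\<in>simple_roots. pair x \<alpha> \<ge> 0) \<and> pair x highest_root \<le> 2}"

definition v :: "'g \<Rightarrow> ('g \<Rightarrow> 'g)" where
  "v z = (THE w. w \<in> W \<and>
     {\<alpha> \<in> Delta_pos. (\<lambda>x. - W_act (inv_into UNIV w) \<alpha> x) \<in> Delta_pos} =
     {\<alpha> \<in> Delta_pos. pair z \<alpha> < 0})"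

definition dominant :: "'g \<Rightarrow> 'g" where
  "dominant z = inv_into UNIV (v z) z"

definition Delta_level :: "'g \<Rightarrow> int \<Rightarrow> ('g \<Rightarrow> complex) set" where
  "Delta_level z i = {\<alpha> \<in> Delta_pos. pair z \<alpha> = of_int i}"

definition root_sum :: "('g \<Rightarrow> complex) set \<Rightarrow> 'g set" where
  "root_sum \<Phi> = span (\<Union>\<alpha>\<in>\<Phi>. root_space UNIV H \<alpha>)"

definition Z :: "'g set" where
  "Z = {\<sigma> \<in> coweights. (\<forall>\<alpha>\<in>simple_roots. pair \<sigma> \<alpha> \<le> 1) \<and> pair \<sigma> highest_root \<ge> -2}"

definition Z_ab :: "'g set" where
  "Z_ab = {\<sigma> \<in> coweights. \<forall>\<beta>\<in>Delta_pos. pair \<sigma> \<beta> \<in> {0, -1, 1, -2}}"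

definition Z_hat :: "'g \<Rightarrow> 'g set" where
  "Z_hat \<tau> = {z \<in> Z. dominant z = \<tau>}"

definition Z_tilde :: "'g \<Rightarrow> 'g set" where
  "Z_tilde \<tau> = {z \<in> Z_ab. dominant z = \<tau>}"

definition k :: "'g \<Rightarrow> 'g set" where
  "k \<tau> = {x. Ad_exp (scale (\<i> * complex_of_real pi) \<tau>) x = x}"

definition p :: "'g \<Rightarrow> 'g set" where
  "p \<tau> = {x. Ad_exp (scale (\<i> * complex_of_real pi) \<tau>) x = - x}"

definition b_k :: "'g \<Rightarrow> 'g set" where
  "b_k \<tau> = B \<inter> k \<tau>"

definition b_p :: "'g \<Rightarrow> 'g set" where
  "b_p \<tau> = B \<inter> p \<tau>"

definition submodules :: "'g \<Rightarrow> 'g set set" where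
  "submodules \<tau> = {S. subspace S \<and> S \<subseteq> b_p \<tau> \<and> (\<forall>x\<in>b_k \<tau>. \<forall>y\<in>S. bracket x y \<in> S)}"

definition W_sub :: "'g \<Rightarrow> ('g \<Rightarrow> 'g) set" where
  "W_sub \<tau> = weyl_group (k \<tau>) H"

definition weyl_index :: "'g \<Rightarrow> nat" where
  "weyl_index \<tau> = card (rcosets\<^bsub>(BijGroup UNIV)\<lparr>carrier := W\<rparr>\<^esub> (W_sub \<tau>))"

end

end

theory Submission
  imports Defs "HOL-Library.Function_Algebras"
begin

text \<open>
  The structure theory of the pair \<open>H \<subseteq> B\<close> is elementary: since \<open>H\<close> is self-centralizing and acts
  diagonalizably, \<open>sl2\<close>-arguments with raising and lowering operators replace the Killing form.

  Write \<open>\<Delta>\<^sub>i\<close> for the roots of value \<open>i\<close> on \<open>\<tau>\<close>; \<open>i\<close> ranges over \<open>-2, \<dots>, 2\<close>. An element \<open>z = w \<tau>\<close> with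
  \<open>w = v\<^sub>z\<close> is the same as the positive system \<open>P = w\<inverse> \<Delta>\<^sup>+\<close>, which may be any positive system containing
  \<open>\<Delta>\<^sub>0\<^sup>+\<close>. The condition \<open>z \<in> Z\<close> says that no simple root of \<open>P\<close> lies in \<open>\<Delta>\<^sub>2\<close>. Then
  \<open>P \<inter> \<Delta>\<^sub>2\<close> consists of the sums of two elements of \<open>F = P \<inter> \<Delta>\<^sub>1\<close>, so \<open>F\<close> determines \<open>P\<close>; conversely
  every \<open>F \<subseteq> \<Delta>\<^sub>1\<close> stable under adding elements of \<open>\<Delta>\<^sub>0\<^sup>+\<close> arises, and these \<open>F\<close> are the
  submodules. The submodule is abelian iff \<open>P \<inter> \<Delta>\<^sub>2\<close> is empty, i.e. iff \<open>P\<close> contains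
  \<open>\<Delta>\<^sub>0\<^sup>+ \<union> - \<Delta>\<^sub>2\<close>. This is a positive system of the roots of \<open>k\<close>, and simple transitivity of the Weyl
  group of \<open>k\<close> gives exactly one such \<open>w\<inverse>\<close> in each coset.
\<close>

section \<open>Weight space decomposition\<close>

text \<open>Coroots are defined through brackets of opposite root spaces, and simplicity only
  forbids ideals. So the first obstacle is that these brackets do not vanish, which has to be shown
  before any nondegenerate form is at hand. If a root where they vanish (a null root) led by a
  bracket to a root \<open>a + b\<close> where they do not, the coroots of \<open>b\<close> and
  \<open>a + b\<close> would be proportional, which finiteness of the set of weights excludes. Hence
  the null root spaces span an ideal.

  No ordering and no basis of simple roots is used. Positive systems are sets of roots closed under
  addition that choose between \<open>a\<close> and \<open>- a\<close>; zero is no nonempty sum of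
  their elements, because the terms of a vanishing sum can be merged.

  Weyl group elements act on roots by precomposition: \<open>a \<circ> w\<close> is the image of
  \<open>a\<close> under the inverse of \<open>w\<close>, so the inverse of \<open>v z\<close>
  becomes a plain composition.

  The way back from \<open>F\<close> to \<open>P\<close> rests on one consequence of the Jacobi
  identity, \<open>root_triple_sum\<close>: if \<open>a + b\<close> and \<open>a + b + c\<close> are
  roots, then \<open>c\<close> can already be added to \<open>a\<close> or to
  \<open>b\<close>.\<close>

lemma sum_fun_apply: "(\<Sum>i\<in>I. f i) x = (\<Sum>i\<in>I. f i x)"
  for f :: "'i \<Rightarrow> 'b \<Rightarrow> 'c::comm_monoid_add"
  by (induction I rule: infinite_finite_induct) (auto simp: zero_fun_def)

lemma of_int_fun_apply [simp]: "(of_int n :: 'b \<Rightarrow> 'c::comm_ring_1) x = of_int n"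
  by (cases n) auto

section \<open>Bracket calculus and simultaneous diagonalization\<close>

context complex_lie_algebra
begin

lemma bracket_zero_left [simp]: "bracket 0 x = 0"
  using bracket_scale_left[of 0 0 x] by simp

lemma bracket_zero_right [simp]: "bracket x 0 = 0"
  using bracket_scale_right[of x 0 0] by simp

lemma bracket_minus_right: "bracket x (- y) = - bracket x y"
  using bracket_scale_right[of x "-1" y] by simp

lemma bracket_diff_right: "bracket x (y - z) = bracket x y - bracket x z"
  using bracket_add_right[of x y "-z"] by (simp add: bracket_minus_right)

lemma bracket_sum_right: "bracket x (\<Sum>i\<in>I. f i) = (\<Sum>i\<in>I. bracket x (f i))"
  by (induction I rule: infinite_finite_induct) (auto simp: bracket_add_right)

lemma bracket_anti: "bracket x y = - bracket y x"
proof -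
  have "bracket (x + y) (x + y) = bracket x x + bracket y x + (bracket x y + bracket y y)"
    by (simp only: bracket_add_left bracket_add_right)
  then have "bracket y x + bracket x y = 0" unfolding bracket_self by simp
  then show ?thesis by (simp add: eq_neg_iff_add_eq_0 add.commute)
qed

lemma bracket_deriv: "bracket x (bracket y z) = bracket (bracket x y) z + bracket y (bracket x z)"
proof -
  have "bracket y (bracket z x) = - bracket y (bracket x z)"
    by (subst bracket_anti[of z x]) (simp add: bracket_minus_right)
  moreover have "bracket z (bracket x y) = - bracket (bracket x y) z"
    by (rule bracket_anti)
  ultimately show ?thesis using jacobi[of x y z]
    by (simp add: algebra_simps add_eq_0_iff)
qed

lemma bracket_deriv2: "bracket (bracket x y) z = bracket x (bracket y z) - bracket y (bracket x z)"
  using bracket_deriv[of x y z] by simp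

lemma span_bracket_closed:
  assumes "\<And>a b. a \<in> A \<Longrightarrow> b \<in> B \<Longrightarrow> bracket a b \<in> U" and "subspace U"
    and x: "x \<in> span A" and y: "y \<in> span B"
  shows "bracket x y \<in> U"
proof -
  have 1: "bracket a y \<in> U" if a: "a \<in> A" for a
    using y
  proof (induction rule: span_induct_alt)
    case base then show ?case using assms(2) by (simp add: subspace_0)
  next
    case (step c b u) then show ?case using assms(1)[OF a, of b] assms(2)
      by (simp add: bracket_add_right bracket_scale_right subspace_add subspace_scale)
  qed
  show ?thesis using x
  proof (induction rule: span_induct_alt)
    case base then show ?case using assms(2) by (simp add: subspace_0)
  next
    case (step c b u) then show ?case using 1[of b] assms(2)
      by (simp add: bracket_add_left bracket_scale_left subspace_add subspace_scale)
  qed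
qed

lemma subspace_scale_cancel:
  assumes "subspace U" "c *s x \<in> U" "c \<noteq> 0" shows "x \<in> U"
proof -
  have "(1 / c) *s (c *s x) \<in> U" using assms(1,2) by (rule subspace_scale)
  then show ?thesis using assms(3) by simp
qed

text \<open>The operator \<open>ad h - c j\<close> preserves \<open>U\<close>, kills the summand of
  index \<open>j\<close> and multiplies the others by nonzero factors, so induction on
  \<open>I\<close> separates the summands.\<close>

lemma eigenvector_sum_mem:
  assumes "finite I" "subspace U" "\<And>x. x \<in> U \<Longrightarrow> bracket h x \<in> U"
    "\<And>i. i \<in> I \<Longrightarrow> bracket h (y i) = c i *s y i" "inj_on c I" "sum y I \<in> U" "i \<in> I"
  shows "y i \<in> U"
  using assms(1,4-)
proof (induction I arbitrary: y i rule: finite_induct)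
  case empty then show ?case by simp
next
  case (insert j J)
  have U: "sum y (insert j J) \<in> U" by fact
  have "bracket h (sum y (insert j J)) - c j *s sum y (insert j J) \<in> U"
    using U assms(2,3) by (simp add: subspace_diff subspace_scale)
  also have "bracket h (sum y (insert j J)) - c j *s sum y (insert j J)
     = (\<Sum>i\<in>J. (c i - c j) *s y i)"
    using insert(1,2,4) by (simp add: bracket_sum_right bracket_add_right scale_right_distrib
       scale_sum_right scale_left_diff_distrib sum_subtractf)
  finally have S: "(\<Sum>i\<in>J. (c i - c j) *s y i) \<in> U" .
  have J: "y i \<in> U" if i: "i \<in> J" for i
  proof -
    have "bracket h ((c l - c j) *s y l) = c l *s (c l - c j) *s y l" if "l \<in> J" for l
      using insert(4)[of l] that by (simp add: bracket_scale_right mult.commute)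
    moreover have "inj_on c J" using insert(5) by (auto intro: inj_on_subset)
    ultimately have "(c i - c j) *s y i \<in> U"
      using S i by (intro insert.IH[of "\<lambda>l. (c l - c j) *s y l" i]) auto
    moreover have "c i - c j \<noteq> 0" using insert(2,5) i by (auto simp: inj_on_def)
    ultimately show ?thesis by (rule subspace_scale_cancel[OF assms(2)])
  qed
  have "y j = sum y (insert j J) - sum y J" using insert by simp
  also have "\<dots> \<in> U" by (rule subspace_diff[OF assms(2) U subspace_sum[OF assms(2) J]])
  finally show ?case using J insert(7) by auto
qed

text \<open>Indexing the summands by their eigenvalues makes these distinct by construction, as
  \<open>eigenvector_sum_mem\<close> requires.\<close>

lemma ad_semisimple_split:
  assumes "ad_semisimple h"
  obtains I y where "finite I" "\<And>i. i \<in> I \<Longrightarrow> bracket h (y i) = i *s y i" "x = sum y I"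
proof -
  have "x \<in> span {y. \<exists>c. bracket h y = c *s y}" using assms by (simp add: ad_semisimple_def)
  then have "\<exists>I y. finite I \<and> (\<forall>i\<in>I. bracket h (y i) = i *s y i) \<and> x = sum y I"
  proof (induction rule: span_induct_alt)
    case base show ?case by (rule exI[of _ "{}"]) auto
  next
    case (step a b u)
    then obtain I y c where I: "finite I" "\<forall>i\<in>I. bracket h (y i) = i *s y i" "u = sum y I"
      and c: "bracket h b = c *s b" by auto
    \<comment> \<open>A new eigenvector joins the summand of its eigenvalue if there is one already;
      \<open>y\<close> is arbitrary outside \<open>I\<close>, hence the default value 0.\<close>
    define y' where "y' i = (if i \<in> I then y i else 0) + (if i = c then a *s b else 0)" for i
    have "sum y' (insert c I) = (\<Sum>i\<in>insert c I. if i \<in> I then y i else 0)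
       + (\<Sum>i\<in>insert c I. if i = c then a *s b else 0)"
      by (simp add: y'_def[abs_def] sum.distrib)
    also have "(\<Sum>i\<in>insert c I. if i \<in> I then y i else 0) = (\<Sum>i\<in>I. y i)"
      using I(1) by (intro sum.mono_neutral_cong_right) auto
    also have "(\<Sum>i\<in>insert c I. if i = c then a *s b else 0) = a *s b"
      using I(1) by (subst sum.delta) auto
    finally have "a *s b + u = sum y' (insert c I)" using I by simp
    moreover have "\<forall>i\<in>insert c I. bracket h (y' i) = i *s y' i"
      using I c by (auto simp: y'_def bracket_add_right bracket_scale_right scale_right_distrib mult.commute)
    ultimately show ?case using I by (intro exI[of _ "insert c I"] exI[of _ y']) auto
  qed
  then show thesis using that by blast
qed

text \<open>A joint eigenvector for \<open>F\<close> splits into eigenvectors of \<open>h\<close>.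
  Since \<open>h\<close> commutes with \<open>F\<close>, the joint eigenspace \<open>U\<close> is
  stable under \<open>h\<close> and contains these parts.\<close>

lemma simultaneous_eigenvectors_span:
  assumes "finite F" "\<And>h. h \<in> F \<Longrightarrow> ad_semisimple h"
    "\<And>h h'. h \<in> F \<Longrightarrow> h' \<in> F \<Longrightarrow> bracket h h' = 0"
  shows "span {x. \<forall>h\<in>F. \<exists>c. bracket h x = c *s x} = UNIV"
  using assms
proof (induction F rule: finite_induct)
  case empty then show ?case by simp
next
  case (insert h F)
  let ?E = "\<lambda>F. {x. \<forall>h\<in>F. \<exists>c. bracket h x = c *s x}"
  have IH: "span (?E F) = UNIV" using insert by auto
  have "x \<in> span (?E (insert h F))" if x: "x \<in> ?E F" for x
  proof -
    obtain c where c: "\<And>f. f \<in> F \<Longrightarrow> bracket f x = c f *s x" using x by simp metis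
    obtain I y where I: "finite I" "\<And>i. i \<in> I \<Longrightarrow> bracket h (y i) = i *s y i" "x = sum y I"
      using ad_semisimple_split[of h x] insert by auto
    define U where "U = {z. \<forall>f\<in>F. bracket f z = c f *s z}"
    have "subspace U" unfolding subspace_def U_def
      by (auto simp: bracket_add_right bracket_scale_right scale_right_distrib mult.commute)
    moreover have "bracket h z \<in> U" if "z \<in> U" for z
    proof -
      have "bracket f (bracket h z) = c f *s bracket h z" if f: "f \<in> F" for f
        using that \<open>z \<in> U\<close> insert(5)[of f h] bracket_deriv[of f h z]
        by (simp add: U_def bracket_scale_right)
      then show ?thesis by (simp add: U_def)
    qed
    moreover have "sum y I \<in> U" using I(3) c by (simp add: U_def)
    ultimately have "y i \<in> U" if "i \<in> I" for i
      using eigenvector_sum_mem[of I U h y "\<lambda>i. i" i] I that by auto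
    then have "y i \<in> ?E (insert h F)" if "i \<in> I" for i
      using that I(2) by (auto simp: U_def)
    then show ?thesis unfolding I(3) by (intro span_sum span_base)
  qed
  then have "span (?E F) \<subseteq> span (?E (insert h F))"
    by (metis (no_types, lifting) span_minimal subsetI subspace_span)
  then show ?case using IH by auto
qed

end

section \<open>Weights and roots of a Cartan subalgebra, before a Borel subalgebra is chosen\<close>

locale simple_lie_cartan = simple_lie_algebra scale bracket
  for scale :: "complex \<Rightarrow> 'g::ab_group_add \<Rightarrow> 'g" (infixr \<open>*s\<close> 75) and bracket +
  fixes H :: "'g set"
  assumes cartan: "cartan_subalgebra H"
begin

abbreviation wspace :: "('g \<Rightarrow> complex) \<Rightarrow> 'g set" where
  "wspace \<equiv> root_space UNIV H"

abbreviation roots_H :: "('g \<Rightarrow> complex) set" where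
  "roots_H \<equiv> roots UNIV H"

lemma subspace_H: "subspace H" and abelian_H: "\<And>h h'. h \<in> H \<Longrightarrow> h' \<in> H \<Longrightarrow> bracket h h' = 0"
  and ad_semisimple_H: "\<And>h. h \<in> H \<Longrightarrow> ad_semisimple h"
  using cartan by (auto simp: cartan_subalgebra_def subalgebra_def abelian_def)

text \<open>Adjoining \<open>x\<close> to \<open>H\<close> gives an abelian subalgebra, and
  \<open>H\<close> is maximal among these.\<close>

lemma centralizer_H:
  assumes "\<And>h. h \<in> H \<Longrightarrow> bracket h x = 0"
  shows "x \<in> H"
proof -
  let ?K = "span (insert x H)"
  have "bracket y z \<in> {0}" if "y \<in> ?K" "z \<in> ?K" for y z
  proof (rule span_bracket_closed[OF _ _ that])
    fix a b assume "a \<in> insert x H" "b \<in> insert x H"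
    then show "bracket a b \<in> {0}" using assms abelian_H bracket_self bracket_anti[of x] by auto
  qed (rule subspace_single_0)
  then have "abelian ?K" "subalgebra ?K" by (auto simp: abelian_def subalgebra_def span_zero)
  moreover have "H \<subseteq> ?K" by (meson span_superset subset_insertI subset_trans)
  ultimately have "?K = H" using cartan unfolding cartan_subalgebra_def by blast
  then show ?thesis by (metis insertI1 span_base)
qed

lemma wspace_iff: "x \<in> wspace a \<longleftrightarrow> (\<forall>h\<in>H. bracket h x = a h *s x)"
  by (simp add: root_space_def)

lemma gsD: "x \<in> wspace a \<Longrightarrow> h \<in> H \<Longrightarrow> bracket h x = a h *s x"
  by (simp add: wspace_iff)

lemma subspace_wspace: "subspace (wspace a)"
  by (auto simp: subspace_def wspace_iff bracket_add_right bracket_scale_right scale_right_distrib mult.commute)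

lemma wspace_0: "wspace 0 = H"
  using centralizer_H abelian_H by (auto simp: wspace_iff)

lemma bracket_wspace: "x \<in> wspace a \<Longrightarrow> y \<in> wspace b \<Longrightarrow> bracket x y \<in> wspace (a + b)"
  unfolding wspace_iff by (auto simp only: bracket_deriv[of _ x y] plus_fun_apply bracket_scale_left bracket_scale_right scale_left_distrib)

lemma zero_in_wspace [simp]: "0 \<in> wspace a"
  by (simp add: wspace_iff)

lemma dual_D: "a \<in> dual H \<Longrightarrow> x \<in> H \<Longrightarrow> y \<in> H \<Longrightarrow> a (x + y) = a x + a y"
  "a \<in> dual H \<Longrightarrow> x \<in> H \<Longrightarrow> a (c *s x) = c * a x"
  "a \<in> dual H \<Longrightarrow> x \<notin> H \<Longrightarrow> a x = 0"
  by (auto simp: dual_def)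

lemma H_closed: "0 \<in> H" "x \<in> H \<Longrightarrow> y \<in> H \<Longrightarrow> x + y \<in> H" "x \<in> H \<Longrightarrow> y \<in> H \<Longrightarrow> x - y \<in> H"
  "x \<in> H \<Longrightarrow> c *s x \<in> H" "x \<in> H \<Longrightarrow> - x \<in> H"
  using subspace_H by (auto simp: subspace_0 subspace_add subspace_diff subspace_scale subspace_neg)

lemma dual_diff: "a \<in> dual H \<Longrightarrow> x \<in> H \<Longrightarrow> y \<in> H \<Longrightarrow> a (x - y) = a x - a y"
  and dual_neg: "a \<in> dual H \<Longrightarrow> x \<in> H \<Longrightarrow> a (- x) = - a x"
  and dual_0: "a \<in> dual H \<Longrightarrow> a 0 = 0"
proof -
  show 1: "a 0 = 0" if "a \<in> dual H" for a using dual_D(2)[OF that H_closed(1), of 0] by simp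
  show 2: "a (- x) = - a x" if "a \<in> dual H" "x \<in> H" for a x
    using dual_D(2)[OF that, of "-1"] by simp
  show "a (x - y) = a x - a y" if "a \<in> dual H" "x \<in> H" "y \<in> H" for a x y
    using dual_D(1)[OF that(1,2), of "-y"] that 2 by (simp add: H_closed)
qed

lemma dual_closed: "0 \<in> dual H" "a \<in> dual H \<Longrightarrow> b \<in> dual H \<Longrightarrow> a + b \<in> dual H"
  "a \<in> dual H \<Longrightarrow> - a \<in> dual H" "a \<in> dual H \<Longrightarrow> of_int n * a \<in> dual H"
  "a \<in> dual H \<Longrightarrow> of_nat m * a \<in> dual H"
  "a \<in> dual H \<Longrightarrow> b \<in> dual H \<Longrightarrow> a - b \<in> dual H"
  by (auto simp: dual_def algebra_simps)

lemma roots_H_iff: "a \<in> roots_H \<longleftrightarrow> a \<in> dual H \<and> a \<noteq> 0 \<and> wspace a \<noteq> {0}"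
  by (simp add: roots_def zero_fun_def)

lemma roots_H_dual: "a \<in> roots_H \<Longrightarrow> a \<in> dual H"
  by (simp add: roots_H_iff)

lemma roots_H_obtain: assumes "a \<in> roots_H" obtains x where "x \<in> wspace a" "x \<noteq> 0"
  using assms zero_in_wspace[of a] by (auto simp: roots_H_iff)

lemma roots_HI: "a \<in> dual H \<Longrightarrow> a \<noteq> 0 \<Longrightarrow> x \<in> wspace a \<Longrightarrow> x \<noteq> 0 \<Longrightarrow> a \<in> roots_H"
  by (auto simp: roots_H_iff)

lemma zero_notin_roots_H [simp]: "0 \<notin> roots_H"
  by (simp add: roots_H_iff)

lemma roots_H_apply_0: "a \<in> roots_H \<Longrightarrow> x \<notin> H \<Longrightarrow> a x = 0"
  by (simp add: roots_H_dual dual_D)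

text \<open>Being an eigenvector passes from the generators \<open>F\<close> to their span, and the
  eigenvalue is linear because \<open>x\<close> is nonzero. Setting it to 0 outside \<open>H\<close>
  matches the encoding of \<open>dual\<close>.\<close>

lemma weight_functional:
  assumes F: "finite F" "span F = H" and x: "x \<noteq> 0" "\<forall>h\<in>F. \<exists>c. bracket h x = c *s x"
  shows "\<exists>a\<in>dual H. x \<in> wspace a"
proof -
  have ex: "\<exists>c. bracket h x = c *s x" if "h \<in> H" for h
    using that unfolding F(2)[symmetric]
  proof (induction rule: span_induct_alt)
    case base show ?case by (rule exI[of _ 0]) simp
  next
    case (step c h u)
    then obtain d e where "bracket h x = d *s x" "bracket u x = e *s x" using x by blast
    then show ?case
      by (intro exI[of _ "c * d + e"]) (simp add: bracket_add_left bracket_scale_left scale_left_distrib)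
  qed
  define a where "a h = (if h \<in> H then (THE c. bracket h x = c *s x) else 0)" for h
  have a: "bracket h x = a h *s x" if "h \<in> H" for h
  proof -
    from ex[OF that] obtain c where c: "bracket h x = c *s x" by blast
    then have "(THE c. bracket h x = c *s x) = c"
      by (rule the_equality) (use c x(1) in \<open>auto simp: scale_cancel_right\<close>)
    then show ?thesis using c that by (simp add: a_def)
  qed
  have "a \<in> dual H" unfolding dual_def
  proof (intro CollectI conjI ballI allI impI)
    fix g h assume gh: "g \<in> H" "h \<in> H"
    then have "(a (g + h) - (a g + a h)) *s x = 0"
      using a[of g] a[of h] a[of "g + h"]
      by (simp add: H_closed scale_left_diff_distrib scale_left_distrib bracket_add_left)
    then show "a (g + h) = a g + a h" using x(1) by simp
  next
    fix c h assume h: "h \<in> H"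
    then have "(a (c *s h) - c * a h) *s x = 0"
      using a[OF h] a[OF H_closed(4)[OF h, of c]] by (auto simp: scale_left_diff_distrib bracket_scale_left)
    then show "a (c *s h) = c * a h" using x(1) by simp
  qed (simp add: a_def)
  then show ?thesis using a by (auto simp: wspace_iff)
qed

lemma finite_generators: obtains F where "finite F" "span F = H"
proof -
  obtain S where S: "finite S" "span S = UNIV" using finite_dim by blast
  obtain F where F: "F \<subseteq> H" "independent F" "H \<subseteq> span F" using maximal_independent_subset by blast
  have "finite F" using independent_span_bound[OF S(1) F(2)] S by auto
  moreover have "span F = H" using F subspace_H by (meson span_minimal subset_antisym)
  ultimately show thesis using that by blast
qed

lemma weight_spaces_span: "span (\<Union>a\<in>insert 0 roots_H. wspace a) = UNIV"
proof -
  obtain F where F: "finite F" "span F = H" by (rule finite_generators)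
  have FH: "F \<subseteq> H" using F span_superset by blast
  have "span {x. \<forall>h\<in>F. \<exists>c. bracket h x = c *s x} = UNIV"
    using F(1) FH by (intro simultaneous_eigenvectors_span) (auto intro: ad_semisimple_H abelian_H)
  moreover have "{x. \<forall>h\<in>F. \<exists>c. bracket h x = c *s x} \<subseteq> (\<Union>a\<in>insert 0 roots_H. wspace a)"
  proof
    fix x assume x: "x \<in> {x. \<forall>h\<in>F. \<exists>c. bracket h x = c *s x}"
    show "x \<in> (\<Union>a\<in>insert 0 roots_H. wspace a)"
    proof (cases "x = 0")
      case False
      then obtain a where "a \<in> dual H" "x \<in> wspace a" using weight_functional[OF F False] x by blast
      then show ?thesis using False by (cases "a = 0") (auto intro: roots_HI)
    qed auto
  qed
  ultimately show ?thesis using span_mono by blast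
qed

text \<open>The argument of \<open>eigenvector_sum_mem\<close>, with a separating element that
  depends on the pair of weights. It lies in \<open>H\<close> because all weights vanish outside
  \<open>H\<close>.\<close>

lemma weight_sum_mem:
  assumes "finite I" "I \<subseteq> dual H" "subspace U" "\<And>h x. h \<in> H \<Longrightarrow> x \<in> U \<Longrightarrow> bracket h x \<in> U"
    "\<And>a. a \<in> I \<Longrightarrow> y a \<in> wspace a" "sum y I \<in> U" "a \<in> I"
  shows "y a \<in> U"
  using assms(1,2,5-)
proof (induction I arbitrary: y a rule: finite_induct)
  case empty then show ?case by simp
next
  case (insert b J)
  have U: "sum y (insert b J) \<in> U" by fact
  have J: "y a \<in> U" if a: "a \<in> J" for a
  proof -
    have "a \<noteq> b" using a insert by auto
    then obtain h where h: "a h \<noteq> b h" by auto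
    have hH: "h \<in> H" using h a insert by (metis dual_D(3) insert_subset subset_iff)
    have "bracket h (sum y (insert b J)) - b h *s sum y (insert b J) \<in> U"
      using U assms(3,4) hH by (simp add: subspace_diff subspace_scale)
    also have "bracket h (sum y (insert b J)) - b h *s sum y (insert b J)
       = (\<Sum>c\<in>J. (c h - b h) *s y c)"
    proof -
      have "bracket h (y c) = c h *s y c" if "c \<in> insert b J" for c
        using gsD[OF insert(5)[OF that] hH] .
      then show ?thesis using insert(1,2) by (simp add: bracket_sum_right bracket_add_right
         scale_right_distrib scale_sum_right scale_left_diff_distrib sum_subtractf)
    qed
    finally have "(\<Sum>c\<in>J. (c h - b h) *s y c) \<in> U" .
    moreover have "(c h - b h) *s y c \<in> wspace c" if "c \<in> J" for c
      using insert(5)[of c] that subspace_scale[OF subspace_wspace] by blast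
    moreover have "J \<subseteq> dual H" using insert(4) by blast
    ultimately have "(a h - b h) *s y a \<in> U"
      using a by (intro insert.IH[of "\<lambda>c. (c h - b h) *s y c" a]) auto
    moreover have "a h - b h \<noteq> 0" using h by simp
    ultimately show ?thesis by (rule subspace_scale_cancel[OF assms(3)])
  qed
  have "y b = sum y (insert b J) - sum y J" using insert by simp
  also have "\<dots> \<in> U" by (rule subspace_diff[OF assms(3) U subspace_sum[OF assms(3) J]])
  finally show ?case using J insert by auto
qed

lemma weight_sum_zero:
  assumes "finite I" "I \<subseteq> dual H" "\<And>a. a \<in> I \<Longrightarrow> y a \<in> wspace a" "sum y I = 0" "a \<in> I"
  shows "y a = 0"
  using weight_sum_mem[of I "{0}" y a] assms by (auto simp: subspace_single_0)

text \<open>Nonzero vectors from distinct root spaces are independent, so finite dimension bounds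
  the number of roots.\<close>

lemma finite_roots_H: "finite roots_H"
proof -
  obtain S where S: "finite S" "span S = UNIV" using finite_dim by blast
  define r where "r a = (SOME x. x \<in> wspace a \<and> x \<noteq> 0)" for a
  have r: "r a \<in> wspace a" "r a \<noteq> 0" if "a \<in> roots_H" for a
    using someI_ex[of "\<lambda>x. x \<in> wspace a \<and> x \<noteq> 0"] roots_H_obtain[OF that] unfolding r_def by blast+
  have inj: "inj_on r roots_H"
  proof (rule inj_onI, rule ccontr)
    fix a b assume ab: "a \<in> roots_H" "b \<in> roots_H" "r a = r b" "a \<noteq> b"
    define y where "y c = (if c = a then r a else - r b)" for c
    have "y a = 0"
      by (rule weight_sum_zero[of "{a, b}"])
        (use ab r(1)[OF ab(1)] r(1)[OF ab(2)] subspace_neg[OF subspace_wspace] in \<open>auto simp: y_def roots_H_dual\<close>)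
    then show False using r(2) ab by (auto simp: y_def)
  qed
  have "independent (r ` roots_H)"
  proof (unfold independent_explicit_finite_subsets, intro allI impI ballI)
    fix T c x assume T: "T \<subseteq> r ` roots_H" "finite T" "(\<Sum>x\<in>T. c x *s x) = 0" "x \<in> T"
    obtain J where J: "J \<subseteq> roots_H" "T = r ` J" using T(1) by (meson subset_imageE)
    have injJ: "inj_on r J" using inj J(1) inj_on_subset by blast
    have fJ: "finite J" using T(2) J injJ by (simp add: finite_image_iff)
    obtain a where a: "a \<in> J" "x = r a" using T(4) J by blast
    have "(\<Sum>a\<in>J. c (r a) *s r a) = 0" using T(3) J(2) injJ by (simp add: sum.reindex)
    then have "c (r a) *s r a = 0"
      using fJ J(1) a r subspace_scale[OF subspace_wspace]
      by (intro weight_sum_zero[of J "\<lambda>a. c (r a) *s r a"]) (auto dest: roots_H_dual)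
    then show "c x = 0" using a r J(1) by auto
  qed
  then have "finite (r ` roots_H)" using independent_span_bound[OF S(1)] S(2) by auto
  then show ?thesis using inj finite_imageD by blast
qed

lemma span_weight_sum:
  assumes "finite I" "x \<in> span (\<Union>a\<in>I. wspace a)"
  obtains y where "\<And>a. a \<in> I \<Longrightarrow> y a \<in> wspace a" "x = sum y I"
proof -
  have "\<exists>y. (\<forall>a\<in>I. y a \<in> wspace a) \<and> x = sum y I" using assms(2)
  proof (induction rule: span_induct_alt)
    case base show ?case by (rule exI[of _ "\<lambda>_. 0"]) auto
  next
    case (step c b u)
    then obtain y a where y: "\<forall>a\<in>I. y a \<in> wspace a" "u = sum y I" and a: "a \<in> I" "b \<in> wspace a" by auto
    have "c *s b + u = (\<Sum>i\<in>I. (if i = a then c *s b else 0) + y i)"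
      using assms(1) a y by (simp add: sum.distrib)
    moreover have "\<forall>i\<in>I. (if i = a then c *s b else 0) + y i \<in> wspace i"
      using y a by (auto simp: subspace_add[OF subspace_wspace] subspace_scale[OF subspace_wspace])
    ultimately show ?case by (intro exI[of _ "\<lambda>i. (if i = a then c *s b else 0) + y i"]) simp
  qed
  then show thesis using that by blast
qed

lemma weight_decomp:
  obtains y where "\<And>a. a \<in> insert 0 roots_H \<Longrightarrow> y a \<in> wspace a" "x = sum y (insert 0 roots_H)"
  using span_weight_sum[of "insert 0 roots_H" x] weight_spaces_span finite_roots_H by auto

lemma insert_roots_H_dual: "insert 0 roots_H \<subseteq> dual H"
  using dual_closed(1) roots_H_dual by auto

lemma stable_subspace_eq_span:
  assumes "subspace U" "\<And>h x. h \<in> H \<Longrightarrow> x \<in> U \<Longrightarrow> bracket h x \<in> U"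
  shows "U = span (\<Union>a\<in>insert 0 roots_H. wspace a \<inter> U)"
proof
  show "U \<subseteq> span (\<Union>a\<in>insert 0 roots_H. wspace a \<inter> U)"
  proof
    fix x assume x: "x \<in> U"
    obtain y where y: "\<And>a. a \<in> insert 0 roots_H \<Longrightarrow> y a \<in> wspace a" "x = sum y (insert 0 roots_H)"
      using weight_decomp by blast
    have "y a \<in> U" if "a \<in> insert 0 roots_H" for a
      using weight_sum_mem[of "insert 0 roots_H" U y a] finite_roots_H insert_roots_H_dual assms y x that by blast
    then show "x \<in> span (\<Union>a\<in>insert 0 roots_H. wspace a \<inter> U)" unfolding y(2) using y(1)
      by (intro span_sum span_base) blast
  qed
  show "span (\<Union>a\<in>insert 0 roots_H. wspace a \<inter> U) \<subseteq> U" using assms(1) by (intro span_minimal) auto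
qed

text \<open>The centre is an ideal, and it is proper because the algebra is not abelian.\<close>

lemma center_zero:
  assumes "\<And>y. bracket x y = 0" shows "x = 0"
proof -
  have "bracket (bracket z u) y = 0" if "\<forall>y. bracket u y = 0" for z u y
    using that by (simp only: bracket_deriv2[of z u y]) simp
  moreover have "subspace {x. \<forall>y. bracket x y = 0}"
    by (auto simp: subspace_def bracket_add_left bracket_scale_left)
  ultimately have "lie_ideal {x. \<forall>y. bracket x y = 0}"
    unfolding lie_ideal_def by blast
  then have "{x. \<forall>y. bracket x y = 0} = {0} \<or> {x. \<forall>y. bracket x y = 0} = UNIV" by (rule simple)
  moreover have "{x. \<forall>y. bracket x y = 0} \<noteq> UNIV" using not_abelian by (auto simp: abelian_def)
  ultimately show ?thesis using assms by blast
qed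

text \<open>An element of \<open>H\<close> killed by all roots commutes with every weight vector, so
  it is central. Equalities in \<open>H\<close> are later tested on roots in this way, in place of a
  nondegenerate form.\<close>

lemma roots_separate:
  assumes "h \<in> H" "\<And>a. a \<in> roots_H \<Longrightarrow> a h = 0" shows "h = 0"
proof (rule center_zero)
  fix y
  obtain z where z: "\<And>a. a \<in> insert 0 roots_H \<Longrightarrow> z a \<in> wspace a" "y = sum z (insert 0 roots_H)"
    using weight_decomp by blast
  have "bracket h (z a) = 0" if "a \<in> insert 0 roots_H" for a
    using gsD[OF z(1)[OF that] assms(1)] assms(2) that by auto
  then show "bracket h y = 0" unfolding z(2) by (simp add: bracket_sum_right)
qed

text \<open>With \<open>H = {0}\<close> a functional that vanishes outside \<open>H\<close> is zero
  everywhere. So there are no roots, and the whole algebra is \<open>wspace 0 = H\<close>.\<close>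

lemma H_nonzero: "H \<noteq> {0}"
proof
  assume H: "H = {0}"
  have "roots_H = {}"
  proof (rule ccontr)
    assume "roots_H \<noteq> {}"
    then obtain a where a: "a \<in> roots_H" by blast
    have "a x = 0" for x using dual_0[OF roots_H_dual[OF a]] roots_H_apply_0[OF a, of x] H by (cases "x = 0") auto
    then have "a = 0" by (simp add: fun_eq_iff)
    then show False using a by simp
  qed
  then have "span H = UNIV" using weight_spaces_span by (simp add: wspace_0)
  then have "H = UNIV" using subspace_H span_eq_iff by metis
  then show False using not_abelian abelian_H by (auto simp: abelian_def)
qed

end

section \<open>Root spaces and \<open>sl2\<close>-triples\<close>

context complex_lie_algebra
begin

text \<open>The parameter \<open>a\<close> covers two cases at once: \<open>a = 2\<close> is an
  sl2-triple, \<open>a = 0\<close> a Heisenberg triple, where for \<open>l \<noteq> 0\<close> the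
  coefficient of the second equation never vanishes.\<close>

lemma primitive_vector_powers:
  assumes "bracket e f = h" "bracket h f = (- a) *s f" "bracket e u = 0" "bracket h u = l *s u"
  shows "bracket h ((bracket f ^^ n) u) = (l - a * of_nat n) *s (bracket f ^^ n) u \<and>
    bracket e ((bracket f ^^ Suc n) u) = (of_nat (Suc n) * (l - a * of_nat n / 2)) *s (bracket f ^^ n) u"
proof (induction n)
  case 0
  have "bracket e (bracket f u) = bracket (bracket e f) u + bracket f (bracket e u)" by (rule bracket_deriv)
  then show ?case using assms by simp
next
  case (Suc n)
  define w where "w = (bracket f ^^ Suc n) u"
  have w: "w = bracket f ((bracket f ^^ n) u)" by (simp add: w_def)
  have "bracket h w = bracket (bracket h f) ((bracket f ^^ n) u) + bracket f (bracket h ((bracket f ^^ n) u))"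
    unfolding w by (rule bracket_deriv)
  also have "\<dots> = (- a) *s w + (l - a * of_nat n) *s w"
    using Suc assms(2) by (simp only: bracket_scale_left bracket_scale_right w)
  also have "\<dots> = (l - a * of_nat (Suc n)) *s w"
    by (simp only: scale_left_distrib[symmetric]) (simp add: algebra_simps)
  finally have h: "bracket h w = (l - a * of_nat (Suc n)) *s w" .
  have "bracket e (bracket f w) = bracket h w + bracket f (bracket e w)"
    using bracket_deriv[of e f w] assms(1) by simp
  also have "bracket e w = (of_nat (Suc n) * (l - a * of_nat n / 2)) *s (bracket f ^^ n) u"
    using Suc by (simp add: w_def)
  also have "bracket f \<dots> = (of_nat (Suc n) * (l - a * of_nat n / 2)) *s w"
    by (simp only: bracket_scale_right w)
  also have "bracket h w + \<dots> = (of_nat (Suc (Suc n)) * (l - a * of_nat (Suc n) / 2)) *s w"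
    unfolding h by (simp only: scale_left_distrib[symmetric]) (simp add: field_simps)
  finally show ?case using h by (simp add: w_def)
qed

end

section \<open>Nilpotent root vectors and weight strings\<close>

context simple_lie_cartan
begin

lemma funpow_wspace: "f \<in> wspace a \<Longrightarrow> x \<in> wspace b \<Longrightarrow> (bracket f ^^ n) x \<in> wspace (b + of_nat n * a)"
proof (induction n)
  case (Suc n)
  then have "bracket f ((bracket f ^^ n) x) \<in> wspace (a + (b + of_nat n * a))"
    by (intro bracket_wspace[OF Suc(2) Suc.IH])
  moreover have "b + of_nat (Suc n) * a = a + (b + of_nat n * a)" by (simp add: fun_eq_iff algebra_simps)
  ultimately show ?case by (simp only: funpow.simps o_apply)
qed simp

lemma multiples_inj:
  assumes "a \<noteq> (0 :: 'g \<Rightarrow> complex)" shows "inj (\<lambda>n::nat. b + of_nat n * a)"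
proof (rule injI)
  fix m n :: nat assume eq: "b + of_nat m * a = b + of_nat n * a"
  obtain x where x: "a x \<noteq> 0" using assms by (auto simp: fun_eq_iff)
  have "(b + of_nat m * a) x = (b + of_nat n * a) x" using eq by simp
  then show "m = n" using x by simp
qed

text \<open>The weights \<open>b + n a\<close> are pairwise different, so only finitely many of them
  have a nonzero weight space.\<close>

lemma ad_nilpotent:
  assumes "f \<in> wspace a" "a \<in> dual H" "a \<noteq> 0" "x \<in> wspace b" "b \<in> dual H"
  shows "\<exists>n. (bracket f ^^ n) x = 0"
proof -
  have "infinite (range (\<lambda>n::nat. b + of_nat n * a))"
    using multiples_inj[OF assms(3)] finite_imageD infinite_UNIV_nat by blast
  then have "\<not> range (\<lambda>n::nat. b + of_nat n * a) \<subseteq> insert 0 roots_H"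
    using finite_roots_H finite_subset by blast
  then obtain n :: nat where n: "b + of_nat n * a \<notin> insert 0 roots_H" by blast
  moreover have "b + of_nat n * a \<in> dual H" using assms by (intro dual_closed)
  ultimately have "wspace (b + of_nat n * a) = {0}" by (auto simp: roots_H_iff)
  then show ?thesis using funpow_wspace[OF assms(1,4), of n] by auto
qed

lemma ad_top:
  assumes "f \<in> wspace a" "a \<in> dual H" "a \<noteq> 0" "x \<in> wspace b" "b \<in> dual H" "x \<noteq> 0"
  obtains j where "\<And>i. i \<le> j \<Longrightarrow> (bracket f ^^ i) x \<noteq> 0" "bracket f ((bracket f ^^ j) x) = 0"
proof -
  define n where "n = (LEAST n. (bracket f ^^ n) x = 0)"
  have n: "(bracket f ^^ n) x = 0" unfolding n_def using ad_nilpotent[OF assms(1-5)] by (rule LeastI_ex)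
  have less: "(bracket f ^^ i) x \<noteq> 0" if "i < n" for i
    using that not_less_Least unfolding n_def by blast
  have "n \<noteq> 0" using n assms(6) by (cases n) auto
  then obtain j where j: "n = Suc j" by (cases n) auto
  show thesis
    by (rule that[of j]) (use less n j in auto)
qed

text \<open>If \<open>a h = 0\<close> then \<open>e, f, h\<close> act as a Heisenberg algebra, which is impossible in finite
  dimension unless \<open>h = 0\<close>.\<close>

lemma bracket_opposite_zero:
  assumes a: "a \<in> dual H" "a \<noteq> 0" and e: "e \<in> wspace a" and f: "f \<in> wspace (- a)" and z: "a (bracket e f) = 0"
  shows "bracket e f = 0"
proof (rule roots_separate)
  let ?h = "bracket e f"
  show h: "?h \<in> H" using bracket_wspace[OF e f] by (simp add: wspace_0)
  fix b assume b: "b \<in> roots_H"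
  show "b ?h = 0"
  proof (rule ccontr)
    assume nz: "b ?h \<noteq> 0"
    obtain x where x: "x \<in> wspace b" "x \<noteq> 0" using roots_H_obtain[OF b] .
    obtain j where j: "\<And>i. i \<le> j \<Longrightarrow> (bracket e ^^ i) x \<noteq> 0" "bracket e ((bracket e ^^ j) x) = 0"
      using ad_top[OF e a x(1) roots_H_dual[OF b] x(2)] by blast
    define u where "u = (bracket e ^^ j) x"
    have u: "u \<in> wspace (b + of_nat j * a)" unfolding u_def by (rule funpow_wspace[OF e x(1)])
    have hu: "bracket ?h u = b ?h *s u" using gsD[OF u h] z by simp
    have hf: "bracket ?h f = (- 0) *s f" using gsD[OF f h] z by simp
    have "(bracket f ^^ n) u \<noteq> 0" for n
    proof (induction n)
      case 0 then show ?case using j(1) by (simp add: u_def)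
    next
      case (Suc n)
      have "bracket e ((bracket f ^^ Suc n) u) = (of_nat (Suc n) * b ?h) *s (bracket f ^^ n) u"
        using primitive_vector_powers[OF refl hf _ hu, of n] j(2) by (simp add: u_def)
      then show ?case using Suc nz by (metis bracket_zero_right mult_eq_0_iff of_nat_eq_0_iff old.nat.distinct(2) scale_eq_0_iff)
    qed
    moreover have "\<exists>n. (bracket f ^^ n) u = 0"
      using a b by (intro ad_nilpotent[OF f _ _ u]) (auto intro: dual_closed roots_H_dual)
    ultimately show False by blast
  qed
qed

text \<open>Of the usual relations only \<open>a h = 2\<close> is demanded: \<open>h\<close> lies in
  \<open>H\<close> by its weight, and then \<open>[h, e] = 2 e\<close> and
  \<open>[h, f] = - 2 f\<close> follow.\<close>

definition sl2_triple :: "('g \<Rightarrow> complex) \<Rightarrow> 'g \<Rightarrow> 'g \<Rightarrow> 'g \<Rightarrow> bool" where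
  "sl2_triple a e f h \<longleftrightarrow> a \<in> roots_H \<and> e \<in> wspace a \<and> f \<in> wspace (- a) \<and> bracket e f = h \<and> a h = 2"

lemma sl2_tripleD:
  assumes "sl2_triple a e f h"
  shows "a \<in> roots_H" "e \<in> wspace a" "f \<in> wspace (- a)" "bracket e f = h" "a h = 2" "h \<in> H" "e \<noteq> 0" "f \<noteq> 0"
    "a \<in> dual H" "a \<noteq> 0" "- a \<in> dual H" "- a \<noteq> 0" "- a \<in> roots_H" "bracket h f = (- 2) *s f"
proof -
  show 1: "a \<in> roots_H" "e \<in> wspace a" "f \<in> wspace (- a)" "bracket e f = h" "a h = 2"
    using assms by (auto simp: sl2_triple_def)
  show h: "h \<in> H" using bracket_wspace[OF 1(2,3)] 1(4) by (simp add: wspace_0)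
  have "h \<noteq> 0" using 1(5) dual_0[OF roots_H_dual[OF 1(1)]] by auto
  then show ef: "e \<noteq> 0" "f \<noteq> 0" using 1(4) by auto
  show 2: "a \<in> dual H" "a \<noteq> 0" using 1(1) by (auto simp: roots_H_iff)
  show 3: "- a \<in> dual H" "- a \<noteq> 0" using 2 dual_closed by auto
  show "- a \<in> roots_H" using 3 1 ef by (intro roots_HI[of "- a" f])
  show "bracket h f = (- 2) *s f" using gsD[OF 1(3) h] 1(5) by simp
qed

lemma sl2_triple_neg:
  assumes t: "sl2_triple a e f h" shows "sl2_triple (- a) f e (- h)"
proof -
  note T = sl2_tripleD[OF t]
  have "bracket f e = - h" using bracket_anti[of f e] T(4) by simp
  moreover have "(- a) (- h) = 2" using dual_neg[OF T(9,6)] T(5) by simp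
  ultimately show ?thesis using T(2,3,13) by (simp add: sl2_triple_def)
qed

lemma sl2_triple_exists:
  assumes a: "a \<in> roots_H" and e: "e \<in> wspace a" and f: "f \<in> wspace (- a)" and n: "bracket e f \<noteq> 0"
  obtains s where "s \<noteq> 0" "sl2_triple a e (s *s f) (s *s bracket e f)"
proof -
  have h: "bracket e f \<in> H" using bracket_wspace[OF e f] by (simp add: wspace_0)
  have "a (bracket e f) \<noteq> 0" using bracket_opposite_zero[OF roots_H_dual[OF a] _ e f] n a by (auto simp: roots_H_iff)
  then have "sl2_triple a e ((2 / a (bracket e f)) *s f) ((2 / a (bracket e f)) *s bracket e f)"
    unfolding sl2_triple_def using a e f h
    by (simp add: bracket_scale_right subspace_scale[OF subspace_wspace] dual_D(2)[OF roots_H_dual[OF a]])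
  then show thesis using that[of "2 / a (bracket e f)"] \<open>a (bracket e f) \<noteq> 0\<close> by simp
qed

text \<open>Let \<open>j\<close> be the last exponent at which lowering gives a nonzero vector.
  Raising the zero vector that follows yields the coefficient \<open>(j + 1) (b h - j)\<close>,
  which must vanish; so \<open>N\<close> is \<open>j\<close>.\<close>

lemma primitive_weight:
  assumes t: "sl2_triple a e f h" and u: "u \<in> wspace b" "u \<noteq> 0" "b \<in> dual H" "bracket e u = 0"
  obtains N :: nat where "b h = of_nat N" "\<And>i. i \<le> N \<Longrightarrow> (bracket f ^^ i) u \<noteq> 0"
    "\<And>i. bracket e ((bracket f ^^ Suc i) u) = (of_nat (Suc i) * (of_nat N - of_nat i)) *s (bracket f ^^ i) u"
proof -
  note T = sl2_tripleD[OF t]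
  obtain j where j: "\<And>i. i \<le> j \<Longrightarrow> (bracket f ^^ i) u \<noteq> 0" "bracket f ((bracket f ^^ j) u) = 0"
    using ad_top[OF T(3) T(11,12) u(1,3,2)] by blast
  have p: "bracket e ((bracket f ^^ Suc i) u) = (of_nat (Suc i) * (b h - of_nat i)) *s (bracket f ^^ i) u" for i
    using primitive_vector_powers[OF T(4) T(14) u(4) gsD[OF u(1) T(6)], of i] by simp
  have "(of_nat (Suc j) * (b h - of_nat j)) *s (bracket f ^^ j) u = 0" using p[of j] j(2) by simp
  then have "b h = of_nat j" using j(1)[of j] by (metis eq_iff_diff_eq_0 le_refl mult_eq_0_iff of_nat_eq_0_iff old.nat.distinct(2) scale_eq_0_iff)
  then show thesis using that[of j] j(1) p by simp
qed

text \<open>A vector is raised \<open>j\<close> times to the top of its string, where it is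
  primitive; from there the whole string is descended.\<close>

lemma weight_string_aux:
  assumes t: "sl2_triple a e f h" and x: "x \<in> wspace b" "x \<noteq> 0" and b: "b \<in> dual H"
  obtains j N :: nat and u where "u \<in> wspace (b + of_nat j * a)" "b h + 2 * of_nat j = of_nat N"
    "\<And>i. i \<le> N \<Longrightarrow> (bracket f ^^ i) u \<noteq> 0"
    "\<And>i. (bracket f ^^ i) u \<in> wspace (b + of_nat j * a - of_nat i * a)"
    "\<And>i. bracket e ((bracket f ^^ Suc i) u) = (of_nat (Suc i) * (of_nat N - of_nat i)) *s (bracket f ^^ i) u"
proof -
  note T = sl2_tripleD[OF t]
  obtain j where j: "\<And>i. i \<le> j \<Longrightarrow> (bracket e ^^ i) x \<noteq> 0" "bracket e ((bracket e ^^ j) x) = 0"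
    using ad_top[OF T(2,9,10) x(1) b x(2)] by blast
  define u where "u = (bracket e ^^ j) x"
  have u: "u \<in> wspace (b + of_nat j * a)" "u \<noteq> 0" "bracket e u = 0"
    unfolding u_def using funpow_wspace[OF T(2) x(1)] j by auto
  have d: "b + of_nat j * a \<in> dual H" using b T by (intro dual_closed) auto
  obtain N :: nat where N: "(b + of_nat j * a) h = of_nat N" "\<And>i. i \<le> N \<Longrightarrow> (bracket f ^^ i) u \<noteq> 0"
    "\<And>i. bracket e ((bracket f ^^ Suc i) u) = (of_nat (Suc i) * (of_nat N - of_nat i)) *s (bracket f ^^ i) u"
    using primitive_weight[OF t u(1,2) d u(3)] by blast
  have "(bracket f ^^ i) u \<in> wspace (b + of_nat j * a - of_nat i * a)" for i
    using funpow_wspace[OF T(3) u(1), of i] by (simp add: algebra_simps)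
  moreover have "b h + 2 * of_nat j = of_nat N" using N(1) T(5) by (simp add: mult.commute)
  ultimately show thesis using N u by (intro that[of u j N])
qed

lemma weight_nonzero_in: "b \<in> dual H \<Longrightarrow> x \<in> wspace b \<Longrightarrow> x \<noteq> 0 \<Longrightarrow> b \<in> insert 0 roots_H"
  by (auto simp: roots_H_iff)

text \<open>By \<open>H_nonzero\<close> zero counts as a weight too, so strings that pass through
  zero need no case distinction.\<close>

lemma weight_obtain: assumes "b \<in> insert 0 roots_H" obtains x where "x \<in> wspace b" "x \<noteq> 0"
proof (cases "b = 0")
  case True
  obtain h where "h \<in> H" "h \<noteq> 0" using H_nonzero H_closed(1) by blast
  then show thesis using that[of h] True by (simp add: wspace_0)
next
  case False
  then show thesis using assms roots_H_obtain[of b] that by blast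
qed

lemma weight_string_pos:
  assumes t: "sl2_triple a e f h" and b: "b \<in> insert 0 roots_H"
  obtains n :: int where "b h = of_int n"
    "\<And>k. 0 \<le> k \<Longrightarrow> k \<le> n \<Longrightarrow> b - of_int k * a \<in> insert 0 roots_H"
proof -
  have bd: "b \<in> dual H" using b insert_roots_H_dual by blast
  obtain x where x: "x \<in> wspace b" "x \<noteq> 0" using weight_obtain[OF b] by blast
  obtain j N :: nat and u where u: "b h + 2 * of_nat j = of_nat N"
    "\<And>i. i \<le> N \<Longrightarrow> (bracket f ^^ i) u \<noteq> 0"
    "\<And>i. (bracket f ^^ i) u \<in> wspace (b + of_nat j * a - of_nat i * a)"
    using weight_string_aux[OF t x bd] by metis
  have "b h = of_int (int N - 2 * int j)" using u(1) by (simp add: eq_diff_eq)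
  moreover have "b - of_int k * a \<in> insert 0 roots_H" if k: "0 \<le> k" "k \<le> int N - 2 * int j" for k
  proof -
    \<comment> \<open>The top of the string lies \<open>j\<close> steps above \<open>b\<close>, so
      \<open>b - k a\<close> is reached after \<open>k + j\<close> lowerings. For
      \<open>k \<le> N - 2 j\<close> this does not exceed \<open>N\<close>.\<close>
    define i where "i = nat (k + int j)"
    have i: "int i = k + int j" "i \<le> N" using k by (auto simp: i_def)
    have "of_nat i = (of_int (k + int j) :: 'g \<Rightarrow> complex)" using i(1) by (metis of_int_of_nat_eq)
    then have eq: "b + of_nat j * a - of_nat i * a = b - of_int k * a" by (simp add: algebra_simps)
    show ?thesis using u(2)[OF i(2)] u(3)[of i] bd sl2_tripleD(9)[OF t] unfolding eq
      by (intro weight_nonzero_in) (auto intro: dual_closed)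
  qed
  ultimately show thesis by (rule that)
qed

lemma weight_string:
  assumes t: "sl2_triple a e f h" and b: "b \<in> insert 0 roots_H"
  obtains n :: int where "b h = of_int n"
    "\<And>k. 0 \<le> k \<and> k \<le> n \<or> n \<le> k \<and> k \<le> 0 \<Longrightarrow> b - of_int k * a \<in> insert 0 roots_H"
proof -
  have bd: "b \<in> dual H" using b insert_roots_H_dual by blast
  obtain n where n: "b h = of_int n" "\<And>k. 0 \<le> k \<Longrightarrow> k \<le> n \<Longrightarrow> b - of_int k * a \<in> insert 0 roots_H"
    using weight_string_pos[OF t b] by blast
  obtain m where m: "b (- h) = of_int m" "\<And>k. 0 \<le> k \<Longrightarrow> k \<le> m \<Longrightarrow> b - of_int k * (- a) \<in> insert 0 roots_H"
    using weight_string_pos[OF sl2_triple_neg[OF t] b] by blast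
  have "of_int m = (of_int (- n) :: complex)" using n(1) m(1) dual_neg[OF bd sl2_tripleD(6)[OF t]] by simp
  then have mn: "m = - n" by (simp only: of_int_eq_iff)
  have "b - of_int k * a \<in> insert 0 roots_H" if "n \<le> k" "k \<le> 0" for k
    using m(2)[of "- k"] mn that by simp
  then show thesis using n that by blast
qed

text \<open>After subtraction of a suitable multiple of \<open>f\<close>, \<open>a\<close> vanishes
  on the bracket with \<open>e\<close>, so the bracket itself vanishes by
  \<open>bracket_opposite_zero\<close>. A nonzero vector left over would be primitive of weight -2,
  but such weights are natural numbers.\<close>

lemma one_dim_opposite:
  assumes t: "sl2_triple a e f h" and y: "y \<in> wspace (- a)"
  shows "\<exists>c. y = c *s f"
proof -
  note T = sl2_tripleD[OF t]
  define c where "c = a (bracket e y) / 2"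
  define y' where "y' = y - c *s f"
  have y': "y' \<in> wspace (- a)" unfolding y'_def using y T(3)
    by (intro subspace_diff subspace_scale subspace_wspace)
  have eyH: "bracket e y \<in> H" using bracket_wspace[OF T(2) y] by (simp add: wspace_0)
  have "bracket e y' = bracket e y - c *s h"
    unfolding y'_def by (simp add: bracket_diff_right bracket_scale_right T)
  then have "a (bracket e y') = a (bracket e y) - c * 2"
    using eyH T H_closed by (simp add: dual_diff dual_D)
  then have "a (bracket e y') = 0" by (simp add: c_def)
  then have e0: "bracket e y' = 0" using bracket_opposite_zero[OF T(9,10) T(2) y'] by simp
  have "y' = 0"
  proof (rule ccontr)
    assume "y' \<noteq> 0"
    then obtain N :: nat where "(- a) h = of_nat N" using primitive_weight[OF t y' _ T(11) e0] by blast
    then have "of_nat (N + 2) = (0::complex)" using T(5) by simp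
    then show False by (simp only: of_nat_eq_0_iff)
  qed
  then show ?thesis by (auto simp: y'_def)
qed

lemma one_dim:
  assumes t: "sl2_triple a e f h" and y: "y \<in> wspace a"
  shows "\<exists>c. y = c *s e"
  using one_dim_opposite[OF sl2_triple_neg[OF t]] y by simp

text \<open>The string through \<open>2 a\<close> meets the root space of \<open>a\<close>, which is
  the line of \<open>e\<close> and so is killed by \<open>e\<close>. At that place of the string,
  however, raising has a nonzero coefficient.\<close>

lemma double_not_root:
  assumes t: "sl2_triple a e f h"
  shows "a + a \<notin> roots_H"
proof
  note T = sl2_tripleD[OF t]
  assume r: "a + a \<in> roots_H"
  obtain x where x: "x \<in> wspace (a + a)" "x \<noteq> 0" using roots_H_obtain[OF r] .
  obtain u j N where u0: "u \<in> wspace (a + a + of_nat j * a)" and u1: "(a + a) h + 2 * of_nat j = of_nat N"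
    and u2: "\<And>i. i \<le> N \<Longrightarrow> (bracket f ^^ i) u \<noteq> 0"
    and u3: "\<And>i. (bracket f ^^ i) u \<in> wspace (a + a + of_nat j * a - of_nat i * a)"
    and u4: "\<And>i. bracket e ((bracket f ^^ Suc i) u) = (of_nat (Suc i) * (of_nat N - of_nat i)) *s (bracket f ^^ i) u"
    by (rule weight_string_aux[OF t x roots_H_dual[OF r]]) (rule that)
  note u = u1 u2 u3 u4
  have "of_nat (4 + 2 * j) = (of_nat N :: complex)" using u(1) T(5) by simp
  then have N: "4 + 2 * j = N" by (simp only: of_nat_eq_iff)
  have "(bracket f ^^ Suc j) u \<in> wspace a" using u(3)[of "Suc j"] by (simp add: algebra_simps)
  then obtain c where "(bracket f ^^ Suc j) u = c *s e" using one_dim[OF t] by blast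
  then have "bracket e ((bracket f ^^ Suc j) u) = 0" by (simp add: bracket_scale_right bracket_self)
  then have "(of_nat (Suc j) * (of_nat N - of_nat j)) *s (bracket f ^^ j) u = 0" using u(4)[of j] by simp
  moreover have "(bracket f ^^ j) u \<noteq> 0" using u2[of j] N by linarith
  ultimately have "of_nat (Suc j) * (of_nat N - of_nat j) = (0::complex)" unfolding scale_eq_0_iff by blast
  moreover have "of_nat (Suc j) \<noteq> (0::complex)" by (rule of_nat_neq_0)
  ultimately have "of_nat N = (of_nat j :: complex)" by (metis mult_eq_0_iff eq_iff_diff_eq_0)
  then have "N = j" by (simp only: of_nat_eq_iff)
  then show False using N by simp
qed

lemma weight_reflection:
  assumes t: "sl2_triple a e f h" and b: "b \<in> insert 0 roots_H"
  shows "(\<lambda>x. b x - b h * a x) \<in> insert 0 roots_H"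
proof -
  obtain n :: int where n: "b h = of_int n"
    "\<And>k. 0 \<le> k \<and> k \<le> n \<or> n \<le> k \<and> k \<le> 0 \<Longrightarrow> b - of_int k * a \<in> insert 0 roots_H"
    using weight_string[OF t b] by metis
  have "b - of_int n * a \<in> insert 0 roots_H" using n(2)[of n] by linarith
  moreover have "b - of_int n * a = (\<lambda>x. b x - b h * a x)" by (simp add: fun_eq_iff n(1))
  ultimately show ?thesis by simp
qed

section \<open>Every root has an sl2-triple\<close>

text \<open>Two reflections with proportional coroots compose to a transvection, which has infinite
  order unless it is trivial; as it permutes the finitely many weights, it is trivial.\<close>

lemma proportional_coroots:
  assumes c: "sl2_triple c e f h" and b: "sl2_triple b e' f' (t *s h)"
  shows "c x = t * b x"
proof (rule ccontr)
  note C = sl2_tripleD[OF c] and B = sl2_tripleD[OF b]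
  assume "c x \<noteq> t * b x"
  define d where "d y = c y - t * b y" for y
  have d: "d x \<noteq> 0" using \<open>c x \<noteq> t * b x\<close> by (simp add: d_def)
  \<comment> \<open>Both reflections together move a weight with value 2 at \<open>h\<close> by
    \<open>- 2 d\<close>. As \<open>d h = 0\<close>, the value stays 2 and the move can be repeated
    forever; \<open>m n\<close> is its \<open>n\<close>-th result from \<open>c\<close>.\<close>
  define m where "m n y = c y - 2 * of_nat n * d y" for n :: nat and y
  have "t * b h = 2" using B(5) dual_D(2)[OF B(9) C(6)] by simp
  then have dh: "d h = 0" using C(5) by (simp add: d_def)
  have mem: "m n \<in> insert 0 roots_H" for n
  proof (induction n)
    case 0 show ?case using C(1) by (simp add: m_def)
  next
    case (Suc n)
    define m' where "m' y = m n y - m n h * c y" for y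
    have mh: "m n h = 2" using dh C(5) by (simp add: m_def)
    have m': "m' \<in> insert 0 roots_H" using weight_reflection[OF c Suc] by (simp add: m'_def[abs_def])
    have "m' h = - 2" using mh C(5) by (simp add: m'_def)
    then have m'h: "m' (t *s h) = - 2 * t" using dual_D(2)[of m' h t] m' insert_roots_H_dual C(6) by (auto simp: mult.commute)
    have "(\<lambda>y. m' y - m' (t *s h) * b y) \<in> insert 0 roots_H" using weight_reflection[OF b m'] .
    moreover have "(\<lambda>y. m' y - m' (t *s h) * b y) = m (Suc n)"
      
    proof (rule ext)
      fix y
      have "m' y = m n y - 2 * c y" by (simp add: m'_def mh)
      then show "m' y - m' (t *s h) * b y = m (Suc n) y"
        unfolding m'h by (simp add: m_def d_def algebra_simps)
    qed
    ultimately show ?case by (simp only:)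
  qed
  have "inj m"
  proof (rule injI)
    fix i j assume "m i = m j"
    then have "m i x = m j x" by simp
    then show "i = j" using d by (simp add: m_def)
  qed
  then have "infinite (range m)" using finite_imageD infinite_UNIV_nat by blast
  moreover have "range m \<subseteq> insert 0 roots_H" using mem by blast
  ultimately show False using finite_roots_H finite_subset by blast
qed

lemma int_div_4:
  assumes "(m::int) * k = 4" shows "m \<in> {1, -1, 2, -2, 4, -4}"
proof -
  have "m dvd 4" using assms by (metis dvd_triv_left)
  then have "\<bar>m\<bar> \<le> 4" using dvd_imp_le_int[of 4 m] by simp
  then have "m \<in> {-4..4}" by auto
  then have "m \<in> {-4,-3,-2,-1,0,1,2,3,4}" by auto
  then show ?thesis using \<open>m dvd 4\<close> by auto
qed

text \<open>By \<open>proportional_coroots\<close>, \<open>c = t b\<close>. The Cartan integers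
  \<open>2 t\<close> and \<open>2 / t\<close> have product 4, which leaves 1, 2 and 1/2 up to sign.
  Doubles of roots exclude 2 and 1/2, and for \<open>t = - 1\<close> the weight \<open>c - b\<close>
  would be the double of a root.\<close>

lemma proportional_coroots_eq:
  assumes c: "sl2_triple c e f h" and b: "sl2_triple b e' f' (t *s h)" and r: "c - b \<in> insert 0 roots_H"
  shows "c = b"
proof -
  note C = sl2_tripleD[OF c] and B = sl2_tripleD[OF b]
  have p: "c x = t * b x" for x by (rule proportional_coroots[OF c b])
  obtain m :: int where m: "c (t *s h) = of_int m"
    using weight_string[OF b, of c] C(1) by blast
  obtain k :: int where k: "b h = of_int k"
    using weight_string[OF c, of b] B(1) by blast
  have "c (t *s h) = t * 2" using dual_D(2)[OF C(9) C(6)] C(5) by simp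
  then have tm: "2 * t = of_int m" using m by simp
  have tk: "t * of_int k = 2" using B(5) dual_D(2)[OF B(9) C(6)] k by simp
  have "of_int (m * k) = (of_int 4 :: complex)" using tm tk by (simp flip: tm)
  then have "m * k = 4" by (simp only: of_int_eq_iff)
  then have "m \<in> {1, -1, 2, -2, 4, -4}" by (rule int_div_4)
  moreover have t: "t = of_int m / 2" using tm by (simp add: field_simps)
  ultimately consider "t = 1/2" | "t = -1/2" | "t = 1" | "t = -1" | "t = 2" | "t = -2" by fastforce
  then show ?thesis
  proof cases
    case 1
    then have "b = c + c" by (simp add: fun_eq_iff p 1)
    then show ?thesis using double_not_root[OF c] B(1) by simp
  next
    case 2
    then have "b = - c + - c" by (simp add: fun_eq_iff p 2)
    then show ?thesis using double_not_root[OF sl2_triple_neg[OF c]] B(1) by simp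
  next
    case 3 then show ?thesis by (simp add: fun_eq_iff p 3)
  next
    case 4
    then have eq: "c - b = - b + - b" by (simp add: fun_eq_iff p 4)
    moreover have "- b + - b \<noteq> 0"
    proof
      assume "- b + - b = 0"
      then have "(- b + - b) (t *s h) = (0 :: 'g \<Rightarrow> complex) (t *s h)" by simp
      then show False using B(5) by simp
    qed
    ultimately have "- b + - b \<in> roots_H" using r unfolding eq by blast
    then show ?thesis using double_not_root[OF sl2_triple_neg[OF b]] by blast
  next
    case 5
    then have "c = b + b" by (simp add: fun_eq_iff p 5)
    then show ?thesis using double_not_root[OF b] C(1) by simp
  next
    case 6
    then have "c = - b + - b" by (simp add: fun_eq_iff p 6)
    then show ?thesis using double_not_root[OF sl2_triple_neg[OF b]] C(1) by simp
  qed
qed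

text \<open>Roots \<open>a\<close> with \<open>[wspace a, wspace (- a)] = 0\<close> span an ideal, so there are none.\<close>

lemma null_root_bracket:
  assumes a: "a \<in> roots_H" and null: "\<And>e f. e \<in> wspace a \<Longrightarrow> f \<in> wspace (- a) \<Longrightarrow> bracket e f = 0"
    and b: "b \<in> roots_H" and x: "x \<in> wspace a" and y: "y \<in> wspace b" and nz: "bracket x y \<noteq> 0"
    and e: "e \<in> wspace (a + b)" and f: "f \<in> wspace (- (a + b))"
  shows "bracket e f = 0"
proof (rule ccontr)
  assume ef: "bracket e f \<noteq> 0"
  let ?c = "a + b"
  have xy: "bracket x y \<in> wspace ?c" by (rule bracket_wspace[OF x y])
  have "?c \<noteq> 0" using null[OF x, of y] y nz by (auto simp: eq_neg_iff_add_eq_0[symmetric] add.commute)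
  then have cR: "?c \<in> roots_H" using xy nz by (intro roots_HI dual_closed) (use a b in \<open>auto dest: roots_H_dual\<close>)
  obtain s where s: "s \<noteq> 0" "sl2_triple ?c e (s *s f) (s *s bracket e f)"
    using sl2_triple_exists[OF cR e f ef] .
  note T = sl2_tripleD[OF s(2)]
  obtain r where r: "bracket x y = r *s e" using one_dim[OF s(2) xy] by blast
  have r0: "r \<noteq> 0" using r nz by auto
  let ?f = "s *s f" let ?h = "s *s bracket e f"
  \<comment> \<open>The vector \<open>[y, ?f]\<close> has weight \<open>- a\<close>, so its bracket
    with \<open>x\<close> vanishes. The Jacobi identity then makes \<open>[y, [x, ?f]]\<close> a
    nonzero multiple of \<open>?h\<close>: the coroots of \<open>b\<close> and \<open>a + b\<close>
    are proportional.\<close>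
  have "bracket (bracket x y) ?f = r *s ?h" unfolding r using T(4) by (simp only: bracket_scale_left)
  moreover have "bracket (bracket x y) ?f = bracket x (bracket y ?f) - bracket y (bracket x ?f)"
    by (rule bracket_deriv2)
  moreover have "bracket y ?f \<in> wspace (- a)" using bracket_wspace[OF y T(3)] by simp
  then have "bracket x (bracket y ?f) = 0" using null[OF x] by simp
  ultimately have "bracket y (bracket x ?f) = - (r *s ?h)" by (metis diff_0 minus_minus)
  then have yz: "bracket y (bracket x ?f) = (- r) *s ?h" by (simp only: scale_minus_left)
  have z: "bracket x ?f \<in> wspace (- b)" using bracket_wspace[OF x T(3)] by (simp add: algebra_simps)
  have "?h \<noteq> 0" using s ef by simp
  then have "bracket y (bracket x ?f) \<noteq> 0" using yz r0 by simp
  then obtain q where q: "q \<noteq> 0" "sl2_triple b y (q *s bracket x ?f) (q *s bracket y (bracket x ?f))"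
    using sl2_triple_exists[OF b y z] by blast
  have "sl2_triple b y (q *s bracket x ?f) ((q * - r) *s ?h)" using q(2) unfolding yz by (simp add: mult.assoc)
  then have "?c = b" by (rule proportional_coroots_eq[OF s(2)]) (use a in simp)
  then show False using a by simp
qed

lemma sl2_triple_all:
  assumes "a \<in> roots_H" obtains e f h where "sl2_triple a e f h"
proof -
  define M where "M = {a \<in> roots_H. \<forall>e\<in>wspace a. \<forall>f\<in>wspace (- a). bracket e f = 0}"
  define N where "N = span (\<Union>a\<in>M. wspace a)"
  have "bracket y x \<in> N" if x: "x \<in> N" for x y
  proof (rule span_bracket_closed[where U = N and A = "\<Union>a\<in>insert 0 roots_H. wspace a" and B = "\<Union>a\<in>M. wspace a"])
    show "y \<in> span (\<Union>a\<in>insert 0 roots_H. wspace a)" using weight_spaces_span by simp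
    show "x \<in> span (\<Union>a\<in>M. wspace a)" using x by (simp add: N_def)
    show "subspace N" by (simp add: N_def)
    fix y x assume "y \<in> (\<Union>a\<in>insert 0 roots_H. wspace a)" "x \<in> (\<Union>a\<in>M. wspace a)"
    then obtain b a where b: "b \<in> insert 0 roots_H" "y \<in> wspace b" and a: "a \<in> M" "x \<in> wspace a" by blast
    have aR: "a \<in> roots_H" using a by (simp add: M_def)
    show "bracket y x \<in> N"
    proof (cases "b = 0 \<or> bracket x y = 0")
      case True
      then have "bracket y x \<in> wspace a"
        using bracket_wspace[OF b(2) a(2)] bracket_anti[of y x] by auto
      then show ?thesis unfolding N_def using a by (intro span_base) auto
    next
      case False
      have bR: "b \<in> roots_H" using b False by auto
      have "bracket e f = 0" if "e \<in> wspace (a + b)" "f \<in> wspace (- (a + b))" for e f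
        using null_root_bracket[OF aR _ bR a(2) b(2) _ that] a False by (auto simp: M_def)
      moreover have "a + b \<noteq> 0"
      proof
        assume "a + b = 0"
        then have "b = - a" by (simp add: eq_neg_iff_add_eq_0 add.commute)
        then show False using a b False by (auto simp: M_def)
      qed
      then have "a + b \<in> roots_H" using bracket_wspace[OF a(2) b(2)] False aR bR
        by (intro roots_HI dual_closed) (auto dest: roots_H_dual)
      ultimately have ab: "a + b \<in> M" by (simp add: M_def)
      have "bracket y x \<in> wspace (a + b)" using bracket_wspace[OF b(2) a(2)] by (simp add: add.commute)
      then show ?thesis unfolding N_def using ab by (intro span_base) auto
    qed
  qed
  then have "lie_ideal N" by (simp add: lie_ideal_def N_def)
  then have "N = {0} \<or> N = UNIV" by (rule simple)
  \<comment> \<open>A nonzero element of \<open>H\<close> has weight 0 and so is no sum of root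
    vectors.\<close>
  moreover have "N \<noteq> UNIV"
  proof
    assume N: "N = UNIV"
    obtain h where h: "h \<in> H" "h \<noteq> 0" using H_nonzero H_closed(1) by blast
    have fM: "finite M" "M \<subseteq> roots_H" using finite_roots_H by (auto simp: M_def)
    obtain y where y: "\<And>a. a \<in> M \<Longrightarrow> y a \<in> wspace a" "h = sum y M"
      using span_weight_sum[OF fM(1), of h] N unfolding N_def by blast
    define y' where "y' a = (if a = 0 then - h else y a)" for a
    have M0: "0 \<notin> M" using fM by auto
    have "sum y' (insert 0 M) = - h + sum y' M" using fM M0 by (simp add: y'_def)
    also have "sum y' M = sum y M" using M0 by (intro sum.cong) (auto simp: y'_def)
    also have "- h + sum y M = 0" using y(2) by simp
    finally have "sum y' (insert 0 M) = 0" .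
    then have "y' 0 = 0"
      using fM h y insert_roots_H_dual
      by (intro weight_sum_zero[of "insert 0 M" y' 0]) (auto simp: y'_def wspace_0 H_closed)
    then show False using h by (simp add: y'_def)
  qed
  ultimately have N0: "N = {0}" by blast
  have "a \<notin> M"
  proof
    assume "a \<in> M"
    then have "wspace a \<subseteq> N" unfolding N_def using span_superset by blast
    then show False using N0 roots_H_obtain[OF assms] by blast
  qed
  then obtain e f where "e \<in> wspace a" "f \<in> wspace (- a)" "bracket e f \<noteq> 0" using assms by (auto simp: M_def)
  then show thesis using sl2_triple_exists[OF assms] that by metis
qed

end

section \<open>Coroots, root strings and reflections\<close>

context simple_lie_cartan
begin

abbreviation coroot_of :: "('g \<Rightarrow> complex) \<Rightarrow> 'g" where
  "coroot_of \<equiv> coroot UNIV H"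

text \<open>Both root spaces are lines, so their brackets span the line through \<open>h\<close>, on
  which the condition \<open>a h = 2\<close> picks out a single point.\<close>

lemma coroot_eq:
  assumes t: "sl2_triple a e f h"
  shows "coroot_of a = h"
proof -
  note T = sl2_tripleD[OF t]
  let ?S = "{bracket x y | x y. x \<in> wspace a \<and> y \<in> wspace (\<lambda>x. - a x)}"
  have na: "(\<lambda>x. - a x) = - a" by (simp add: fun_eq_iff)
  have "?S \<subseteq> span {h}"
  proof
    fix z assume "z \<in> ?S"
    then obtain x y where z: "z = bracket x y" "x \<in> wspace a" "y \<in> wspace (- a)" unfolding na by blast
    obtain c d where "x = c *s e" "y = d *s f" using one_dim[OF t z(2)] one_dim_opposite[OF t z(3)] by blast
    then show "z \<in> span {h}" using z(1) T(4)
      by (simp add: bracket_scale_left bracket_scale_right span_scale span_base)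
  qed
  then have S: "span ?S \<subseteq> span {h}" by (intro span_minimal) auto
  show ?thesis unfolding coroot_def
  proof (rule the_equality)
    show "a h = 2 \<and> h \<in> span ?S" using T unfolding na by (auto intro!: span_base)
    fix h' assume h': "a h' = 2 \<and> h' \<in> span ?S"
    then have "h' \<in> span {h}" using S by blast
    then obtain c where c: "h' = c *s h" by (auto simp: span_singleton)
    then show "h' = h" using h' dual_D(2)[OF T(9,6), of c] T(5) by simp
  qed
qed

lemma coroot_triple:
  assumes "a \<in> roots_H" obtains e f where "sl2_triple a e f (coroot_of a)"
  using sl2_triple_all[OF assms] coroot_eq by metis

lemma coroot_in_H: "a \<in> roots_H \<Longrightarrow> coroot_of a \<in> H"
  and coroot_self: "a \<in> roots_H \<Longrightarrow> a (coroot_of a) = 2"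
  and roots_H_neg: "a \<in> roots_H \<Longrightarrow> - a \<in> roots_H"
  using coroot_triple sl2_tripleD by metis+

lemma roots_H_neg_iff: "- a \<in> roots_H \<longleftrightarrow> a \<in> roots_H"
  using roots_H_neg[of a] roots_H_neg[of "- a"] by auto

lemma coroot_neg: "a \<in> roots_H \<Longrightarrow> coroot_of (- a) = - coroot_of a"
  using coroot_triple[of a] sl2_triple_neg coroot_eq by metis

lemma wspace_spanned:
  assumes "a \<in> roots_H" "x \<in> wspace a" "x \<noteq> 0" "y \<in> wspace a"
  shows "\<exists>c. y = c *s x"
proof -
  obtain e f h where t: "sl2_triple a e f h" using sl2_triple_all[OF assms(1)] .
  obtain c d where cd: "x = c *s e" "y = d *s e" using one_dim[OF t] assms by metis
  then have "y = (d / c) *s x" using assms(3) by auto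
  then show ?thesis by blast
qed

definition cartan_int :: "('g \<Rightarrow> complex) \<Rightarrow> ('g \<Rightarrow> complex) \<Rightarrow> int" where
  "cartan_int b a = (THE n. b (coroot_of a) = of_int n)"

lemma
  assumes a: "a \<in> roots_H" and b: "b \<in> insert 0 roots_H"
  shows cartan_int: "b (coroot_of a) = of_int (cartan_int b a)"
    and root_string: "\<And>k. 0 \<le> k \<and> k \<le> cartan_int b a \<or> cartan_int b a \<le> k \<and> k \<le> 0 \<Longrightarrow> b - of_int k * a \<in> insert 0 roots_H"
proof -
  obtain e f where t: "sl2_triple a e f (coroot_of a)" using coroot_triple[OF a] .
  obtain n :: int where n: "b (coroot_of a) = of_int n"
    "\<And>k. 0 \<le> k \<and> k \<le> n \<or> n \<le> k \<and> k \<le> 0 \<Longrightarrow> b - of_int k * a \<in> insert 0 roots_H"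
    using weight_string[OF t b] by metis
  have "cartan_int b a = n" unfolding cartan_int_def using n(1) by (intro the_equality) auto
  then show "b (coroot_of a) = of_int (cartan_int b a)"
    "\<And>k. 0 \<le> k \<and> k \<le> cartan_int b a \<or> cartan_int b a \<le> k \<and> k \<le> 0 \<Longrightarrow> b - of_int k * a \<in> insert 0 roots_H"
    using n by auto
qed

lemma cartan_int_neg: "a \<in> roots_H \<Longrightarrow> b \<in> roots_H \<Longrightarrow> cartan_int b a < 0 \<Longrightarrow> b + a \<in> insert 0 roots_H"
  using root_string[of a b "- 1"] by simp

lemma double_notin: "a \<in> roots_H \<Longrightarrow> a + a \<notin> roots_H"
  using sl2_triple_all double_not_root by metis

text \<open>For \<open>k \<ge> 2\<close> the Cartan integer \<open>2 k\<close> is large enough for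
  the \<open>a\<close>-string to descend from \<open>k a\<close> to \<open>2 a\<close>, which is not
  a root.\<close>

lemma multiple_of_root_pos:
  assumes a: "a \<in> roots_H" and b: "of_int k * a \<in> roots_H" shows "k < 2"
proof (rule ccontr)
  assume k: "\<not> k < 2"
  have "of_int (cartan_int (of_int k * a) a) = (of_int k * a) (coroot_of a)" using cartan_int[OF a, of "of_int k * a"] b by simp
  also have "\<dots> = of_int (2 * k)" using coroot_self[OF a] by simp
  finally have c: "cartan_int (of_int k * a) a = 2 * k" by (simp only: of_int_eq_iff)
  have "of_int k * a - of_int (k - 2) * a \<in> insert 0 roots_H"
    using b k c by (intro root_string[OF a]) auto
  moreover have "of_int k * a - of_int (k - 2) * a = a + a" by (simp add: fun_eq_iff algebra_simps)
  ultimately have "a + a = 0" using double_notin[OF a] by auto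
  then have "(a + a) (coroot_of a) = (0 :: 'g \<Rightarrow> complex) (coroot_of a)" by simp
  then show False using coroot_self[OF a] by simp
qed

lemma multiple_of_root:
  assumes a: "a \<in> roots_H" and b: "of_int k * a \<in> roots_H" shows "k = 1 \<or> k = - 1"
proof -
  have "k < 2" by (rule multiple_of_root_pos[OF a b])
  moreover have "of_int k * a = of_int (- k) * - a" by simp
  then have "- k < 2" using multiple_of_root_pos[OF roots_H_neg[OF a], of "- k"] b by metis
  moreover have "k \<noteq> 0" using b by (metis mult_zero_left of_int_0 zero_notin_roots_H)
  ultimately show ?thesis by linarith
qed

text \<open>If the bracket vanished, \<open>y\<close> would be primitive and its weight
  \<open>M\<close> a natural number. The string through \<open>a + b\<close> then has length
  \<open>N = 2 + M + 2 j\<close> and meets the line of \<open>y\<close> after \<open>j + 1\<close>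
  steps, where the coefficient of raising is nonzero since \<open>N > j\<close>.\<close>

lemma bracket_root_spaces_nonzero:
  assumes a: "a \<in> roots_H" and b: "b \<in> roots_H" and ab: "a + b \<in> roots_H" and x: "x \<in> wspace a" "x \<noteq> 0"
    and y: "y \<in> wspace b" "y \<noteq> 0"
  shows "bracket x y \<noteq> 0"
proof
  assume xy: "bracket x y = 0"
  obtain e f h where t: "sl2_triple a e f h" using sl2_triple_all[OF a] .
  note T = sl2_tripleD[OF t]
  obtain c where "e = c *s x" using wspace_spanned[OF a x T(2)] by blast
  then have ey: "bracket e y = 0" using xy by (simp add: bracket_scale_left)
  obtain M :: nat where M: "b h = of_nat M" using primitive_weight[OF t y roots_H_dual[OF b] ey] by blast
  obtain z where z: "z \<in> wspace (a + b)" "z \<noteq> 0" using roots_H_obtain[OF ab] .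
  obtain u j N where u0: "u \<in> wspace (a + b + of_nat j * a)" and u1: "(a + b) h + 2 * of_nat j = of_nat N"
    and u2: "\<And>i. i \<le> N \<Longrightarrow> (bracket f ^^ i) u \<noteq> 0"
    and u3: "\<And>i. (bracket f ^^ i) u \<in> wspace (a + b + of_nat j * a - of_nat i * a)"
    and u4: "\<And>i. bracket e ((bracket f ^^ Suc i) u) = (of_nat (Suc i) * (of_nat N - of_nat i)) *s (bracket f ^^ i) u"
    by (rule weight_string_aux[OF t z roots_H_dual[OF ab]]) (rule that)
  have "of_nat N = (of_nat (2 + M + 2 * j) :: complex)" using u1 M T(5) by (simp add: add.assoc)
  then have N: "N = 2 + M + 2 * j" by (simp only: of_nat_eq_iff)
  have "a + b + of_nat j * a - of_nat (Suc j) * a = b" by (simp add: fun_eq_iff algebra_simps)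
  then have "(bracket f ^^ Suc j) u \<in> wspace b" using u3[of "Suc j"] by (simp only:)
  then obtain d where "(bracket f ^^ Suc j) u = d *s y" using wspace_spanned[OF b y] by blast
  then have "bracket e ((bracket f ^^ Suc j) u) = 0" using ey by (simp add: bracket_scale_right)
  then have "(of_nat (Suc j) * (of_nat N - of_nat j)) *s (bracket f ^^ j) u = 0" using u4[of j] by simp
  moreover have "(bracket f ^^ j) u \<noteq> 0" using u2[of j] N by linarith
  ultimately have "of_nat (Suc j) * (of_nat N - of_nat j) = (0::complex)" unfolding scale_eq_0_iff by blast
  moreover have "of_nat (Suc j) \<noteq> (0::complex)" by (rule of_nat_neq_0)
  ultimately have "of_nat N = (of_nat j :: complex)" by (metis mult_eq_0_iff eq_iff_diff_eq_0)
  then have "N = j" by (simp only: of_nat_eq_iff)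
  then show False using N by simp
qed

lemma wspace_trivial: "a \<in> dual H \<Longrightarrow> a \<notin> insert 0 roots_H \<Longrightarrow> x \<in> wspace a \<Longrightarrow> x = 0"
  using weight_nonzero_in by blast

text \<open>If \<open>[x, z]\<close> and \<open>[y, z]\<close> both vanished, the Jacobi identity
  would kill \<open>[[x, y], z]\<close>, which is nonzero by
  \<open>bracket_root_spaces_nonzero\<close>.\<close>

lemma root_triple_sum:
  assumes "a \<in> roots_H" "b \<in> roots_H" "c \<in> roots_H" "a + b \<in> roots_H" "a + b + c \<in> roots_H"
  shows "a + c \<in> insert 0 roots_H \<or> b + c \<in> insert 0 roots_H"
proof (rule ccontr)
  assume n: "\<not> (a + c \<in> insert 0 roots_H \<or> b + c \<in> insert 0 roots_H)"
  obtain x y z where x: "x \<in> wspace a" "x \<noteq> 0" and y: "y \<in> wspace b" "y \<noteq> 0" and z: "z \<in> wspace c" "z \<noteq> 0"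
    using assms roots_H_obtain by metis
  have "bracket x y \<noteq> 0" using bracket_root_spaces_nonzero[OF assms(1,2,4) x y] .
  then have nz: "bracket (bracket x y) z \<noteq> 0"
    using bracket_root_spaces_nonzero[OF assms(4,3,5) _ _ z] bracket_wspace[OF x(1) y(1)] by blast
  have "bracket y z = 0"
    using wspace_trivial[OF _ _ bracket_wspace[OF y(1) z(1)]] n assms by (auto intro: dual_closed roots_H_dual)
  moreover have "bracket x z = 0"
    using wspace_trivial[OF _ _ bracket_wspace[OF x(1) z(1)]] n assms by (auto intro: dual_closed roots_H_dual)
  ultimately show False using nz bracket_deriv2[of x y z] by simp
qed

section \<open>Reflections and an invariant form\<close>

abbreviation reflect :: "('g \<Rightarrow> complex) \<Rightarrow> 'g \<Rightarrow> 'g" where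
  "reflect \<equiv> reflection UNIV H"

lemma reflect_in_H: "a \<in> roots_H \<Longrightarrow> x \<in> H \<Longrightarrow> reflect a x \<in> H"
  by (simp add: reflection_def H_closed coroot_in_H)

lemma reflect_outside: "a \<in> roots_H \<Longrightarrow> x \<notin> H \<Longrightarrow> reflect a x = x"
  by (simp add: reflection_def roots_H_apply_0)

lemma dual_reflect: "b \<in> dual H \<Longrightarrow> a \<in> roots_H \<Longrightarrow> x \<in> H \<Longrightarrow> b (reflect a x) = b x - b (coroot_of a) * a x"
  by (simp add: reflection_def dual_diff dual_D coroot_in_H H_closed)

lemma reflect_reflect: "a \<in> roots_H \<Longrightarrow> reflect a (reflect a x) = x"
proof (cases "x \<in> H")
  case True
  assume a: "a \<in> roots_H"
  have "a (reflect a x) = - a x" using dual_reflect[OF roots_H_dual[OF a] a True] coroot_self[OF a] by simp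
  then show ?thesis by (simp add: reflection_def)
qed (simp add: reflect_outside)

lemma reflect_linear: "a \<in> roots_H \<Longrightarrow> x \<in> H \<Longrightarrow> y \<in> H \<Longrightarrow> reflect a (x - c *s y) = reflect a x - c *s reflect a y"
  by (simp add: reflection_def dual_diff dual_D roots_H_dual H_closed algebra_simps scale_left_diff_distrib
      scale_right_diff_distrib)

lemma comp_reflect: "b \<in> dual H \<Longrightarrow> a \<in> roots_H \<Longrightarrow> b \<circ> reflect a = (\<lambda>x. b x - b (coroot_of a) * a x)"
proof
  fix x assume "b \<in> dual H" "a \<in> roots_H"
  then show "(b \<circ> reflect a) x = b x - b (coroot_of a) * a x"
    by (cases "x \<in> H") (simp_all add: dual_reflect reflect_outside roots_H_apply_0)
qed

lemma comp_reflect_cartan_int: "b \<in> roots_H \<Longrightarrow> a \<in> roots_H \<Longrightarrow> b \<circ> reflect a = b - of_int (cartan_int b a) * a"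
  by (simp add: comp_reflect roots_H_dual cartan_int fun_eq_iff)

lemma comp_reflect_reflect: "a \<in> roots_H \<Longrightarrow> b \<circ> reflect a \<circ> reflect a = b"
  by (simp add: fun_eq_iff reflect_reflect)

lemma comp_reflect_self: "a \<in> roots_H \<Longrightarrow> a \<circ> reflect a = - a"
  by (simp add: comp_reflect roots_H_dual coroot_self fun_eq_iff)

lemma comp_reflect_roots_H: "b \<in> roots_H \<Longrightarrow> a \<in> roots_H \<Longrightarrow> b \<circ> reflect a \<in> roots_H"
proof -
  assume b: "b \<in> roots_H" and a: "a \<in> roots_H"
  obtain e f where t: "sl2_triple a e f (coroot_of a)" using coroot_triple[OF a] .
  have "b \<circ> reflect a \<in> insert 0 roots_H" using weight_reflection[OF t, of b] b a by (simp add: comp_reflect roots_H_dual)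
  moreover have "b \<circ> reflect a \<noteq> 0"
  proof
    assume "b \<circ> reflect a = 0"
    then have "b = 0 \<circ> reflect a" using comp_reflect_reflect[OF a, of b] by simp
    then have "b = 0" by (simp add: fun_eq_iff)
    then show False using b by simp
  qed
  ultimately show ?thesis by blast
qed

lemma sum_comp_reflect:
  assumes a: "a \<in> roots_H"
  shows "(\<Sum>b\<in>roots_H. F (b \<circ> reflect a)) = (\<Sum>b\<in>roots_H. F b)"
proof -
  have "bij_betw (\<lambda>b. b \<circ> reflect a) roots_H roots_H"
    by (rule bij_betw_byWitness[where f' = "\<lambda>b. b \<circ> reflect a"]) (auto simp: comp_reflect_reflect comp_reflect_roots_H a)
  then show ?thesis by (rule sum.reindex_bij_betw)
qed

text \<open>By invariance under reflections this form plays the role of the Killing form on \<open>H\<close>.\<close>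

definition root_form :: "'g \<Rightarrow> 'g \<Rightarrow> complex" where
  "root_form x y = (\<Sum>b\<in>roots_H. b x * b y)"

text \<open>The value of \<open>root_form\<close> on the coroot of \<open>a\<close> with itself,
  kept as an integer so that signs can be compared.\<close>

definition root_form_norm :: "('g \<Rightarrow> complex) \<Rightarrow> int" where
  "root_form_norm a = (\<Sum>b\<in>roots_H. (cartan_int b a)\<^sup>2)"

lemma root_form_commute: "root_form x y = root_form y x"
  by (simp add: root_form_def mult.commute)

lemma root_form_reflect: "a \<in> roots_H \<Longrightarrow> root_form (reflect a x) y = root_form x (reflect a y)"
  using sum_comp_reflect[of a "\<lambda>b. b (reflect a x) * b y"] by (simp add: root_form_def reflect_reflect)

lemma root_form_norm_pos: assumes a: "a \<in> roots_H" shows "root_form_norm a > 0"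
proof -
  have "cartan_int a a = 2" using cartan_int[OF a, of a] coroot_self[OF a] a
    by (metis insertCI of_int_eq_iff of_int_numeral)
  then have "0 < (cartan_int a a)\<^sup>2" by simp
  also have "\<dots> \<le> root_form_norm a" unfolding root_form_norm_def using a finite_roots_H by (intro member_le_sum) auto
  finally show ?thesis .
qed

text \<open>Reindexing the sum by the reflection in \<open>a\<close> gives the form back with the
  opposite sign, plus a multiple of \<open>a y\<close>; this is where the factor 2 comes
  from.\<close>

lemma root_form_coroot:
  assumes a: "a \<in> roots_H" and y: "y \<in> H"
  shows "2 * root_form (coroot_of a) y = of_int (root_form_norm a) * a y"
proof -
  have "root_form (coroot_of a) y = (\<Sum>b\<in>roots_H. (b \<circ> reflect a) (coroot_of a) * (b \<circ> reflect a) y)"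
    unfolding root_form_def using sum_comp_reflect[OF a, of "\<lambda>b. b (coroot_of a) * b y"] by simp
  also have "\<dots> = (\<Sum>b\<in>roots_H. (of_int ((cartan_int b a)\<^sup>2) * a y - b (coroot_of a) * b y))"
  proof (rule sum.cong)
    fix b assume b: "b \<in> roots_H"
    have 1: "(b \<circ> reflect a) (coroot_of a) = - b (coroot_of a)"
      unfolding comp_reflect[OF roots_H_dual[OF b] a] coroot_self[OF a] by simp
    have 2: "(b \<circ> reflect a) y = b y - b (coroot_of a) * a y" unfolding comp_reflect[OF roots_H_dual[OF b] a] ..
    show "(b \<circ> reflect a) (coroot_of a) * (b \<circ> reflect a) y = of_int ((cartan_int b a)\<^sup>2) * a y - b (coroot_of a) * b y"
      unfolding 1 2 using cartan_int[OF a, of b] b by (simp add: algebra_simps power2_eq_square)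
  qed simp
  also have "\<dots> = of_int (root_form_norm a) * a y - root_form (coroot_of a) y"
    by (simp add: sum_subtractf root_form_def root_form_norm_def sum_distrib_right)
  finally show ?thesis by simp
qed

text \<open>Both sides are twice the form of the two coroots. As norms are positive, the two Cartan
  integers of a pair of roots have the same sign.\<close>

lemma cartan_int_sym:
  assumes a: "a \<in> roots_H" and b: "b \<in> roots_H"
  shows "root_form_norm a * cartan_int a b = root_form_norm b * cartan_int b a"
proof -
  have "of_int (root_form_norm a) * a (coroot_of b) = of_int (root_form_norm b) * b (coroot_of a)"
    using root_form_coroot[OF a coroot_in_H[OF b]] root_form_coroot[OF b coroot_in_H[OF a]] root_form_commute[of "coroot_of a"] by simp
  then have "of_int (root_form_norm a * cartan_int a b) = (of_int (root_form_norm b * cartan_int b a) :: complex)"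
    using cartan_int[OF a, of b] cartan_int[OF b, of a] a b by simp
  then show ?thesis by (simp only: of_int_eq_iff)
qed

lemma cartan_int_pos_sym: "a \<in> roots_H \<Longrightarrow> b \<in> roots_H \<Longrightarrow> cartan_int a b > 0 \<Longrightarrow> cartan_int b a > 0"
  using cartan_int_sym[of a b] root_form_norm_pos[of a] root_form_norm_pos[of b] by (metis zero_less_mult_pos mult_pos_pos)

text \<open>Pairing with all coroots identifies the two vectors up to the factors given by the
  norms, which are not yet known to agree. Evaluating \<open>?g\<close>, which is 2 on both vectors,
  shows that they do.\<close>

lemma coroot_comp_reflect:
  assumes a: "a \<in> roots_H" and b: "b \<in> roots_H"
  shows "coroot_of (b \<circ> reflect a) = reflect a (coroot_of b)"
proof -
  let ?g = "b \<circ> reflect a"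
  have g: "?g \<in> roots_H" by (rule comp_reflect_roots_H[OF b a])
  have hg: "coroot_of ?g \<in> H" and sh: "reflect a (coroot_of b) \<in> H" by (simp_all add: coroot_in_H g reflect_in_H a b)
  define D where "D = of_int (root_form_norm ?g) *s reflect a (coroot_of b) - of_int (root_form_norm b) *s coroot_of ?g"
  have "D = 0"
  proof (rule roots_separate)
    show "D \<in> H" unfolding D_def using hg sh by (intro H_closed)
    fix c assume c: "c \<in> roots_H"
    have y: "coroot_of c \<in> H" by (rule coroot_in_H[OF c])
    have "of_int (root_form_norm c) * c D = 2 * root_form (coroot_of c) D" using root_form_coroot[OF c \<open>D \<in> H\<close>] by simp
    also have "\<dots> = of_int (root_form_norm ?g) * (2 * root_form (reflect a (coroot_of b)) (coroot_of c)) - of_int (root_form_norm b) * (2 * root_form (coroot_of ?g) (coroot_of c))"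
      using hg sh roots_H_dual unfolding root_form_def D_def
      by (simp add: dual_diff dual_D H_closed sum_distrib_left sum_subtractf[symmetric] algebra_simps cong: sum.cong)
    also have "2 * root_form (coroot_of ?g) (coroot_of c) = of_int (root_form_norm ?g) * b (reflect a (coroot_of c))"
      using root_form_coroot[OF g y] by simp
    also have "2 * root_form (reflect a (coroot_of b)) (coroot_of c) = of_int (root_form_norm b) * b (reflect a (coroot_of c))"
      using root_form_coroot[OF b reflect_in_H[OF a y]] by (simp add: root_form_reflect[OF a])
    finally show "c D = 0" using root_form_norm_pos[OF c] by simp
  qed
  then have eq: "of_int (root_form_norm ?g) *s reflect a (coroot_of b) = of_int (root_form_norm b) *s coroot_of ?g" by (simp add: D_def)
  have "?g (of_int (root_form_norm ?g) *s reflect a (coroot_of b)) = of_int (root_form_norm ?g) * 2"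
    unfolding dual_D(2)[OF roots_H_dual[OF g] sh] by (simp add: reflect_reflect a coroot_self b)
  moreover have "?g (of_int (root_form_norm b) *s coroot_of ?g) = of_int (root_form_norm b) * 2"
    unfolding dual_D(2)[OF roots_H_dual[OF g] hg] coroot_self[OF g] by (rule refl)
  ultimately have "of_int (root_form_norm ?g) = (of_int (root_form_norm b) :: complex)" using eq by simp
  then show ?thesis using eq root_form_norm_pos[OF b] by simp
qed

lemma reflect_conj:
  assumes a: "a \<in> roots_H" and b: "b \<in> roots_H"
  shows "reflect (b \<circ> reflect a) = reflect a \<circ> reflect b \<circ> reflect a"
proof
  fix x
  show "reflect (b \<circ> reflect a) x = (reflect a \<circ> reflect b \<circ> reflect a) x"
  proof (cases "x \<in> H")
    case True
    then have sx: "reflect a x \<in> H" by (simp add: reflect_in_H a)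
    have "reflect a (reflect b (reflect a x)) = reflect a (reflect a x - b (reflect a x) *s coroot_of b)" by (simp add: reflection_def[of _ _ b])
    also have "\<dots> = x - b (reflect a x) *s reflect a (coroot_of b)"
      using reflect_linear[OF a sx coroot_in_H[OF b]] by (simp add: reflect_reflect a)
    also have "\<dots> = reflect (b \<circ> reflect a) x"
      using coroot_comp_reflect[OF a b] by (simp add: reflection_def[of _ _ "b \<circ> reflect a"])
    finally show ?thesis by simp
  next
    case False
    then show ?thesis using a b comp_reflect_roots_H[OF b a] by (simp add: reflect_outside)
  qed
qed

end

section \<open>Positive systems and reflection groups\<close>

text \<open>Leaving out the empty sum lets \<open>0 \<notin> semigroup_span P\<close> express that
  \<open>P\<close> has no relation with positive coefficients.\<close>

inductive_set semigroup_span :: "'a::ab_group_add set \<Rightarrow> 'a set" for P where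
  base: "a \<in> P \<Longrightarrow> a \<in> semigroup_span P"
| step: "x \<in> semigroup_span P \<Longrightarrow> a \<in> P \<Longrightarrow> x + a \<in> semigroup_span P"

lemma semigroup_span_add:
  assumes "x \<in> semigroup_span P" "y \<in> semigroup_span P" shows "x + y \<in> semigroup_span P"
  using assms(2,1) by (induction) (auto intro: semigroup_span.intros simp flip: add.assoc)

lemma semigroup_span_mono:
  assumes "x \<in> semigroup_span P" "P \<subseteq> semigroup_span Q" shows "x \<in> semigroup_span Q"
  using assms by induction (auto intro: semigroup_span.intros semigroup_span_add)

lemma semigroup_span_list:
  assumes "x \<in> semigroup_span P" obtains xs where "xs \<noteq> []" "set xs \<subseteq> P" "x = sum_list xs"
proof -
  have "\<exists>xs. xs \<noteq> [] \<and> set xs \<subseteq> P \<and> x = sum_list xs" using assms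
  proof induction
    case (base a) show ?case by (rule exI[of _ "[a]"]) (use base in simp)
  next
    case (step x a)
    then obtain xs where "xs \<noteq> []" "set xs \<subseteq> P" "x = sum_list xs" by blast
    then show ?case using step by (intro exI[of _ "a # xs"]) (simp add: add.commute)
  qed
  then show thesis using that by blast
qed

lemma semigroup_span_mult:
  fixes x :: "'b \<Rightarrow> complex"
  assumes "x \<in> semigroup_span P" shows "of_nat (Suc n) * x \<in> semigroup_span P"
proof (induction n)
  case 0 show ?case using assms by simp
next
  case (Suc n)
  have "of_nat (Suc (Suc n)) * x = of_nat (Suc n) * x + x" by (simp add: fun_eq_iff algebra_simps)
  then show ?case using semigroup_span_add[OF Suc assms] by (simp only:)
qed

lemma semigroup_span_insert:
  fixes x :: "'b \<Rightarrow> complex"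
  assumes "x \<in> semigroup_span (insert a P)"
  shows "(\<exists>n. x = of_nat (Suc n) * a) \<or> (\<exists>n. \<exists>y\<in>semigroup_span P. x = of_nat n * a + y)"
  using assms
proof induction
  case (base b)
  show ?case
  proof (cases "b = a")
    case True
    then have "b = of_nat (Suc 0) * a" by simp
    then show ?thesis by blast
  next
    case False
    then have "b = of_nat 0 * a + b" "b \<in> semigroup_span P" using base by (auto intro: semigroup_span.base)
    then show ?thesis by blast
  qed
next
  case (step x b)
  have ba: "b = a \<or> b \<in> P" using step by simp
  from step.IH show ?case
  proof (elim disjE exE bexE)
    fix n assume x: "x = of_nat (Suc n) * a"
    from ba show ?case
    proof
      assume "b = a"
      then have "x + b = of_nat (Suc (Suc n)) * a" using x by (simp add: fun_eq_iff algebra_simps)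
      then show ?case by blast
    next
      assume "b \<in> P"
      then show ?case using x by (blast intro: semigroup_span.base)
    qed
  next
    fix n y assume y: "y \<in> semigroup_span P" and x: "x = of_nat n * a + y"
    from ba show ?case
    proof
      assume "b = a"
      then have "x + b = of_nat (Suc n) * a + y" using x by (simp add: fun_eq_iff algebra_simps)
      then show ?case using y by blast
    next
      assume "b \<in> P"
      then have "x + b = of_nat n * a + (y + b)" "y + b \<in> semigroup_span P"
        using x y by (auto intro: semigroup_span.step)
      then show ?case by blast
    qed
  qed
qed

lemma comp_bij_cancel: "bij w \<Longrightarrow> a \<circ> w = b \<circ> w \<longleftrightarrow> a = b"
  by (metis bij_is_surj surj_fun_eq)

section \<open>Closed sets of roots, their heights and indecomposable elements\<close>

context simple_lie_cartan
begin

text \<open>This is what the roots of a Borel subalgebra satisfy before its maximality is used;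
  \<open>pos_system\<close> adds the choice between \<open>a\<close> and \<open>- a\<close> for
  every root.\<close>

definition half_closed :: "('g \<Rightarrow> complex) set \<Rightarrow> bool" where
  "half_closed P \<longleftrightarrow> P \<subseteq> roots_H \<and> (\<forall>a\<in>P. - a \<notin> P) \<and> (\<forall>a\<in>P. \<forall>b\<in>P. a + b \<in> roots_H \<longrightarrow> a + b \<in> P)"

text \<open>Working relative to \<open>D\<close> lets one theory serve the Weyl group of the whole
  algebra and that of \<open>k\<close>, where \<open>D\<close> is \<open>even_roots\<close>.\<close>

definition subsystem :: "('g \<Rightarrow> complex) set \<Rightarrow> bool" where
  "subsystem D \<longleftrightarrow> D \<subseteq> roots_H \<and> (\<forall>a\<in>D. - a \<in> D) \<and> (\<forall>a\<in>D. \<forall>b\<in>D. a + b \<in> roots_H \<longrightarrow> a + b \<in> D)"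

definition pos_system :: "('g \<Rightarrow> complex) set \<Rightarrow> ('g \<Rightarrow> complex) set \<Rightarrow> bool" where
  "pos_system D P \<longleftrightarrow> half_closed P \<and> P \<subseteq> D \<and> (\<forall>a\<in>D. a \<in> P \<or> - a \<in> P)"

lemma subsystem_roots_H: "subsystem roots_H"
  by (auto simp: subsystem_def roots_H_neg)

lemma sum_list_cartan_int:
  assumes "a \<in> roots_H" "set xs \<subseteq> roots_H"
  shows "(sum_list xs) (coroot_of a) = of_int (\<Sum>b\<leftarrow>xs. cartan_int b a)"
  using assms(2) by (induction xs) (auto simp: cartan_int[OF assms(1)])

lemma cartan_int_self: "a \<in> roots_H \<Longrightarrow> cartan_int a a = 2"
  by (metis cartan_int coroot_self insertCI of_int_eq_iff of_int_numeral)

text \<open>In a vanishing sum the first term \<open>a\<close> contributes 2 at its own coroot, so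
  the others contribute -2 together and one of them, \<open>b\<close>, is negative there. Then
  \<open>b + a\<close> is a root in \<open>P\<close>, and merging the two terms shortens the
  list.\<close>

lemma half_closed_sum_list:
  assumes P: "half_closed P" and "set xs \<subseteq> P" "xs \<noteq> []"
  shows "sum_list xs \<noteq> 0"
  using assms(2,3)
proof (induction "length xs" arbitrary: xs rule: less_induct)
  case less
  have PR: "P \<subseteq> roots_H" using P by (simp add: half_closed_def)
  obtain a ys where xs: "xs = a # ys" using less by (cases xs) auto
  have a: "a \<in> P" "a \<in> roots_H" using less xs PR by auto
  show ?case
  proof
    assume z: "sum_list xs = 0"
    then have "(sum_list xs) (coroot_of a) = 0" by simp
    moreover have "set xs \<subseteq> roots_H" using less(2) PR by blast
    ultimately have "of_int (\<Sum>b\<leftarrow>xs. cartan_int b a) = (of_int 0 :: complex)"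
      using sum_list_cartan_int[OF a(2), of xs] by simp
    then have "(\<Sum>b\<leftarrow>xs. cartan_int b a) = 0" by (simp only: of_int_eq_iff)
    then have neg: "(\<Sum>b\<leftarrow>ys. cartan_int b a) = - 2" using xs cartan_int_self[OF a(2)] by simp
    have "\<exists>b\<in>set ys. cartan_int b a < 0"
    proof (rule ccontr)
      assume "\<not> (\<exists>b\<in>set ys. cartan_int b a < 0)"
      then have "0 \<le> (\<Sum>b\<leftarrow>ys. cartan_int b a)" by (intro sum_list_nonneg) auto
      then show False using neg by simp
    qed
    then obtain b where b: "b \<in> set ys" "cartan_int b a < 0" by blast
    have bP: "b \<in> P" "b \<in> roots_H" using b xs less(2) PR by auto
    have "b + a \<noteq> 0" using P a bP by (auto simp: half_closed_def add_eq_0_iff2)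
    then have "b + a \<in> roots_H" using cartan_int_neg[OF a(2) bP(2) b(2)] by simp
    then have ba: "b + a \<in> P" using P a bP by (auto simp: half_closed_def)
    have "sum_list ((b + a) # remove1 b ys) = sum_list xs"
      using xs sum_list_map_remove1[OF b(1), of "\<lambda>x. x"] by (simp add: ac_simps)
    moreover have "sum_list ((b + a) # remove1 b ys) \<noteq> 0"
    proof (rule less.hyps)
      have "length ys > 0" using b by (cases ys) auto
      then show "length ((b + a) # remove1 b ys) < length xs" using xs b by (simp add: length_remove1)
      show "set ((b + a) # remove1 b ys) \<subseteq> P" using ba less(2) xs set_remove1_subset[of b ys] by auto
    qed simp
    ultimately show False using z by simp
  qed
qed

lemma half_closed_no_zero: "half_closed P \<Longrightarrow> 0 \<notin> semigroup_span P"
proof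
  assume P: "half_closed P" "0 \<in> semigroup_span P"
  obtain xs where "xs \<noteq> []" "set xs \<subseteq> P" "0 = sum_list xs" using semigroup_span_list[OF P(2)] .
  then show False using half_closed_sum_list[OF P(1)] by metis
qed

lemma half_closed_insert:
  assumes P: "half_closed P" and D: "subsystem D" "P \<subseteq> D" and a: "a \<in> D"
    and no: "\<And>n. - (of_nat (Suc n) * a) \<notin> semigroup_span P"
  shows "half_closed (semigroup_span (insert a P) \<inter> D)"
proof -
  have aR: "a \<in> roots_H" using a D by (auto simp: subsystem_def)
  have nz: "of_nat (Suc n) * a \<noteq> 0" for n
  proof
    assume "of_nat (Suc n) * a = 0"
    then have "(of_nat (Suc n) * a) (coroot_of a) = (0 :: 'g \<Rightarrow> complex) (coroot_of a)" by simp
    then have "of_nat (Suc n) * (2::complex) = 0" using coroot_self[OF aR] by (simp only: times_fun_apply of_nat_fun_apply zero_fun_apply)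
    then show False using of_nat_neq_0[where 'a = complex, of n] by (simp del: of_nat_Suc)
  qed
  have zero: "0 \<notin> semigroup_span (insert a P)"
  proof
    assume "0 \<in> semigroup_span (insert a P)"
    from semigroup_span_insert[OF this] show False
    proof (elim disjE exE bexE)
      fix n assume "0 = of_nat (Suc n) * a"
      then show False using nz by metis
    next
      fix n y assume y: "y \<in> semigroup_span P" "0 = of_nat n * a + y"
      show False
      proof (cases n)
        case 0 then show False using y half_closed_no_zero[OF P] by simp
      next
        case (Suc m)
        then have "y = - (of_nat (Suc m) * a)" using y(2) by (metis add_eq_0_iff)
        then show False using y no by blast
      qed
    qed
  qed
  show ?thesis unfolding half_closed_def
  proof (intro conjI ballI impI)
    show "semigroup_span (insert a P) \<inter> D \<subseteq> roots_H" using D by (auto simp: subsystem_def)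
  next
    fix b assume b: "b \<in> semigroup_span (insert a P) \<inter> D"
    show "- b \<notin> semigroup_span (insert a P) \<inter> D"
    proof
      assume "- b \<in> semigroup_span (insert a P) \<inter> D"
      then have "b + - b \<in> semigroup_span (insert a P)" using b by (intro semigroup_span_add) auto
      then show False using zero by simp
    qed
  next
    fix b c assume "b \<in> semigroup_span (insert a P) \<inter> D" "c \<in> semigroup_span (insert a P) \<inter> D" "b + c \<in> roots_H"
    then show "b + c \<in> semigroup_span (insert a P) \<inter> D"
      using D semigroup_span_add by (auto simp: subsystem_def)
  qed
qed

text \<open>Take a maximal half-closed set between \<open>Q\<close> and \<open>D\<close>. A root
  that cannot be added to it has a negative multiple in its semigroup span, and this cannot happen
  for \<open>a\<close> and \<open>- a\<close> at the same time.\<close>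

lemma half_closed_extend:
  assumes Q: "half_closed Q" and D: "subsystem D" "Q \<subseteq> D"
  obtains P where "Q \<subseteq> P" "pos_system D P"
proof -
  let ?F = "{P. half_closed P \<and> Q \<subseteq> P \<and> P \<subseteq> D}"
  have finD: "finite D" using D finite_roots_H finite_subset by (auto simp: subsystem_def)
  have "finite ?F" by (rule finite_subset[of _ "Pow D"]) (use finD in auto)
  moreover have "Q \<in> ?F" using Q D by simp
  ultimately have "\<exists>P\<in>?F. Q \<subseteq> P \<and> (\<forall>P'\<in>?F. P \<subseteq> P' \<longrightarrow> P = P')" by (rule finite_has_maximal2)
  then obtain P where PF: "P \<in> ?F" and max: "\<forall>P'\<in>?F. P \<subseteq> P' \<longrightarrow> P = P'"
    by (elim bexE conjE)
  have P: "P' = P" if "P' \<in> ?F" "P \<subseteq> P'" for P' using max[rule_format, OF that] by (rule sym)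
  have PD: "half_closed P" "P \<subseteq> D" "Q \<subseteq> P" using PF by auto
  have ext: "a \<in> P" if a: "a \<in> D" and no: "\<And>n. - (of_nat (Suc n) * a) \<notin> semigroup_span P" for a
  proof -
    have "semigroup_span (insert a P) \<inter> D = P"
      using half_closed_insert[OF PD(1) D(1) PD(2) a no] PD semigroup_span.base[of _ "insert a P"]
      by (intro P) auto
    then show ?thesis using a semigroup_span.base[of a "insert a P"] by blast
  qed
  have "a \<in> P \<or> - a \<in> P" if a: "a \<in> D" for a
  proof (rule ccontr)
    assume n: "\<not> (a \<in> P \<or> - a \<in> P)"
    have ma: "- a \<in> D" using a D by (simp add: subsystem_def)
    obtain m where m: "- (of_nat (Suc m) * a) \<in> semigroup_span P" using ext[OF a] n by blast
    obtain k where k: "- (of_nat (Suc k) * - a) \<in> semigroup_span P" using ext[OF ma] n by blast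
    \<comment> \<open>Multiplying each of the two relations by the coefficient of the other writes
      zero as a nonempty sum.\<close>
    have "of_nat (Suc k) * - (of_nat (Suc m) * a) + of_nat (Suc m) * - (of_nat (Suc k) * - a) \<in> semigroup_span P"
      by (intro semigroup_span_add semigroup_span_mult m k)
    moreover have "of_nat (Suc k) * - (of_nat (Suc m) * a) + of_nat (Suc m) * - (of_nat (Suc k) * - a) = 0"
      by (simp add: fun_eq_iff algebra_simps)
    ultimately show False using half_closed_no_zero[OF PD(1)] by simp
  qed
  then show thesis using that[of P] PD by (simp add: pos_system_def)
qed

text \<open>Counts the elements of \<open>P\<close> strictly below \<open>x\<close>. It replaces the
  sum of the coefficients in the simple roots, which would presuppose their linear
  independence.\<close>

definition height :: "('g \<Rightarrow> complex) set \<Rightarrow> ('g \<Rightarrow> complex) \<Rightarrow> nat" where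
  "height P x = card {b \<in> P. x - b \<in> semigroup_span P}"

lemma height_less:
  assumes P: "half_closed P" and x: "x \<in> P" and y: "y - x \<in> semigroup_span P"
  shows "height P x < height P y"
proof -
  have "finite P" using P finite_roots_H finite_subset by (auto simp: half_closed_def)
  moreover have "{b \<in> P. x - b \<in> semigroup_span P} \<subseteq> {b \<in> P. y - b \<in> semigroup_span P}"
  proof
    fix b assume b: "b \<in> {b \<in> P. x - b \<in> semigroup_span P}"
    then have "(y - x) + (x - b) \<in> semigroup_span P" by (intro semigroup_span_add y) simp
    then show "b \<in> {b \<in> P. y - b \<in> semigroup_span P}" using b by simp
  qed
  moreover have "x \<in> {b \<in> P. y - b \<in> semigroup_span P}" "x \<notin> {b \<in> P. x - b \<in> semigroup_span P}"
    using x y half_closed_no_zero[OF P] by auto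
  ultimately have "{b \<in> P. x - b \<in> semigroup_span P} \<subset> {b \<in> P. y - b \<in> semigroup_span P}" by blast
  then show ?thesis unfolding height_def using \<open>finite P\<close> by (intro psubset_card_mono) auto
qed

lemma height_add:
  assumes P: "half_closed P" and x: "x \<in> P" and y: "y \<in> P"
  shows "height P x < height P (x + y)" "height P y < height P (x + y)"
  using height_less[OF P x, of "x + y"] height_less[OF P y, of "x + y"] x y
  by (auto intro: semigroup_span.base)

definition indecomposables :: "('g \<Rightarrow> complex) set \<Rightarrow> ('g \<Rightarrow> complex) set" where
  "indecomposables P = {a \<in> P. \<not> (\<exists>b\<in>P. \<exists>c\<in>P. a = b + c)}"

lemma half_closed_induct [consumes 2, case_names indec add]:
  assumes P: "half_closed P" and "a \<in> P"
    and "\<And>a. a \<in> indecomposables P \<Longrightarrow> Q a"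
    and "\<And>b c. b \<in> P \<Longrightarrow> c \<in> P \<Longrightarrow> b + c \<in> P \<Longrightarrow> Q b \<Longrightarrow> Q c \<Longrightarrow> Q (b + c)"
  shows "Q a"
  using assms(2)
proof (induction "height P a" arbitrary: a rule: less_induct)
  case less
  show ?case
  proof (cases "a \<in> indecomposables P")
    case False
    then obtain b c where bc: "b \<in> P" "c \<in> P" "a = b + c" using less(2) by (auto simp: indecomposables_def)
    then show ?thesis using less height_add[OF P bc(1,2)] assms(4) by metis
  qed (use assms(3) in auto)
qed

lemma semigroup_span_indecomposables:
  assumes P: "half_closed P" and "a \<in> P" shows "a \<in> semigroup_span (indecomposables P)"
  using assms
proof (induction rule: half_closed_induct)
  case (indec a) then show ?case by (rule semigroup_span.base)
next
  case (add b c)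
  show "b + c \<in> semigroup_span (indecomposables P)" by (rule semigroup_span_add[OF add(4,5)])
qed

lemma root_string_nonzero:
  assumes "a \<in> roots_H" "b \<in> roots_H" "b \<noteq> a" "b \<noteq> - a"
    "0 \<le> k \<and> k \<le> cartan_int b a \<or> cartan_int b a \<le> k \<and> k \<le> 0"
  shows "b - of_int k * a \<in> roots_H"
proof -
  have "b - of_int k * a \<noteq> 0"
  proof
    assume "b - of_int k * a = 0"
    then have eq: "b = of_int k * a" by simp
    then have "k = 1 \<or> k = - 1" using multiple_of_root[OF assms(1), of k] assms(2) by simp
    then show False using eq assms(3,4) by auto
  qed
  then show ?thesis using root_string[OF assms(1), of b k] assms(2,5) by auto
qed

text \<open>The reflected root is reached from \<open>b\<close> by single steps of \<open>a\<close>,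
  and all steps stay among the roots because zero can be met only for \<open>b = a\<close> or
  \<open>b = - a\<close>. Subsystems and positive systems both use this.\<close>

lemma root_string_closed:
  assumes a: "a \<in> roots_H" and b: "b \<in> roots_H" "b \<noteq> a" "b \<noteq> - a" and C: "b \<in> C"
    and up: "\<And>x. x \<in> C \<Longrightarrow> x + a \<in> roots_H \<Longrightarrow> x + a \<in> C"
    and down: "\<And>x. x \<in> C \<Longrightarrow> x - a \<in> roots_H \<Longrightarrow> x - a \<in> C"
  shows "b \<circ> reflect a \<in> C"
proof -
  have D: "int n \<le> cartan_int b a \<Longrightarrow> b - of_int (int n) * a \<in> C" for n
  proof (induction n)
    case (Suc n)
    have le: "int (Suc n) \<le> cartan_int b a" by (rule Suc.prems)
    then have "b - of_int (int n) * a \<in> C" by (intro Suc.IH) simp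
    moreover have "b - of_int (int (Suc n)) * a = (b - of_int (int n) * a) - a" by (simp add: fun_eq_iff algebra_simps)
    moreover have "b - of_int (int (Suc n)) * a \<in> roots_H" using le by (intro root_string_nonzero a b) auto
    ultimately show "b - of_int (int (Suc n)) * a \<in> C" using down[of "b - of_int (int n) * a"] by (simp only:)
  qed (use C in simp)
  have U: "cartan_int b a \<le> - int n \<Longrightarrow> b - of_int (- int n) * a \<in> C" for n
  proof (induction n)
    case (Suc n)
    have le: "cartan_int b a \<le> - int (Suc n)" by (rule Suc.prems)
    then have "b - of_int (- int n) * a \<in> C" by (intro Suc.IH) simp
    moreover have "b - of_int (- int (Suc n)) * a = (b - of_int (- int n) * a) + a" by (simp add: fun_eq_iff algebra_simps)
    moreover have "b - of_int (- int (Suc n)) * a \<in> roots_H" using le by (intro root_string_nonzero a b) auto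
    ultimately show "b - of_int (- int (Suc n)) * a \<in> C" using up[of "b - of_int (- int n) * a"] by (simp only:)
  qed (use C in simp)
  have "b - of_int (cartan_int b a) * a \<in> C"
  proof (cases "cartan_int b a \<ge> 0")
    case True then show ?thesis using D[of "nat (cartan_int b a)"] by simp
  next
    case False then show ?thesis using U[of "nat (- cartan_int b a)"] by simp
  qed
  then show ?thesis using comp_reflect_cartan_int[OF b(1) a] by simp
qed

lemma neg_comp: "(- b) \<circ> f = - (b \<circ> f)" for b :: "'g \<Rightarrow> complex"
  by (simp add: fun_eq_iff)

lemma add_comp: "(b + c) \<circ> f = (b \<circ> f) + (c \<circ> f)" for b :: "'g \<Rightarrow> complex"
  by (simp add: fun_eq_iff)

lemma subsystem_reflect:
  assumes D: "subsystem D" and a: "a \<in> D" and b: "b \<in> D"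
  shows "b \<circ> reflect a \<in> D"
proof -
  have R: "a \<in> roots_H" "b \<in> roots_H" "- a \<in> D" using assms by (auto simp: subsystem_def)
  show ?thesis
  proof (cases "b = a \<or> b = - a")
    case True
    then show ?thesis using R a comp_reflect_self[OF R(1)] by (auto simp: neg_comp)
  next
    case False
    show ?thesis
    proof (rule root_string_closed[OF R(1,2) _ _ b])
      show "x + a \<in> D" if "x \<in> D" "x + a \<in> roots_H" for x using that a D by (auto simp: subsystem_def)
      show "x - a \<in> D" if "x \<in> D" "x - a \<in> roots_H" for x
        using that R(3) D unfolding subsystem_def by (metis diff_conv_add_uminus)
    qed (use False in auto)
  qed
qed

text \<open>\<open>P\<close> is closed under subtracting \<open>a\<close> within the roots: if
  \<open>x - a\<close> were not in \<open>P\<close>, then \<open>a = x + (a - x)\<close> would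
  decompose \<open>a\<close>.\<close>

lemma indecomposable_reflect:
  assumes D: "subsystem D" and P: "pos_system D P" and a: "a \<in> indecomposables P" and b: "b \<in> P" "b \<noteq> a"
  shows "b \<circ> reflect a \<in> P"
proof -
  have aP: "a \<in> P" using a by (simp add: indecomposables_def)
  have PD: "P \<subseteq> D" "D \<subseteq> roots_H" "half_closed P" using P D by (auto simp: pos_system_def subsystem_def)
  have R: "a \<in> roots_H" "b \<in> roots_H" using aP b PD by auto
  have mD: "- a \<in> D" using aP PD D by (auto simp: subsystem_def)
  have "b \<noteq> - a" using b aP PD(3) by (auto simp: half_closed_def)
  moreover have "x - a \<in> P" if x: "x \<in> P" "x - a \<in> roots_H" for x
  proof (rule ccontr)
    assume n: "x - a \<notin> P"
    have "x - a \<in> D" using x mD PD(1) D unfolding subsystem_def by (metis diff_conv_add_uminus subsetD)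
    then have "- (x - a) \<in> P" using P n by (auto simp: pos_system_def)
    moreover have "a = x + - (x - a)" by simp
    ultimately show False using a x(1) unfolding indecomposables_def by blast
  qed
  moreover have "x + a \<in> P" if "x \<in> P" "x + a \<in> roots_H" for x
    using that aP PD(3) by (auto simp: half_closed_def)
  ultimately show ?thesis using root_string_closed[OF R b(2) _ b(1)] by blast
qed

section \<open>Reflection groups and their simply transitive action on positive systems\<close>

primrec word :: "('g \<Rightarrow> complex) list \<Rightarrow> 'g \<Rightarrow> 'g" where
  "word [] = id"
| "word (a # as) = reflect a \<circ> word as"

text \<open>Words without inverses suffice because reflections are involutions;
  \<open>generate_reflections\<close> identifies this with the generated group.\<close>

definition reflection_group :: "('g \<Rightarrow> complex) set \<Rightarrow> ('g \<Rightarrow> 'g) set" where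
  "reflection_group D = {word as | as. set as \<subseteq> D}"

lemma word_append: "word (as @ bs) = word as \<circ> word bs"
  by (induction as) (auto simp: comp_assoc)

lemma reflect_comp_reflect: "a \<in> roots_H \<Longrightarrow> reflect a \<circ> reflect a = id"
  by (simp add: fun_eq_iff reflect_reflect)

lemma word_rev: "set as \<subseteq> roots_H \<Longrightarrow> word (rev as) \<circ> word as = id"
proof (induction as)
  case (Cons a as)
  have "word (rev (a # as)) \<circ> word (a # as) = word (rev as) \<circ> (reflect a \<circ> reflect a) \<circ> word as"
    by (simp add: word_append comp_assoc)
  moreover have "word (rev as) \<circ> word as = id" using Cons.prems by (intro Cons.IH) simp
  moreover have "reflect a \<circ> reflect a = id" using Cons.prems by (intro reflect_comp_reflect) simp
  ultimately show "word (rev (a # as)) \<circ> word (a # as) = id" by (simp only: comp_id)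
qed simp

lemma word_rev': "set as \<subseteq> roots_H \<Longrightarrow> word as \<circ> word (rev as) = id"
  using word_rev[of "rev as"] by simp

lemma reflection_group_id: "id \<in> reflection_group D"
  unfolding reflection_group_def by (intro CollectI exI[of _ "[]"]) simp

lemma reflection_group_comp: "v \<in> reflection_group D \<Longrightarrow> w \<in> reflection_group D \<Longrightarrow> v \<circ> w \<in> reflection_group D"
  unfolding reflection_group_def by (clarsimp simp flip: word_append) (metis Un_least set_append)

lemma reflection_group_reflect: "a \<in> D \<Longrightarrow> reflect a \<in> reflection_group D"
  unfolding reflection_group_def by (intro CollectI exI[of _ "[a]"]) simp

lemma reflection_group_mono: "D \<subseteq> D' \<Longrightarrow> reflection_group D \<subseteq> reflection_group D'"
  unfolding reflection_group_def by blast

lemma reflection_group_inverse: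
  assumes "w \<in> reflection_group D" "D \<subseteq> roots_H"
  obtains w' where "w' \<in> reflection_group D" "w' \<circ> w = id" "w \<circ> w' = id"
proof -
  obtain as where as: "w = word as" "set as \<subseteq> D" using assms by (auto simp: reflection_group_def)
  have "word (rev as) \<in> reflection_group D" unfolding reflection_group_def using as by (intro CollectI exI[of _ "rev as"]) simp
  then show thesis using that word_rev[of as] word_rev'[of as] as assms(2) by auto
qed

lemma reflection_group_bij: "w \<in> reflection_group D \<Longrightarrow> D \<subseteq> roots_H \<Longrightarrow> bij w"
  using reflection_group_inverse o_bij by metis

lemma reflection_group_inv: "w \<in> reflection_group D \<Longrightarrow> D \<subseteq> roots_H \<Longrightarrow> inv_into UNIV w \<in> reflection_group D"
  using reflection_group_inverse inv_unique_comp by metis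

lemma word_subsystem: "subsystem D \<Longrightarrow> set as \<subseteq> D \<Longrightarrow> b \<in> D \<Longrightarrow> b \<circ> word as \<in> D"
  by (induction as arbitrary: b) (auto simp: subsystem_reflect simp flip: comp_assoc)

lemma reflection_group_subsystem: "subsystem D \<Longrightarrow> w \<in> reflection_group D \<Longrightarrow> b \<in> D \<Longrightarrow> b \<circ> w \<in> D"
  by (auto simp: reflection_group_def word_subsystem)

text \<open>A reflection passes through a word once its root is moved along; the deletion argument
  cancels two letters by this.\<close>

lemma word_conj:
  "a \<in> roots_H \<Longrightarrow> set bs \<subseteq> roots_H \<Longrightarrow> word bs \<circ> reflect (a \<circ> word bs) = reflect a \<circ> word bs"
proof (induction bs arbitrary: a)
  case (Cons b bs)
  have b: "b \<in> roots_H" using Cons by simp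
  have "word bs \<circ> reflect ((a \<circ> reflect b) \<circ> word bs) = reflect (a \<circ> reflect b) \<circ> word bs"
    using Cons.prems(2) by (intro Cons.IH comp_reflect_roots_H[OF Cons.prems(1) b]) simp
  then have "reflect b \<circ> (word bs \<circ> reflect ((a \<circ> reflect b) \<circ> word bs)) = reflect b \<circ> (reflect b \<circ> reflect a \<circ> reflect b \<circ> word bs)"
    using reflect_conj[OF b Cons(2)] by simp
  also have "\<dots> = (reflect b \<circ> reflect b) \<circ> reflect a \<circ> reflect b \<circ> word bs" by (simp add: comp_assoc)
  finally show "word (b # bs) \<circ> reflect (a \<circ> word (b # bs)) = reflect a \<circ> word (b # bs)"
    using b by (simp add: reflect_comp_reflect comp_assoc)
qed simp

lemma indecomposable_reflect_pos_system:
  assumes D: "subsystem D" and P: "pos_system D P" and a: "a \<in> indecomposables P"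
  shows "(\<lambda>b. b \<circ> reflect a) ` P = insert (- a) (P - {a})"
proof -
  have aP: "a \<in> P" "a \<in> roots_H" "- a \<notin> P" using a P by (auto simp: indecomposables_def pos_system_def half_closed_def)
  show ?thesis
  proof (intro Set.set_eqI iffI)
    fix c assume "c \<in> (\<lambda>b. b \<circ> reflect a) ` P"
    then obtain b where b: "b \<in> P" "c = b \<circ> reflect a" by blast
    show "c \<in> insert (- a) (P - {a})"
    proof (cases "b = a")
      case True then show ?thesis using b comp_reflect_self[OF aP(2)] by simp
    next
      case False
      have "c \<noteq> a"
      proof
        assume "c = a"
        then have "b = a \<circ> reflect a" using b comp_reflect_reflect[OF aP(2), of b] by simp
        then show False using comp_reflect_self[OF aP(2)] aP b by simp
      qed
      then show ?thesis using indecomposable_reflect[OF D P a b(1) False] b by simp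
    qed
  next
    fix c assume c: "c \<in> insert (- a) (P - {a})"
    show "c \<in> (\<lambda>b. b \<circ> reflect a) ` P"
    proof (cases "c = - a")
      case True then show ?thesis using comp_reflect_self[OF aP(2)] aP(1) by (intro image_eqI[of _ _ a]) auto
    next
      case False
      then have "c \<circ> reflect a \<in> P" using indecomposable_reflect[OF D P a] c by blast
      then show ?thesis using comp_reflect_reflect[OF aP(2), of c] by (intro image_eqI[of _ _ "c \<circ> reflect a"]) auto
    qed
  qed
qed

lemma reflection_group_pos_system:
  assumes D: "subsystem D" "D' \<subseteq> roots_H" and P: "pos_system D P" and w: "w \<in> reflection_group D'"
    and DD: "(\<lambda>b. b \<circ> w) ` D = E" "subsystem E"
  shows "pos_system E ((\<lambda>b. b \<circ> w) ` P)"
proof -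
  obtain w' where w': "w' \<in> reflection_group D'" "w' \<circ> w = id" "w \<circ> w' = id" using reflection_group_inverse[OF w D(2)] .
  have PD: "P \<subseteq> D" "half_closed P" "D \<subseteq> roots_H" using P D by (auto simp: pos_system_def subsystem_def)
  have wR: "w \<in> reflection_group roots_H" "w' \<in> reflection_group roots_H" using w w' D(2) reflection_group_mono by blast+
  have bk: "b \<circ> w \<circ> w' = b" "b \<circ> w' \<circ> w = b" for b :: "'g \<Rightarrow> complex" by (simp_all add: comp_assoc w')
  have mem: "b \<circ> w \<in> (\<lambda>b. b \<circ> w) ` P \<longleftrightarrow> b \<in> P" for b
    using bk by (metis (no_types, lifting) image_iff)
  show ?thesis unfolding pos_system_def half_closed_def
  proof (intro conjI ballI impI)
    show "(\<lambda>b. b \<circ> w) ` P \<subseteq> roots_H" using reflection_group_subsystem[OF subsystem_roots_H wR(1)] PD by auto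
    show "(\<lambda>b. b \<circ> w) ` P \<subseteq> E" using DD PD by blast
  next
    fix a assume "a \<in> (\<lambda>b. b \<circ> w) ` P"
    then obtain a' where a': "a' \<in> P" "a = a' \<circ> w" by blast
    then have "- a' \<notin> P" using PD(2) by (auto simp: half_closed_def)
    then show "- a \<notin> (\<lambda>b. b \<circ> w) ` P" using mem[of "- a'"] a'(2) by (simp only: neg_comp not_False_eq_True)
  next
    fix a b assume ab: "a \<in> (\<lambda>b. b \<circ> w) ` P" "b \<in> (\<lambda>b. b \<circ> w) ` P" "a + b \<in> roots_H"
    then obtain a' b' where 1: "a' \<in> P" "b' \<in> P" "a = a' \<circ> w" "b = b' \<circ> w" by blast
    have eq: "a + b = (a' + b') \<circ> w" by (simp only: 1 add_comp)
    have "(a' + b') \<circ> w \<circ> w' \<in> roots_H"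
      using reflection_group_subsystem[OF subsystem_roots_H wR(2) ab(3)] unfolding eq .
    then have "a' + b' \<in> P" using 1(1,2) PD(2) unfolding bk(1) by (auto simp: half_closed_def)
    then show "a + b \<in> (\<lambda>b. b \<circ> w) ` P" unfolding eq by (rule imageI)
  next
    fix a assume "a \<in> E"
    then obtain a' where a': "a' \<in> D" "a = a' \<circ> w" using DD by blast
    then have "a' \<in> P \<or> - a' \<in> P" using P by (simp add: pos_system_def)
    then show "a \<in> (\<lambda>b. b \<circ> w) ` P \<or> - a \<in> (\<lambda>b. b \<circ> w) ` P"
      using a' mem by (auto simp flip: neg_comp)
  qed
qed

lemma reflection_group_image_subsystem:
  assumes D: "subsystem D" and w: "w \<in> reflection_group D"
  shows "(\<lambda>b. b \<circ> w) ` D = D"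
proof -
  have DR: "D \<subseteq> roots_H" using D by (simp add: subsystem_def)
  obtain w' where w': "w' \<in> reflection_group D" "w' \<circ> w = id" "w \<circ> w' = id" using reflection_group_inverse[OF w DR] .
  have "b \<in> (\<lambda>b. b \<circ> w) ` D" if "b \<in> D" for b
    using reflection_group_subsystem[OF D w'(1) that] by (intro image_eqI[of _ _ "b \<circ> w'"]) (simp_all add: comp_assoc w')
  then show ?thesis using reflection_group_subsystem[OF D w] by blast
qed

text \<open>Reflecting in an indecomposable \<open>a\<close> of \<open>P\<close> outside
  \<open>Q\<close> only trades \<open>a\<close> for \<open>- a\<close>, which is in
  \<open>Q\<close>, so fewer elements of \<open>P\<close> lie outside \<open>Q\<close>. If there is
  no such \<open>a\<close>, closure gives \<open>P \<subseteq> Q\<close> and hence equality.\<close>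

lemma pos_systems_conjugate:
  assumes D: "subsystem D" and Q: "pos_system D Q" and P: "pos_system D P"
  shows "\<exists>w\<in>reflection_group D. (\<lambda>b. b \<circ> w) ` Q = P"
  using P
proof (induction "card (P - Q)" arbitrary: P rule: less_induct)
  case less
  have hP: "half_closed P" "P \<subseteq> D" and hQ: "half_closed Q" "Q \<subseteq> D"
    using less(2) Q by (auto simp: pos_system_def)
  have DR: "D \<subseteq> roots_H" using D by (simp add: subsystem_def)
  have fin: "finite P" "finite Q" using hP hQ DR finite_roots_H finite_subset by (metis subset_trans)+
  show ?case
  proof (cases "indecomposables P \<subseteq> Q")
    case True
    have PQ: "a \<in> Q" if "a \<in> P" for a
      using hP(1) that
    proof (induction rule: half_closed_induct)
      case (indec a) then show ?case using True by blast
    next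
      case (add b c)
      have "b + c \<in> roots_H" using add(3) hP(1) by (auto simp: half_closed_def)
      then show "b + c \<in> Q" using add(4,5) hQ(1) by (auto simp: half_closed_def)
    qed
    have "Q \<subseteq> P"
    proof
      fix a assume a: "a \<in> Q"
      then have "- a \<notin> P" using PQ hQ(1) by (auto simp: half_closed_def)
      then show "a \<in> P" using less(2) a hQ(2) by (auto simp: pos_system_def)
    qed
    then have "(\<lambda>b. b \<circ> id) ` Q = P" using PQ by auto
    then show ?thesis using reflection_group_id by blast
  next
    case False
    then obtain a where a: "a \<in> indecomposables P" "a \<notin> Q" by blast
    have aP: "a \<in> P" "a \<in> D" using a hP by (auto simp: indecomposables_def)
    have aR: "a \<in> roots_H" using aP DR by blast
    have maQ: "- a \<in> Q" using Q a(2) aP by (auto simp: pos_system_def)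
    let ?P = "(\<lambda>b. b \<circ> reflect a) ` P"
    have P': "?P = insert (- a) (P - {a})" by (rule indecomposable_reflect_pos_system[OF D less(2) a(1)])
    have "pos_system D ?P"
      using reflection_group_pos_system[OF D DR less(2) reflection_group_reflect[OF aP(2)] reflection_group_image_subsystem[OF D reflection_group_reflect[OF aP(2)]] D] .
    moreover have "card (?P - Q) < card (P - Q)"
      unfolding P' using a aP maQ fin by (intro psubset_card_mono) auto
    ultimately obtain w where w: "w \<in> reflection_group D" "(\<lambda>b. b \<circ> w) ` Q = ?P" using less(1) by blast
    have "(\<lambda>b. b \<circ> (w \<circ> reflect a)) ` Q = (\<lambda>b. b \<circ> reflect a) ` (\<lambda>b. b \<circ> w) ` Q"
      by (simp add: image_image comp_assoc)
    also have "\<dots> = P" unfolding w(2) image_image comp_reflect_reflect[OF aR] by simp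
    finally show ?thesis using reflection_group_comp[OF w(1) reflection_group_reflect[OF aP(2)]] by blast
  qed
qed

text \<open>Written as a sum of indecomposables, \<open>b\<close> has the value 2 at its own coroot,
  so some summand \<open>a\<close> is positive there. The reflection in \<open>a\<close> lowers
  \<open>b\<close>, and conjugation by it brings back the reflection in \<open>b\<close>.\<close>

lemma reflect_in_reflection_group_indecomposables:
  assumes D: "subsystem D" and P: "pos_system D P" and "b \<in> P"
  shows "reflect b \<in> reflection_group (indecomposables P)"
  using assms(3)
proof (induction "height P b" arbitrary: b rule: less_induct)
  case less
  have hP: "half_closed P" "P \<subseteq> roots_H" using P by (auto simp: pos_system_def half_closed_def)
  show ?case
  proof (cases "b \<in> indecomposables P")
    case True then show ?thesis by (rule reflection_group_reflect)
  next
    case False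
    have bR: "b \<in> roots_H" using less hP by blast
    obtain xs where xs: "set xs \<subseteq> indecomposables P" "b = sum_list xs"
      using semigroup_span_list[OF semigroup_span_indecomposables[OF hP(1) less(2)]] by metis
    have xsP: "set xs \<subseteq> P" using xs by (auto simp: indecomposables_def)
    have "of_int (\<Sum>c\<leftarrow>xs. cartan_int c b) = (of_int 2 :: complex)"
      using sum_list_cartan_int[OF bR, of xs] xs xsP hP coroot_self[OF bR] by auto
    then have s: "(\<Sum>c\<leftarrow>xs. cartan_int c b) = 2" by (simp only: of_int_eq_iff)
    have "\<exists>c\<in>set xs. cartan_int c b > 0"
    proof (rule ccontr)
      assume "\<not> (\<exists>c\<in>set xs. cartan_int c b > 0)"
      then have "(\<Sum>c\<leftarrow>xs. cartan_int c b) \<le> 0" by (intro sum_list_nonpos) auto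
      then show False using s by simp
    qed
    then obtain a where a: "a \<in> indecomposables P" "cartan_int a b > 0" using xs by blast
    have aP: "a \<in> P" "a \<in> roots_H" using a hP by (auto simp: indecomposables_def)
    \<comment> \<open>The expansion of \<open>b\<close> gives the sign of
      \<open>cartan_int a b\<close>, but the reflection of \<open>b\<close> in \<open>a\<close>
      involves \<open>cartan_int b a\<close>; the invariant form links the signs.\<close>
    have c: "cartan_int b a > 0" using cartan_int_pos_sym[OF aP(2) bR a(2)] .
    let ?b = "b \<circ> reflect a"
    have b': "?b \<in> P" using indecomposable_reflect[OF D P a(1) less(2)] False a(1) by blast
    \<comment> \<open>The multiple of \<open>a\<close> is positive; it is written as a successor
      because \<open>semigroup_span_mult\<close> excludes the factor 0.\<close>
    have "b - ?b = of_nat (Suc (nat (cartan_int b a - 1))) * a"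
      using c comp_reflect_cartan_int[OF bR aP(2)] by (simp add: fun_eq_iff of_nat_nat)
    then have "b - ?b \<in> semigroup_span P"
      using semigroup_span_mult[OF semigroup_span.base[OF aP(1)]] by simp
    then have "height P ?b < height P b" by (rule height_less[OF hP(1) b'])
    then have "reflect ?b \<in> reflection_group (indecomposables P)" using less b' by blast
    moreover have "reflect b = reflect a \<circ> reflect ?b \<circ> reflect a"
      using reflect_conj[OF aP(2), of ?b] comp_reflect_reflect[OF aP(2), of b] b' hP(2) by auto
    ultimately show ?thesis using reflection_group_reflect[OF a(1)] by (auto intro: reflection_group_comp)
  qed
qed

text \<open>Outside \<open>P\<close>, only \<open>- a\<close> is brought into \<open>P\<close> by
  the reflection in an indecomposable \<open>a\<close>. So the letter at which the image of
  \<open>c\<close> enters \<open>P\<close> is known.\<close>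

lemma word_sign_change:
  assumes D: "subsystem D" and P: "pos_system D P"
    and "set ws \<subseteq> indecomposables P" "c \<in> D" "c \<notin> P" "c \<circ> word ws \<in> P"
  shows "\<exists>us a vs. ws = us @ a # vs \<and> c \<circ> word us = - a"
  using assms(3-)
proof (induction ws arbitrary: c)
  case (Cons a ws)
  have a: "a \<in> indecomposables P" "a \<in> D" using Cons P by (auto simp: indecomposables_def pos_system_def)
  have mc: "- c \<in> P" using Cons P by (auto simp: pos_system_def)
  show ?case
  proof (cases "c \<circ> reflect a \<in> P")
    case True
    have "- c = a"
    proof (rule ccontr)
      assume "- c \<noteq> a"
      then have "- (c \<circ> reflect a) \<in> P" using indecomposable_reflect[OF D P a(1) mc] by (simp add: neg_comp)
      then show False using True P by (auto simp: pos_system_def half_closed_def)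
    qed
    then have "c \<circ> word [] = - a" by auto
    then show ?thesis by blast
  next
    case False
    have "c \<circ> word (a # ws) \<in> P" by (rule Cons(5))
    then have "(c \<circ> reflect a) \<circ> word ws \<in> P" by (simp add: comp_assoc)
    moreover have "set ws \<subseteq> indecomposables P" using Cons.prems(1) by simp
    ultimately have "\<exists>us b vs. ws = us @ b # vs \<and> (c \<circ> reflect a) \<circ> word us = - b"
      using Cons.IH[OF _ subsystem_reflect[OF D a(2) Cons.prems(2)] False] by blast
    then obtain us b vs where "ws = us @ b # vs" "(c \<circ> reflect a) \<circ> word us = - b" by blast
    then have "a # ws = (a # us) @ b # vs" "c \<circ> word (a # us) = - b" by (auto simp: comp_assoc)
    then show ?thesis by blast
  qed
qed simp

text \<open>The deletion argument: a word that preserves \<open>P\<close> can be shortened by two letters.\<close>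

lemma word_preserving_trivial:
  assumes D: "subsystem D" and P: "pos_system D P"
    and "set ws \<subseteq> indecomposables P" "\<And>b. b \<in> P \<Longrightarrow> b \<circ> word ws \<in> P"
  shows "word ws = id"
  using assms(3-)
proof (induction "length ws" arbitrary: ws rule: less_induct)
  case less
  show ?case
  proof (cases ws)
    case (Cons a vs)
    have PR: "P \<subseteq> roots_H" "half_closed P" "P \<subseteq> D" using P by (auto simp: pos_system_def half_closed_def)
    have iR: "indecomposables P \<subseteq> roots_H" using PR by (auto simp: indecomposables_def)
    have a: "a \<in> P" "a \<in> roots_H" using less Cons PR by (auto simp: indecomposables_def)
    have ma: "- a \<notin> P" "- a \<in> D" using a PR D by (auto simp: half_closed_def subsystem_def)
    have "a \<circ> word ws \<in> P" using less a by blast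
    then have "(a \<circ> reflect a) \<circ> word vs \<in> P" using Cons by (simp add: comp_assoc)
    then have "(- a) \<circ> word vs \<in> P" using comp_reflect_self[OF a(2)] by simp
    then obtain us b rs where vs: "vs = us @ b # rs" "(- a) \<circ> word us = - b"
      using word_sign_change[OF D P _ ma(2,1), of vs] less(2) Cons by auto
    have us: "set us \<subseteq> roots_H" and b: "b \<in> roots_H" using less(2) Cons vs iR by auto
    have ab: "a \<circ> word us = b" using vs(2) by (simp add: neg_comp)
    have "word ws = (reflect a \<circ> word us) \<circ> reflect b \<circ> word rs"
      by (simp add: Cons vs(1) word_append comp_assoc)
    also have "reflect a \<circ> word us = word us \<circ> reflect b" using word_conj[OF a(2) us] ab by simp
    also have "word us \<circ> reflect b \<circ> reflect b \<circ> word rs = word us \<circ> (reflect b \<circ> reflect b) \<circ> word rs"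
      by (simp add: comp_assoc)
    also have "\<dots> = word (us @ rs)" using b by (simp add: reflect_comp_reflect word_append)
    finally have eq: "word ws = word (us @ rs)" .
    have "word (us @ rs) = id"
      using less(2,3) eq Cons vs(1) by (intro less.hyps) auto
    then show ?thesis using eq by simp
  qed simp
qed

lemma reflection_group_indecomposables:
  assumes D: "subsystem D" and P: "pos_system D P" and w: "w \<in> reflection_group D"
  shows "w \<in> reflection_group (indecomposables P)"
proof -
  have reflect: "reflect b \<in> reflection_group (indecomposables P)" if b: "b \<in> D" for b
  proof (cases "b \<in> P")
    case True then show ?thesis by (rule reflect_in_reflection_group_indecomposables[OF D P])
  next
    case False
    then have m: "- b \<in> P" using b P by (auto simp: pos_system_def)
    have bR: "b \<in> roots_H" using b D by (auto simp: subsystem_def)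
    have "reflect (- b) = reflect b" by (simp add: reflection_def fun_eq_iff coroot_neg bR)
    then show ?thesis using reflect_in_reflection_group_indecomposables[OF D P m] by simp
  qed
  have "word as \<in> reflection_group (indecomposables P)" if "set as \<subseteq> D" for as
    using that by (induction as) (auto intro: reflection_group_id reflection_group_comp reflect)
  then show ?thesis using w by (auto simp: reflection_group_def[of D])
qed

lemma reflection_group_preserving_trivial:
  assumes D: "subsystem D" and P: "pos_system D P" and w: "w \<in> reflection_group D"
    and "\<And>b. b \<in> P \<Longrightarrow> b \<circ> w \<in> P"
  shows "w = id"
  using reflection_group_indecomposables[OF D P w] word_preserving_trivial[OF D P] assms(4) by (auto simp: reflection_group_def)

theorem pos_systems_conjugate_unique:
  assumes D: "subsystem D" and Q: "pos_system D Q" and P: "pos_system D P"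
  shows "\<exists>!w. w \<in> reflection_group D \<and> (\<lambda>b. b \<circ> w) ` Q = P"
proof (rule ex_ex1I)
  show "\<exists>w. w \<in> reflection_group D \<and> (\<lambda>b. b \<circ> w) ` Q = P" using pos_systems_conjugate[OF assms] by blast
  fix v w assume v: "v \<in> reflection_group D \<and> (\<lambda>b. b \<circ> v) ` Q = P" and w: "w \<in> reflection_group D \<and> (\<lambda>b. b \<circ> w) ` Q = P"
  have DR: "D \<subseteq> roots_H" using D by (simp add: subsystem_def)
  obtain v' where v': "v' \<in> reflection_group D" "v' \<circ> v = id" "v \<circ> v' = id" using v reflection_group_inverse DR by metis
  have "v' \<circ> w = id"
  proof (rule reflection_group_preserving_trivial[OF D P])
    show "v' \<circ> w \<in> reflection_group D" using v' w by (simp add: reflection_group_comp)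
    fix b assume "b \<in> P"
    then obtain c where c: "c \<in> Q" "b = c \<circ> v" using v by blast
    have "b \<circ> (v' \<circ> w) = c \<circ> (v \<circ> v') \<circ> w" unfolding c(2) by (simp only: comp_assoc)
    also have "\<dots> = c \<circ> w" by (simp add: v')
    also have "\<dots> \<in> P" using c w by blast
    finally show "b \<circ> (v' \<circ> w) \<in> P" .
  qed
  then have "v \<circ> v' \<circ> w = v" by (simp add: comp_assoc)
  then show "v = w" using v' by simp
qed

end

section \<open>Borel subalgebras and the highest root\<close>

context simple_lie_cartan
begin

section \<open>Solvable subalgebras built from closed sets of roots\<close>

abbreviation root_sum_with_H :: "('g \<Rightarrow> complex) set \<Rightarrow> 'g set" where
  "root_sum_with_H P \<equiv> span (\<Union>a\<in>insert 0 P. wspace a)"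

lemma bracket_root_spaces_mem:
  assumes P: "half_closed P" and a: "a \<in> P" "x \<in> wspace a" and b: "b \<in> P" "y \<in> wspace b"
  shows "bracket x y = 0 \<or> a + b \<in> P \<and> bracket x y \<in> wspace (a + b)"
proof (cases "bracket x y = 0")
  case False
  have "a + b \<noteq> 0" using P a b by (auto simp: half_closed_def add_eq_0_iff)
  moreover have "a + b \<in> dual H" using P a b by (auto simp: half_closed_def intro: dual_closed roots_H_dual)
  ultimately have "a + b \<in> roots_H" using bracket_wspace[OF a(2) b(2)] False by (intro roots_HI) auto
  then show ?thesis using P a b bracket_wspace[OF a(2) b(2)] by (auto simp: half_closed_def)
qed simp

lemma subalgebra_root_sum_with_H:
  assumes P: "half_closed P" shows "subalgebra (root_sum_with_H P)"
proof -
  have "bracket x y \<in> root_sum_with_H P" if x: "x \<in> root_sum_with_H P" and y: "y \<in> root_sum_with_H P" for x y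
  proof (rule span_bracket_closed[OF _ _ x y])
    fix x y assume "x \<in> (\<Union>a\<in>insert 0 P. wspace a)" "y \<in> (\<Union>a\<in>insert 0 P. wspace a)"
    then obtain a b where a: "a \<in> insert 0 P" "x \<in> wspace a" and b: "b \<in> insert 0 P" "y \<in> wspace b" by blast
    have xy: "bracket x y \<in> wspace (a + b)" by (rule bracket_wspace[OF a(2) b(2)])
    have "bracket x y = 0 \<or> a + b \<in> insert 0 P"
    proof (cases "a = 0 \<or> b = 0")
      case True then show ?thesis using a b by auto
    next
      case False then show ?thesis using bracket_root_spaces_mem[OF P _ a(2) _ b(2)] a b by blast
    qed
    then show "bracket x y \<in> root_sum_with_H P" using xy span_base[of "bracket x y" "\<Union>a\<in>insert 0 P. wspace a"]
      by (auto simp: span_zero)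
  qed simp
  then show ?thesis by (simp add: subalgebra_def)
qed

text \<open>The derived series loses \<open>H\<close> in its first step and gains height in every
  further one; heights are bounded by \<open>card P\<close>.\<close>

lemma solvable_root_sum_with_H:
  assumes P: "half_closed P" shows "solvable (root_sum_with_H P)"
proof -
  let ?B = "root_sum_with_H P"
  define U where "U n = (\<Union>a\<in>{a \<in> P. n \<le> height P a}. wspace a)" for n
  have UI: "x \<in> span (U n)" if "a \<in> P" "n \<le> height P a" "x \<in> wspace a" for x a n
    using that by (intro span_base) (auto simp: U_def)
  have sub: "derived_series ?B (Suc n) \<subseteq> span (U n)" for n
  proof (induction n)
    case 0
    have "bracket x y \<in> span (U 0)" if x: "x \<in> ?B" and y: "y \<in> ?B" for x y
    proof (rule span_bracket_closed[OF _ _ x y])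
      fix x y assume "x \<in> (\<Union>a\<in>insert 0 P. wspace a)" "y \<in> (\<Union>a\<in>insert 0 P. wspace a)"
      then obtain a b where a: "a \<in> insert 0 P" "x \<in> wspace a" and b: "b \<in> insert 0 P" "y \<in> wspace b" by blast
      have xy: "bracket x y \<in> wspace (a + b)" by (rule bracket_wspace[OF a(2) b(2)])
      consider "a = 0" "b = 0" | "a = 0" "b \<in> P" | "a \<in> P" "b = 0" | "a \<in> P" "b \<in> P" using a b by blast
      then show "bracket x y \<in> span (U 0)"
      proof cases
        case 1 then show ?thesis using a b abelian_H by (simp add: wspace_0 span_zero)
      next
        case 2 then show ?thesis using xy UI[of b 0] by simp
      next
        case 3 then show ?thesis using xy UI[of a 0] by simp
      next
        case 4 then show ?thesis using bracket_root_spaces_mem[OF P _ a(2) _ b(2)] UI[of "a + b" 0 "bracket x y"] by (auto simp: span_zero)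
      qed
    qed simp
    then have "{bracket x y | x y. x \<in> derived_series ?B 0 \<and> y \<in> derived_series ?B 0} \<subseteq> span (U 0)"
      by (simp only: derived_series.simps(1)) blast
    then have "span {bracket x y | x y. x \<in> derived_series ?B 0 \<and> y \<in> derived_series ?B 0} \<subseteq> span (U 0)"
      by (intro span_minimal) auto
    then show ?case by (simp only: derived_series.simps(2)[of ?B 0])
  next
    case (Suc n)
    have "bracket x y \<in> span (U (Suc n))" if x: "x \<in> span (U n)" and y: "y \<in> span (U n)" for x y
    proof (rule span_bracket_closed[OF _ _ x y])
      fix x y assume "x \<in> U n" "y \<in> U n"
      then obtain a b where a: "a \<in> P" "n \<le> height P a" "x \<in> wspace a" and b: "b \<in> P" "y \<in> wspace b"
        by (auto simp: U_def)
      have "Suc n \<le> height P (a + b)" using height_add(1)[OF P a(1) b(1)] a(2) by simp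
      then show "bracket x y \<in> span (U (Suc n))"
        using bracket_root_spaces_mem[OF P a(1,3) b] UI[of "a + b" "Suc n" "bracket x y"] by (auto simp: span_zero)
    qed simp
    then have "{bracket x y | x y. x \<in> derived_series ?B (Suc n) \<and> y \<in> derived_series ?B (Suc n)} \<subseteq> span (U (Suc n))"
      using Suc by blast
    then have "span {bracket x y | x y. x \<in> derived_series ?B (Suc n) \<and> y \<in> derived_series ?B (Suc n)} \<subseteq> span (U (Suc n))"
      by (intro span_minimal) auto
    then show ?case by (simp only: derived_series.simps(2)[of ?B "Suc n"])
  qed
  have "finite P" using P finite_roots_H finite_subset by (auto simp: half_closed_def)
  then have "height P a \<le> card P" for a unfolding height_def by (intro card_mono) auto
  then have "{a \<in> P. Suc (card P) \<le> height P a} = {}" by (simp add: not_less_eq_eq)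
  then have "U (Suc (card P)) = {}" unfolding U_def by (simp only: UN_empty)
  then have "derived_series ?B (Suc (Suc (card P))) \<subseteq> {0}" using sub[of "Suc (card P)"] by simp
  moreover have "0 \<in> derived_series ?B (Suc (Suc (card P)))" by (simp add: span_zero)
  ultimately show ?thesis unfolding solvable_def by blast
qed

text \<open>The span of an sl2-triple is its own derived algebra, so the triple survives in the
  whole derived series.\<close>

lemma opposite_roots_not_solvable:
  assumes "subspace K" "\<And>x y. x \<in> K \<Longrightarrow> y \<in> K \<Longrightarrow> bracket x y \<in> K"
    and a: "a \<in> roots_H" "wspace a \<subseteq> K" "wspace (- a) \<subseteq> K"
  shows "\<not> solvable K"
proof
  assume "solvable K"
  then obtain n where n: "derived_series K n = {0}" by (auto simp: solvable_def)
  obtain e f h where t: "sl2_triple a e f h" using sl2_triple_all[OF a(1)] .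
  note T = sl2_tripleD[OF t]
  have he: "bracket h e = 2 *s e" using gsD[OF T(2,6)] T(5) by simp
  have "e \<in> derived_series K n \<and> f \<in> derived_series K n \<and> h \<in> derived_series K n"
  proof (induction n)
    case 0
    have "e \<in> K" "f \<in> K" using a T(2,3) by auto
    then show ?case using assms(2)[of e f] T(4) by simp
  next
    case (Suc n)
    let ?S = "{bracket x y | x y. x \<in> derived_series K n \<and> y \<in> derived_series K n}"
    have S: "bracket x y \<in> span ?S" if "x \<in> derived_series K n" "y \<in> derived_series K n" for x y
      using that by (intro span_base) blast
    have "2 *s e \<in> span ?S" "(- 2) *s f \<in> span ?S" "h \<in> span ?S"
      using S[of h e] S[of h f] S[of e f] Suc he T(4,14) by auto
    then have "e \<in> span ?S" "f \<in> span ?S" "h \<in> span ?S"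
      using subspace_scale_cancel[of "span ?S" 2 e] subspace_scale_cancel[of "span ?S" "- 2" f] by auto
    then show ?case by simp
  qed
  then show False using n T(7) by simp
qed

section \<open>The highest root\<close>

text \<open>Applying lowering operators to a maximal root vector already generates an ideal; this is what
  makes a maximal root the highest one.\<close>

inductive lower :: "('g \<Rightarrow> complex) set \<Rightarrow> 'g \<Rightarrow> ('g \<Rightarrow> complex) \<Rightarrow> 'g \<Rightarrow> ('g \<Rightarrow> complex) \<Rightarrow> bool"
  for P x0 t where
  start: "lower P x0 t x0 t"
| step: "lower P x0 t y b \<Longrightarrow> a \<in> indecomposables P \<Longrightarrow> f \<in> wspace (- a) \<Longrightarrow> lower P x0 t (bracket f y) (b - a)"

text \<open>The root space of \<open>a + b\<close> is spanned by one bracket, whose action is a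
  commutator. Stability of \<open>M\<close> thus spreads from the simple roots to all
  others.\<close>

lemma root_space_sum_stable:
  assumes ab: "a \<in> roots_H" "b \<in> roots_H" "a + b \<in> roots_H" and M: "subspace M"
    and a: "\<And>x m. x \<in> wspace a \<Longrightarrow> m \<in> M \<Longrightarrow> bracket x m \<in> M"
    and b: "\<And>x m. x \<in> wspace b \<Longrightarrow> m \<in> M \<Longrightarrow> bracket x m \<in> M"
    and z: "z \<in> wspace (a + b)" and m: "m \<in> M"
  shows "bracket z m \<in> M"
proof -
  obtain x y where x: "x \<in> wspace a" "x \<noteq> 0" and y: "y \<in> wspace b" "y \<noteq> 0"
    using roots_H_obtain[OF ab(1)] roots_H_obtain[OF ab(2)] by metis
  obtain c where c: "z = c *s bracket x y"
    using wspace_spanned[OF ab(3) bracket_wspace[OF x(1) y(1)] bracket_root_spaces_nonzero[OF ab x y] z] by blast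
  have "bracket (bracket x y) m \<in> M"
    unfolding bracket_deriv2 using a b x(1) y(1) m by (intro subspace_diff M) auto
  then show ?thesis using c by (simp add: bracket_scale_left subspace_scale M)
qed

lemma indecomposables_diff:
  assumes P: "pos_system roots_H P" and a: "a \<in> indecomposables P" and b: "b \<in> indecomposables P" and "a \<noteq> b"
  shows "a - b \<notin> insert 0 roots_H"
proof
  assume "a - b \<in> insert 0 roots_H"
  then have "a - b \<in> roots_H" using assms(4) by simp
  then have "a - b \<in> P \<or> - (a - b) \<in> P" using P unfolding pos_system_def by blast
  moreover have "a = b + (a - b)" "b = a + - (a - b)" by simp_all
  ultimately show False using a b unfolding indecomposables_def by blast
qed

text \<open>The span is stable under simple lowering operators by construction. A simple raising
  operator is commuted down to \<open>x0\<close>, which it kills by maximality of \<open>t\<close>.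
  Stability under all root spaces follows, so the span is a nonzero ideal.\<close>

lemma maximal_root_generates:
  assumes P: "pos_system roots_H P" and t: "t \<in> P" and x0: "x0 \<in> wspace t" "x0 \<noteq> 0"
    and max: "\<And>a. a \<in> indecomposables P \<Longrightarrow> t + a \<notin> roots_H"
  shows "span {y. \<exists>b. lower P x0 t y b} = UNIV"
proof -
  let ?L = "{y. \<exists>b. lower P x0 t y b}"
  let ?M = "span ?L"
  have hP: "half_closed P" "P \<subseteq> roots_H" using P by (auto simp: pos_system_def)
  have iP: "a \<in> P" "a \<in> roots_H" if "a \<in> indecomposables P" for a using that hP by (auto simp: indecomposables_def)
  have wt: "y \<in> wspace b" if "lower P x0 t y b" for y b
    using that
  proof induction
    case (step y b a f)
    have "bracket f y \<in> wspace (- a + b)" by (rule bracket_wspace[OF step(3,4)])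
    then show "bracket f y \<in> wspace (b - a)" by simp
  qed (rule x0)
  have stab: "bracket x m \<in> ?M" if "m \<in> ?M" "\<And>y. y \<in> ?L \<Longrightarrow> bracket x y \<in> ?M" for x m
    by (rule span_bracket_closed[of "{x}" ?L]) (use that in \<open>auto intro: span_base\<close>)
  have st0: "bracket h m \<in> ?M" if "h \<in> wspace 0" "m \<in> ?M" for h m
  proof (rule stab[OF that(2)])
    fix y assume y: "y \<in> ?L"
    then obtain b where "lower P x0 t y b" by blast
    then have "bracket h y = b h *s y" by (rule gsD[OF wt that(1)[unfolded wspace_0]])
    then show "bracket h y \<in> ?M" using span_scale[OF span_base[OF y], of "b h"] by (simp only:)
  qed
  have stm: "bracket f m \<in> ?M" if "f \<in> wspace (- a)" "a \<in> indecomposables P" "m \<in> ?M" for f a m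
  proof (rule stab[OF that(3)])
    fix y assume "y \<in> ?L"
    then obtain b where "lower P x0 t y b" by blast
    then have "lower P x0 t (bracket f y) (b - a)" by (rule lower.step[OF _ that(2,1)])
    then have "bracket f y \<in> ?L" by blast
    then show "bracket f y \<in> ?M" by (rule span_base)
  qed
  have stp: "bracket e m \<in> ?M" if e: "e \<in> wspace a" and a: "a \<in> indecomposables P" and m: "m \<in> ?M" for e a m
  proof (rule stab[OF m])
    fix y assume "y \<in> ?L"
    then obtain b where "lower P x0 t y b" by blast
    then show "bracket e y \<in> ?M"
    proof induction
      case start
      have "a + t \<noteq> 0" using hP(1) iP(1)[OF a] t by (auto simp: half_closed_def add_eq_0_iff)
      then have "a + t \<notin> insert 0 roots_H" using max[OF a] by (simp add: add.commute)
      moreover have "a + t \<in> dual H" using iP(2)[OF a] t hP by (intro dual_closed) (auto dest: roots_H_dual)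
      ultimately have "bracket e x0 = 0" using wspace_trivial bracket_wspace[OF e x0(1)] by blast
      then show ?case by (simp add: span_zero)
    next
      case (step y b c f)
      have "y \<in> ?L" using step(1) by blast
      then have y: "y \<in> ?M" by (rule span_base)
      \<comment> \<open>The weight of \<open>[e, f]\<close> is a difference of simple roots: it is
        zero, which leaves an element of \<open>H\<close>, or it is no weight and the bracket
        vanishes.\<close>
      have "bracket (bracket e f) y \<in> ?M"
      proof (cases "a = c")
        case True
        then have "bracket e f \<in> wspace 0" using bracket_wspace[OF e step(3)] by simp
        then show ?thesis by (rule st0[OF _ y])
      next
        case False
        have "a - c \<in> dual H" using iP a step by (intro dual_closed) (auto dest: roots_H_dual)
        moreover have "bracket e f \<in> wspace (a - c)" using bracket_wspace[OF e step(3)] by simp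
        ultimately have "bracket e f = 0" using indecomposables_diff[OF P a step(2) False] wspace_trivial by blast
        then show ?thesis by (simp add: span_zero)
      qed
      moreover have "bracket f (bracket e y) \<in> ?M" by (rule stm[OF step(3,2,4)])
      ultimately show ?case unfolding bracket_deriv[of e f y] by (intro span_add)
    qed
  qed
  have all: "(\<forall>x\<in>wspace a. \<forall>m\<in>?M. bracket x m \<in> ?M) \<and> (\<forall>x\<in>wspace (- a). \<forall>m\<in>?M. bracket x m \<in> ?M)"
    if "a \<in> P" for a
    using hP(1) that
  proof (induction rule: half_closed_induct)
    case (indec a) then show ?case using stm stp by blast
  next
    case (add b c)
    have R: "b \<in> roots_H" "c \<in> roots_H" "b + c \<in> roots_H" "- b \<in> roots_H" "- c \<in> roots_H" "- (b + c) \<in> roots_H" "- b + - c \<in> roots_H"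
      using add(1-3) hP(2) roots_H_neg_iff[of "b + c"] roots_H_neg by auto
    have 1: "bracket x m \<in> ?M" if "x \<in> wspace (b + c)" "m \<in> ?M" for x m
      by (rule root_space_sum_stable[OF R(1-3) subspace_span _ _ that]) (use add(4,5) in blast)+
    have 2: "bracket x m \<in> ?M" if "x \<in> wspace (- b + - c)" "m \<in> ?M" for x m
      by (rule root_space_sum_stable[OF R(4,5,7) subspace_span _ _ that]) (use add(4,5) in blast)+
    have "- b + - c = - (b + c)" by simp
    then show "(\<forall>x\<in>wspace (b + c). \<forall>m\<in>?M. bracket x m \<in> ?M) \<and> (\<forall>x\<in>wspace (- (b + c)). \<forall>m\<in>?M. bracket x m \<in> ?M)"
      using 1 2 by (simp only:) blast
  qed
  have "bracket x m \<in> ?M" if m: "m \<in> ?M" for x m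
  proof (rule span_bracket_closed[of "\<Union>a\<in>insert 0 roots_H. wspace a" "{m}"])
    show "x \<in> span (\<Union>a\<in>insert 0 roots_H. wspace a)" using weight_spaces_span by blast
    show "m \<in> span {m}" by (simp add: span_base)
    fix x' m' assume "x' \<in> (\<Union>a\<in>insert 0 roots_H. wspace a)" "m' \<in> {m}"
    then obtain a where a: "a \<in> insert 0 roots_H" "x' \<in> wspace a" "m' = m" by blast
    show "bracket x' m' \<in> ?M"
    proof (cases "a = 0")
      case True then show ?thesis using st0 a m by blast
    next
      case False
      then have aR: "a \<in> roots_H" using a by blast
      then consider "a \<in> P" | "- a \<in> P" using P by (auto simp: pos_system_def)
      then show ?thesis
      proof cases
        case 1 then show ?thesis using all a m by blast
      next
        case 2
        have "x' \<in> wspace (- (- a))" using a by simp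
        then show ?thesis using all[OF 2] a m by blast
      qed
    qed
  qed simp
  then have "lie_ideal ?M" by (simp add: lie_ideal_def)
  then have "?M = {0} \<or> ?M = UNIV" by (rule simple)
  moreover have "x0 \<in> ?L" using lower.start by blast
  then have "x0 \<in> ?M" by (rule span_base)
  ultimately show ?thesis using x0 by auto
qed

definition nat_comb :: "('g \<Rightarrow> complex) set \<Rightarrow> ('g \<Rightarrow> complex) \<Rightarrow> bool" where
  "nat_comb S g \<longleftrightarrow> (\<exists>c :: ('g \<Rightarrow> complex) \<Rightarrow> nat. g = (\<Sum>a\<in>S. of_nat (c a) * a))"

lemma nat_comb_iff:
  "nat_comb S (t - b) \<longleftrightarrow>
    (\<exists>c :: ('g \<Rightarrow> complex) \<Rightarrow> nat. \<forall>x. t x - b x = (\<Sum>a\<in>S. of_nat (c a) * a x))"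
  by (simp add: nat_comb_def fun_eq_iff sum_fun_apply)

lemma nat_comb_0: "nat_comb S 0"
  unfolding nat_comb_def by (intro exI[of _ "\<lambda>_. 0"]) simp

lemma nat_comb_add:
  assumes "finite S" "nat_comb S g" "a \<in> S" shows "nat_comb S (g + a)"
proof -
  obtain c :: "('g \<Rightarrow> complex) \<Rightarrow> nat" where c: "g = (\<Sum>a\<in>S. of_nat (c a) * a)"
    using assms by (auto simp: nat_comb_def)
  have "(\<Sum>b\<in>S. of_nat ((c(a := Suc (c a))) b) * b) = (\<Sum>b\<in>S. of_nat (c b) * b + (if b = a then a else 0))"
  proof (rule sum.cong[OF refl])
    fix b
    show "of_nat ((c(a := Suc (c a))) b) * b = of_nat (c b) * b + (if b = a then a else 0)"
    proof (cases "b = a")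
      case True then show ?thesis by (simp add: distrib_right add.commute)
    qed simp
  qed
  also have "\<dots> = g + a" using assms c by (simp add: sum.distrib)
  finally show ?thesis unfolding nat_comb_def by metis
qed

lemma nat_comb_semigroup_span:
  assumes "nat_comb S g" shows "g = 0 \<or> g \<in> semigroup_span S"
proof (cases "finite S")
  case True
  obtain c :: "('g \<Rightarrow> complex) \<Rightarrow> nat" where c: "g = (\<Sum>a\<in>S. of_nat (c a) * a)"
    using assms by (auto simp: nat_comb_def)
  have "F \<subseteq> S \<Longrightarrow> (\<Sum>a\<in>F. of_nat (c a) * a) = 0 \<or> (\<Sum>a\<in>F. of_nat (c a) * a) \<in> semigroup_span S" if "finite F" for F
    using that
  proof (induction F)
    case (insert a F)
    let ?s = "\<Sum>a\<in>F. of_nat (c a) * a"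
    have s: "(\<Sum>a\<in>insert a F. of_nat (c a) * a) = of_nat (c a) * a + ?s" using insert by simp
    have IH: "?s = 0 \<or> ?s \<in> semigroup_span S" using insert.IH insert.prems by blast
    show "(\<Sum>a\<in>insert a F. of_nat (c a) * a) = 0 \<or> (\<Sum>a\<in>insert a F. of_nat (c a) * a) \<in> semigroup_span S"
      unfolding s
    proof (cases "c a")
      case 0 then show "of_nat (c a) * a + ?s = 0 \<or> of_nat (c a) * a + ?s \<in> semigroup_span S"
        using IH by (simp only: of_nat_0 mult_zero_left add_0_left)
    next
      case (Suc n)
      have "of_nat (Suc n) * a \<in> semigroup_span S"
        using insert.prems by (intro semigroup_span_mult semigroup_span.base) auto
      then show "of_nat (c a) * a + ?s = 0 \<or> of_nat (c a) * a + ?s \<in> semigroup_span S"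
        unfolding Suc using IH semigroup_span_add[of "of_nat (Suc n) * a" S ?s]
        by (elim disjE) (simp_all only: add_0_right simp_thms)
    qed
  qed simp
  then show ?thesis using True c by blast
next
  case False then show ?thesis using assms by (simp add: nat_comb_def)
qed

text \<open>To a root \<open>t\<close> of maximal height no simple root can be added, so its
  lowerings span everything and every weight is \<open>t\<close> minus a sum of simple roots. Two
  candidates would differ by a positive sum in either direction, contrary to
  \<open>half_closed_no_zero\<close>.\<close>

lemma highest_root_exists:
  assumes P: "pos_system roots_H P"
  shows "\<exists>!t. t \<in> roots_H \<and> (\<forall>b\<in>roots_H. nat_comb (indecomposables P) (t - b))"
proof (rule ex_ex1I)
  have hP: "half_closed P" "P \<subseteq> roots_H" using P by (auto simp: pos_system_def)
  have "indecomposables P \<subseteq> P" by (auto simp: indecomposables_def)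
  then have fin: "finite P" "finite (indecomposables P)"
    using finite_subset[OF hP(2) finite_roots_H] finite_subset by auto
  have "roots_H \<noteq> {}"
  proof
    assume "roots_H = {}"
    then have "h = 0" if "h \<in> H" for h using roots_separate[OF that] by blast
    then show False using H_nonzero H_closed(1) by blast
  qed
  then have "P \<noteq> {}" using P by (auto simp: pos_system_def)
  then have "Max (height P ` P) \<in> height P ` P" using fin by (intro Max_in) auto
  then obtain t where t: "t \<in> P" "height P t = Max (height P ` P)" by force
  have max: "t + a \<notin> roots_H" if a: "a \<in> indecomposables P" for a
  proof
    assume "t + a \<in> roots_H"
    have aP: "a \<in> P" using a by (simp add: indecomposables_def)
    then have "t + a \<in> P" using t(1) hP \<open>t + a \<in> roots_H\<close> by (auto simp: half_closed_def)
    then have "height P (t + a) \<le> height P t" unfolding t(2) using fin by (intro Max_ge) auto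
    then show False using height_add(1)[OF hP(1) t(1) aP] by simp
  qed
  obtain x0 where x0: "x0 \<in> wspace t" "x0 \<noteq> 0" using t hP roots_H_obtain by blast
  define Lw where "Lw = {b. nat_comb (indecomposables P) (t - b)}"
  have low: "y \<in> wspace b \<and> b \<in> dual H \<and> b \<in> Lw" if "lower P x0 t y b" for y b
    using that
  proof induction
    case start then show ?case using x0 t hP nat_comb_0 by (auto simp: Lw_def dest: roots_H_dual)
  next
    case (step y b a f)
    have "bracket f y \<in> wspace (- a + b)" using step by (intro bracket_wspace) auto
    moreover have "- a + b = b - a" by simp
    moreover have "b - a \<in> dual H" using step hP by (intro dual_closed) (auto simp: indecomposables_def dest: roots_H_dual)
    moreover have "nat_comb (indecomposables P) ((t - b) + a)"
      using step fin by (intro nat_comb_add) (auto simp: Lw_def)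
    moreover have "(t - b) + a = t - (b - a)" by simp
    ultimately show "bracket f y \<in> wspace (b - a) \<and> b - a \<in> dual H \<and> b - a \<in> Lw"
      unfolding Lw_def by (simp only: mem_Collect_eq)
  qed
  let ?I = "insert 0 roots_H \<inter> Lw"
  have "{y. \<exists>b. lower P x0 t y b} \<subseteq> span (\<Union>b\<in>?I. wspace b)"
  proof
    fix y assume "y \<in> {y. \<exists>b. lower P x0 t y b}"
    then obtain b where b: "y \<in> wspace b" "b \<in> dual H" "b \<in> Lw" using low by blast
    show "y \<in> span (\<Union>b\<in>?I. wspace b)"
    proof (cases "y = 0")
      case False
      then have "b \<in> ?I" using weight_nonzero_in[OF b(2,1)] b by blast
      then show ?thesis using b(1) by (intro span_base) blast
    qed (simp add: span_zero)
  qed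
  then have "span {y. \<exists>b. lower P x0 t y b} \<subseteq> span (\<Union>b\<in>?I. wspace b)" by (intro span_minimal) auto
  then have UN: "span (\<Union>b\<in>?I. wspace b) = UNIV" using maximal_root_generates[OF P t(1) x0 max] by blast
  have "b \<in> Lw" if b: "b \<in> roots_H" for b
  proof (rule ccontr)
    assume n: "b \<notin> Lw"
    obtain x where x: "x \<in> wspace b" "x \<noteq> 0" using roots_H_obtain[OF b] .
    have fI: "finite ?I" using finite_roots_H by blast
    obtain y where y: "\<And>a. a \<in> ?I \<Longrightarrow> y a \<in> wspace a" "x = sum y ?I"
      using span_weight_sum[OF fI, of x] UN by blast
    \<comment> \<open>A vector of a missing weight, expanded in the other weight spaces, becomes a
      vanishing sum over distinct weights.\<close>
    define z where "z a = (if a = b then - x else y a)" for a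
    have bI: "b \<notin> ?I" using n by blast
    have "sum z (insert b ?I) = - x + sum z ?I" using fI bI by (simp add: z_def)
    also have "sum z ?I = sum y ?I" using bI by (intro sum.cong) (auto simp: z_def)
    also have "- x + sum y ?I = 0" using y(2) by simp
    finally have s: "sum z (insert b ?I) = 0" .
    have "z b = 0"
    proof (rule weight_sum_zero[OF _ _ _ s])
      show "finite (insert b ?I)" using fI by blast
      show "insert b ?I \<subseteq> dual H" using insert_roots_H_dual b by blast
      show "z a \<in> wspace a" if "a \<in> insert b ?I" for a
        using that y(1)[of a] x(1) subspace_neg[OF subspace_wspace, of x b] by (cases "a = b") (auto simp: z_def)
    qed simp
    then show False using x by (simp add: z_def)
  qed
  then show "\<exists>t. t \<in> roots_H \<and> (\<forall>b\<in>roots_H. nat_comb (indecomposables P) (t - b))"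
    using t hP unfolding Lw_def by blast
  fix s u assume s: "s \<in> roots_H \<and> (\<forall>b\<in>roots_H. nat_comb (indecomposables P) (s - b))"
    and u: "u \<in> roots_H \<and> (\<forall>b\<in>roots_H. nat_comb (indecomposables P) (u - b))"
  have sub: "semigroup_span (indecomposables P) \<subseteq> semigroup_span P"
  proof
    fix x assume "x \<in> semigroup_span (indecomposables P)"
    then show "x \<in> semigroup_span P"
      by (rule semigroup_span_mono) (auto simp: indecomposables_def intro: semigroup_span.base)
  qed
  show "s = u"
  proof (rule ccontr)
    assume "s \<noteq> u"
    then have nz: "s - u \<noteq> 0" "u - s \<noteq> 0" by auto
    have "s - u \<in> semigroup_span P" "u - s \<in> semigroup_span P"
      using nat_comb_semigroup_span[of _ "s - u"] nat_comb_semigroup_span[of _ "u - s"] s u nz sub by blast+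
    then have "(s - u) + (u - s) \<in> semigroup_span P" by (rule semigroup_span_add)
    then show False using half_closed_no_zero[OF hP(1)] by simp
  qed
qed

end

section \<open>The positive system of a Borel subalgebra\<close>

sublocale simple_lie_borel \<subseteq> simple_lie_cartan scale bracket H
  by unfold_locales (rule cartan)

context simple_lie_borel
begin

lemma Delta_eq: "Delta = roots_H"
  by (simp add: Delta_def)

lemma borel_facts: "subspace B" "\<And>x y. x \<in> B \<Longrightarrow> y \<in> B \<Longrightarrow> bracket x y \<in> B" "solvable B"
  "\<And>K. subalgebra K \<Longrightarrow> solvable K \<Longrightarrow> B \<subseteq> K \<Longrightarrow> K = B"
  using borel by (auto simp: borel_subalgebra_def subalgebra_def)

lemma wspace_subset_B: "a \<in> roots_H \<Longrightarrow> x \<in> wspace a \<Longrightarrow> x \<in> B \<Longrightarrow> x \<noteq> 0 \<Longrightarrow> wspace a \<subseteq> B"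
  using wspace_spanned borel_facts(1) subspace_scale by blast

lemma Delta_pos_iff: "a \<in> Delta_pos \<longleftrightarrow> a \<in> roots_H \<and> wspace a \<subseteq> B"
  by (simp add: Delta_pos_def Delta_eq)

lemma half_closed_Delta_pos: "half_closed Delta_pos"
  unfolding half_closed_def
proof (intro conjI ballI impI)
  show "Delta_pos \<subseteq> roots_H" by (auto simp: Delta_pos_iff)
  fix a assume a: "a \<in> Delta_pos"
  show "- a \<notin> Delta_pos"
    using opposite_roots_not_solvable[OF borel_facts(1,2)] borel_facts(3) a by (auto simp: Delta_pos_iff)
  fix b assume b: "b \<in> Delta_pos" and ab: "a + b \<in> roots_H"
  obtain x y where x: "x \<in> wspace a" "x \<noteq> 0" and y: "y \<in> wspace b" "y \<noteq> 0"
    using roots_H_obtain a b unfolding Delta_pos_iff by metis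
  have "bracket x y \<noteq> 0" using bracket_root_spaces_nonzero[OF _ _ ab x y] a b by (simp add: Delta_pos_iff)
  moreover have "bracket x y \<in> B" using borel_facts(2) a b x y by (auto simp: Delta_pos_iff)
  ultimately show "a + b \<in> Delta_pos"
    using wspace_subset_B[OF ab bracket_wspace[OF x(1) y(1)]] ab unfolding Delta_pos_iff by blast
qed

lemma B_eq: "B = root_sum_with_H Delta_pos"
proof
  have "B = span (\<Union>a\<in>insert 0 roots_H. wspace a \<inter> B)"
    using borel_facts cartan_subset_borel by (intro stable_subspace_eq_span) auto
  also have "\<dots> \<subseteq> root_sum_with_H Delta_pos"
  proof (rule span_minimal)
    show "(\<Union>a\<in>insert 0 roots_H. wspace a \<inter> B) \<subseteq> root_sum_with_H Delta_pos"
    proof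
      fix x assume "x \<in> (\<Union>a\<in>insert 0 roots_H. wspace a \<inter> B)"
      then obtain a where a: "a \<in> insert 0 roots_H" "x \<in> wspace a" "x \<in> B" by blast
      show "x \<in> root_sum_with_H Delta_pos"
      proof (cases "x = 0")
        case False
        then have "a \<in> insert 0 Delta_pos" using a wspace_subset_B[of a x] by (auto simp only: Delta_pos_iff insert_iff)
        then show ?thesis using a(2) by (intro span_base) blast
      qed (simp add: span_zero)
    qed
  qed simp
  finally show "B \<subseteq> root_sum_with_H Delta_pos" .
  show "root_sum_with_H Delta_pos \<subseteq> B"
    using borel_facts(1) cartan_subset_borel by (intro span_minimal) (auto simp: Delta_pos_iff wspace_0)
qed

text \<open>Extend \<open>Delta_pos\<close> to a positive system \<open>P\<close>. The subalgebra of
  \<open>P\<close> is solvable and contains \<open>B\<close>, so maximality of \<open>B\<close>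
  makes them equal and \<open>P\<close> adds nothing.\<close>

lemma pos_system_Delta_pos: "pos_system roots_H Delta_pos"
proof -
  have "Delta_pos \<subseteq> roots_H" by (auto simp: Delta_pos_iff)
  then obtain P where P: "Delta_pos \<subseteq> P" "pos_system roots_H P"
    using half_closed_extend[OF half_closed_Delta_pos subsystem_roots_H] by blast
  have hP: "half_closed P" "P \<subseteq> roots_H" using P by (auto simp: pos_system_def)
  have "root_sum_with_H Delta_pos \<subseteq> root_sum_with_H P" using P(1) by (intro span_mono) blast
  then have "B \<subseteq> root_sum_with_H P" by (simp only: B_eq[symmetric])
  then have eq: "root_sum_with_H P = B"
    by (rule borel_facts(4)[OF subalgebra_root_sum_with_H[OF hP(1)] solvable_root_sum_with_H[OF hP(1)]])
  have "P \<subseteq> Delta_pos"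
  proof
    fix a assume a: "a \<in> P"
    then have "wspace a \<subseteq> (\<Union>a\<in>insert 0 P. wspace a)" by blast
    also have "\<dots> \<subseteq> root_sum_with_H P" by (rule span_superset)
    finally have "wspace a \<subseteq> B" by (simp only: eq)
    then show "a \<in> Delta_pos" using a hP(2) by (auto simp: Delta_pos_iff)
  qed
  then show ?thesis using P by auto
qed

lemma simple_roots_eq: "simple_roots = indecomposables Delta_pos"
  by (simp add: simple_roots_def indecomposables_def plus_fun_def)

lemma highest_root_spec: "highest_root \<in> roots_H \<and> (\<forall>b\<in>roots_H. nat_comb simple_roots (highest_root - b))"
proof -
  let ?Q = "\<lambda>t. t \<in> roots_H \<and> (\<forall>b\<in>roots_H. nat_comb simple_roots (t - b))"
  have hq: "highest_root = (THE t. ?Q t)"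
    unfolding highest_root_def Delta_eq nat_comb_iff ..
  show ?thesis unfolding hq
    using highest_root_exists[OF pos_system_Delta_pos] unfolding simple_roots_eq by (rule theI')
qed

text \<open>If the highest root were negative, comparing it with its own negative would put twice
  the root into the positive span, which contains twice its negative as well.\<close>

lemma highest_root_in: "highest_root \<in> Delta_pos" "highest_root \<in> roots_H"
proof -
  show R: "highest_root \<in> roots_H" using highest_root_spec by blast
  show "highest_root \<in> Delta_pos"
  proof (rule ccontr)
    assume "highest_root \<notin> Delta_pos"
    then have m: "- highest_root \<in> Delta_pos" using pos_system_Delta_pos R by (auto simp: pos_system_def)
    have "nat_comb simple_roots (highest_root - - highest_root)" using highest_root_spec R roots_H_neg by blast
    then have "highest_root + highest_root = 0 \<or> highest_root + highest_root \<in> semigroup_span simple_roots"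
      using nat_comb_semigroup_span by fastforce
    moreover have "highest_root + highest_root \<noteq> 0"
    proof
      assume "highest_root + highest_root = 0"
      then have "(highest_root + highest_root) (coroot_of highest_root) = (0 :: 'g \<Rightarrow> complex) (coroot_of highest_root)" by simp
      then show False using coroot_self[OF R] by simp
    qed
    ultimately have "highest_root + highest_root \<in> semigroup_span Delta_pos"
      using semigroup_span_mono[of _ simple_roots Delta_pos] semigroup_span.base[of _ Delta_pos]
      by (auto simp: simple_roots_eq indecomposables_def)
    moreover have "- highest_root + - highest_root \<in> semigroup_span Delta_pos"
      using m by (intro semigroup_span_add semigroup_span.base)
    ultimately have "(highest_root + highest_root) + (- highest_root + - highest_root) \<in> semigroup_span Delta_pos"
      by (rule semigroup_span_add)
    then show False using half_closed_no_zero[OF half_closed_Delta_pos] by simp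
  qed
qed

end

section \<open>The Weyl group and the exponential of a Cartan element\<close>

lemma BijGroup_UNIV_simps:
  "bij f \<Longrightarrow> bij g \<Longrightarrow> f \<otimes>\<^bsub>BijGroup UNIV\<^esub> g = f \<circ> g"
  "\<one>\<^bsub>BijGroup UNIV\<^esub> = id"
  "bij f \<Longrightarrow> inv\<^bsub>BijGroup UNIV\<^esub> f = inv_into UNIV f"
  by (auto simp: inv_BijGroup Bij_def) (auto simp: BijGroup_def Bij_def compose_def fun_eq_iff)

context simple_lie_cartan
begin

lemma bij_reflect: "a \<in> roots_H \<Longrightarrow> bij (reflect a)"
  using reflect_comp_reflect o_bij by blast

lemma generate_reflections:
  assumes D: "D \<subseteq> roots_H"
  shows "generate (BijGroup UNIV) (reflect ` D) = reflection_group D"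
proof
  show "generate (BijGroup UNIV) (reflect ` D) \<subseteq> reflection_group D"
  proof
    fix w assume "w \<in> generate (BijGroup UNIV) (reflect ` D)"
    then show "w \<in> reflection_group D"
    proof induction
      case one show ?case by (simp only: BijGroup_UNIV_simps reflection_group_id)
    next
      case (incl h) then show ?case using reflection_group_reflect by blast
    next
      case (inv h)
      then obtain a where a: "a \<in> D" "h = reflect a" by blast
      then have "inv\<^bsub>BijGroup UNIV\<^esub> h = inv_into UNIV h" using D by (intro BijGroup_UNIV_simps) (auto simp: bij_reflect)
      also have "\<dots> \<in> reflection_group D" unfolding a(2) by (rule reflection_group_inv[OF reflection_group_reflect[OF a(1)] D])
      finally show ?case .
    next
      case (eng h1 h2)
      have "h1 \<otimes>\<^bsub>BijGroup UNIV\<^esub> h2 = h1 \<circ> h2" using eng reflection_group_bij D by (intro BijGroup_UNIV_simps) auto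
      then show ?case using reflection_group_comp[OF eng(3,4)] by (simp only:)
    qed
  qed
  have "word as \<in> generate (BijGroup UNIV) (reflect ` D)" if "set as \<subseteq> D" for as
    using that
  proof (induction as)
    case Nil
    have "\<one>\<^bsub>BijGroup UNIV\<^esub> \<in> generate (BijGroup UNIV) (reflect ` D)" by (rule generate.one)
    then show "word [] \<in> generate (BijGroup UNIV) (reflect ` D)" by (simp only: BijGroup_UNIV_simps word.simps)
  next
    case (Cons a as)
    have a: "a \<in> D" "a \<in> roots_H" using Cons D by auto
    have IH: "word as \<in> generate (BijGroup UNIV) (reflect ` D)" using Cons by simp
    have "word as \<in> reflection_group D" using Cons by (auto simp: reflection_group_def)
    then have "bij (word as)" using reflection_group_bij D by blast
    then have "reflect a \<otimes>\<^bsub>BijGroup UNIV\<^esub> word as = word (a # as)" using bij_reflect[OF a(2)] by (simp only: BijGroup_UNIV_simps word.simps)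
    moreover have "reflect a \<otimes>\<^bsub>BijGroup UNIV\<^esub> word as \<in> generate (BijGroup UNIV) (reflect ` D)"
      by (rule generate.eng[OF generate.incl[OF imageI[OF a(1)]] IH])
    ultimately show "word (a # as) \<in> generate (BijGroup UNIV) (reflect ` D)" by (simp only:)
  qed
  then show "reflection_group D \<subseteq> generate (BijGroup UNIV) (reflect ` D)" by (auto simp: reflection_group_def)
qed

lemma pos_system_subset_eq:
  assumes "pos_system D P" "pos_system D Q" "P \<subseteq> Q" shows "P = Q"
proof
  show "Q \<subseteq> P"
  proof
    fix a assume a: "a \<in> Q"
    then have "- a \<notin> Q" "a \<in> D" using assms(2) by (auto simp: pos_system_def half_closed_def)
    then show "a \<in> P" using assms(1,3) by (auto simp: pos_system_def)
  qed
qed fact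

text \<open>Limits in \<open>Ad_exp\<close> are tested on linear functionals; separation makes the
  vector in its definite description unique.\<close>

lemma linear_functionals_separate:
  assumes "\<And>f. Vector_Spaces.linear scale (*) f \<Longrightarrow> f x = f y" shows "x = y"
proof (rule ccontr)
  assume "x \<noteq> y"
  interpret C: vector_space "(*) :: complex \<Rightarrow> complex \<Rightarrow> complex"
    by unfold_locales (simp_all add: algebra_simps)
  interpret VP: vector_space_pair scale "(*) :: complex \<Rightarrow> complex \<Rightarrow> complex" ..
  have "independent {x - y}" using \<open>x \<noteq> y\<close> by simp
  then obtain g where g: "Vector_Spaces.linear scale (*) g" "g (x - y) = 1"
    using VP.linear_independent_extend[of "{x - y}" "\<lambda>_. 1"] by auto
  then have "g x - g y = 1" by (simp add: VP.linear_diff)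
  then show False using assms[OF g(1)] by simp
qed

text \<open>Powers of \<open>ad h\<close> scale the summand of weight \<open>a\<close> by powers of
  \<open>a h\<close>, so under each functional the series is a finite sum of scalar exponential
  series.\<close>

lemma Ad_exp_weight_sum:
  assumes h: "h \<in> H" and I: "finite I" and y: "\<And>a. a \<in> I \<Longrightarrow> y a \<in> wspace a"
  shows "Ad_exp h (sum y I) = (\<Sum>a\<in>I. exp (a h) *s y a)"
proof -
  have pow: "(bracket h ^^ n) (sum y I) = (\<Sum>a\<in>I. (a h) ^ n *s y a)" for n
  proof (induction n)
    case (Suc n)
    have "(bracket h ^^ Suc n) (sum y I) = (\<Sum>a\<in>I. (a h) ^ n *s bracket h (y a))"
      using Suc by (simp add: bracket_sum_right bracket_scale_right)
    also have "\<dots> = (\<Sum>a\<in>I. (a h) ^ Suc n *s y a)"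
      using gsD[OF y h] by (intro sum.cong) (auto simp: mult.commute)
    finally show ?case .
  qed simp
  have S: "(\<lambda>n. f ((bracket h ^^ n) (sum y I)) / fact n) sums f (\<Sum>a\<in>I. exp (a h) *s y a)"
    if f: "Vector_Spaces.linear scale (*) f" for f
  proof -
    interpret f: Vector_Spaces.linear scale "(*) :: complex \<Rightarrow> complex \<Rightarrow> complex" f by (rule f)
    have e: "(\<lambda>n. (a h) ^ n / fact n * f (y a)) sums (exp (a h) * f (y a))" for a
    proof -
      have "(a h) ^ n /\<^sub>R fact n = (a h) ^ n / fact n" for n
        by (simp add: scaleR_conv_of_real divide_inverse mult.commute)
      then show ?thesis using sums_mult2[OF exp_converges[of "a h"], of "f (y a)"] by (simp only:)
    qed
    have "(\<lambda>n. \<Sum>a\<in>I. (a h) ^ n / fact n * f (y a)) sums (\<Sum>a\<in>I. exp (a h) * f (y a))"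
      by (intro sums_sum e)
    then show ?thesis unfolding pow by (simp add: f.sum f.scale sum_divide_distrib)
  qed
  show ?thesis unfolding Ad_exp_def
  proof (rule the_equality)
    show "\<forall>f. Vector_Spaces.linear scale (*) f \<longrightarrow>
      (\<lambda>n. f ((bracket h ^^ n) (sum y I)) / fact n) sums f (\<Sum>a\<in>I. exp (a h) *s y a)" using S by blast
    fix z assume z: "\<forall>f. Vector_Spaces.linear scale (*) f \<longrightarrow>
      (\<lambda>n. f ((bracket h ^^ n) (sum y I)) / fact n) sums f z"
    show "z = (\<Sum>a\<in>I. exp (a h) *s y a)"
      by (rule linear_functionals_separate) (use z S sums_unique2 in blast)
  qed
qed

lemma Ad_exp_eq_iff:
  assumes h: "h \<in> H" and y: "\<And>a. a \<in> insert 0 roots_H \<Longrightarrow> y a \<in> wspace a"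
  shows "Ad_exp h (sum y (insert 0 roots_H)) = c *s sum y (insert 0 roots_H) \<longleftrightarrow>
    (\<forall>a\<in>insert 0 roots_H. exp (a h) = c \<or> y a = 0)"
proof -
  let ?I = "insert 0 roots_H"
  have fin: "finite ?I" using finite_roots_H by blast
  have A: "Ad_exp h (sum y ?I) = (\<Sum>a\<in>?I. exp (a h) *s y a)"
    by (rule Ad_exp_weight_sum[OF h fin y])
  have "Ad_exp h (sum y ?I) - c *s sum y ?I = (\<Sum>a\<in>?I. (exp (a h) - c) *s y a)"
    unfolding A scale_left_diff_distrib sum_subtractf scale_sum_right ..
  then have eq: "Ad_exp h (sum y ?I) = c *s sum y ?I \<longleftrightarrow> (\<Sum>a\<in>?I. (exp (a h) - c) *s y a) = 0"
    by (simp only: eq_iff_diff_eq_0[of "Ad_exp h (sum y ?I)"])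
  show ?thesis unfolding eq
  proof
    assume z: "(\<Sum>a\<in>?I. (exp (a h) - c) *s y a) = 0"
    have mem: "(exp (a h) - c) *s y a \<in> wspace a" if "a \<in> ?I" for a
      by (rule subspace_scale[OF subspace_wspace y[OF that]])
    have "(exp (a h) - c) *s y a = 0" if "a \<in> ?I" for a
      by (rule weight_sum_zero[where y = "\<lambda>a. (exp (a h) - c) *s y a", OF fin insert_roots_H_dual mem z that])
    then show "\<forall>a\<in>?I. exp (a h) = c \<or> y a = 0" by auto
  next
    assume "\<forall>a\<in>?I. exp (a h) = c \<or> y a = 0"
    then show "(\<Sum>a\<in>?I. (exp (a h) - c) *s y a) = 0" by (intro sum.neutral) auto
  qed
qed

lemma Ad_exp_wspace:
  assumes "h \<in> H" "x \<in> wspace a" shows "Ad_exp h x = exp (a h) *s x"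
  using Ad_exp_weight_sum[OF assms(1), of "{a}" "\<lambda>_. x"] assms(2) by simp

end

section \<open>The element \<open>v z\<close> and the coweights\<close>

context simple_lie_borel
begin

lemma W_eq: "W = reflection_group roots_H"
  unfolding W_def weyl_group_def by (rule generate_reflections) simp

lemma pair_add: "pair z (a + b) = pair z a + pair z b"
  and pair_neg: "pair z (- a) = - pair z a"
  and pair_diff: "pair z (a - b) = pair z a - pair z b"
  and pair_comp: "pair z (a \<circ> w) = pair (w z) a"
  by (simp_all add: pair_def)

lemma Delta_pos_roots_H: "a \<in> Delta_pos \<Longrightarrow> a \<in> roots_H"
  by (simp add: Delta_pos_iff)

lemma Delta_pos_cases: "a \<in> roots_H \<Longrightarrow> a \<in> Delta_pos \<or> - a \<in> Delta_pos"
  and Delta_pos_neg: "a \<in> Delta_pos \<Longrightarrow> - a \<notin> Delta_pos"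
  and Delta_pos_add: "a \<in> Delta_pos \<Longrightarrow> b \<in> Delta_pos \<Longrightarrow> a + b \<in> roots_H \<Longrightarrow> a + b \<in> Delta_pos"
  using pos_system_Delta_pos by (auto simp: pos_system_def half_closed_def)

text \<open>The positive system of a small perturbation of \<open>z\<close> in a dominant direction:
  \<open>z\<close> decides first, and \<open>Delta_pos\<close> breaks ties.\<close>

definition chamber :: "'g \<Rightarrow> ('g \<Rightarrow> complex) set" where
  "chamber z = {a \<in> roots_H. pair z a > 0 \<or> pair z a = 0 \<and> a \<in> Delta_pos}"

lemma pos_system_chamber: "pos_system roots_H (chamber z)"
  unfolding pos_system_def half_closed_def
proof (intro conjI ballI impI)
  show "chamber z \<subseteq> roots_H" "chamber z \<subseteq> roots_H" by (auto simp: chamber_def)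
next
  fix a assume "a \<in> chamber z"
  then show "- a \<notin> chamber z" using Delta_pos_neg by (auto simp: chamber_def pair_neg)
next
  fix a b assume "a \<in> chamber z" "b \<in> chamber z" "a + b \<in> roots_H"
  then show "a + b \<in> chamber z" unfolding chamber_def mem_Collect_eq pair_add
    using Delta_pos_add[of a b] by linarith
next
  fix a assume a: "a \<in> roots_H"
  then show "a \<in> chamber z \<or> - a \<in> chamber z"
    unfolding chamber_def mem_Collect_eq pair_neg using Delta_pos_cases roots_H_neg by force
qed

lemma reflection_group_roots_H_comp: "w \<in> reflection_group roots_H \<Longrightarrow> a \<in> roots_H \<Longrightarrow> a \<circ> w \<in> roots_H"
  by (rule reflection_group_subsystem[OF subsystem_roots_H])

lemma W_act_inv: "w \<in> reflection_group roots_H \<Longrightarrow> W_act (inv_into UNIV w) a = a \<circ> w"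
  unfolding W_act_def using reflection_group_bij[of w roots_H] by (simp add: inv_inv_eq)

text \<open>The inversion set of \<open>w\<close> prescribes for every positive root the sign of its
  image, which amounts to sending \<open>chamber z\<close> into \<open>Delta_pos\<close>; inclusion
  of positive systems is equality. Simple transitivity then makes \<open>v z\<close> well
  defined.\<close>

lemma inversion_set_iff:
  assumes w: "w \<in> reflection_group roots_H"
  shows "{a \<in> Delta_pos. (\<lambda>x. - W_act (inv_into UNIV w) a x) \<in> Delta_pos} = {a \<in> Delta_pos. pair z a < 0}
    \<longleftrightarrow> (\<lambda>a. a \<circ> w) ` chamber z = Delta_pos"
proof -
  have neg: "(\<lambda>x. - W_act (inv_into UNIV w) a x) = (- a) \<circ> w" for a
    unfolding W_act_inv[OF w] by (simp add: fun_eq_iff)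
  have bw: "bij w" using reflection_group_bij[OF w] by simp
  have PS: "pos_system roots_H ((\<lambda>a. a \<circ> w) ` chamber z)"
    using reflection_group_pos_system[OF subsystem_roots_H _ pos_system_chamber w reflection_group_image_subsystem[OF subsystem_roots_H w] subsystem_roots_H] by simp
  show ?thesis unfolding neg
  proof
    assume eq: "{a \<in> Delta_pos. (- a) \<circ> w \<in> Delta_pos} = {a \<in> Delta_pos. pair z a < 0}"
    have "a \<circ> w \<in> Delta_pos" if a: "a \<in> chamber z" for a
    proof (cases "a \<in> Delta_pos")
      case True
      then have "a \<notin> {a \<in> Delta_pos. pair z a < 0}" using a by (auto simp: chamber_def)
      then have "(- a) \<circ> w \<notin> Delta_pos" using True eq by blast
      moreover have "a \<circ> w \<in> roots_H" using reflection_group_roots_H_comp[OF w] True Delta_pos_roots_H by blast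
      ultimately show ?thesis using Delta_pos_cases unfolding neg_comp by blast
    next
      case False
      have aR: "a \<in> roots_H" using a by (simp add: chamber_def)
      then have m: "- a \<in> Delta_pos" using False Delta_pos_cases by blast
      moreover have "pair z (- a) < 0" using a False by (auto simp: chamber_def pair_neg)
      ultimately have "- a \<in> {a \<in> Delta_pos. (- a) \<circ> w \<in> Delta_pos}" using eq by blast
      then show ?thesis by simp
    qed
    then have "(\<lambda>a. a \<circ> w) ` chamber z \<subseteq> Delta_pos" by blast
    then show "(\<lambda>a. a \<circ> w) ` chamber z = Delta_pos"
      by (rule pos_system_subset_eq[OF PS pos_system_Delta_pos])
  next
    assume eq: "(\<lambda>a. a \<circ> w) ` chamber z = Delta_pos"
    have "(- a) \<circ> w \<in> Delta_pos \<longleftrightarrow> pair z a < 0" if a: "a \<in> Delta_pos" for a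
    proof -
      have "(- a) \<circ> w \<in> Delta_pos \<longleftrightarrow> - a \<in> chamber z"
        unfolding eq[symmetric] using comp_bij_cancel[OF bw] by (metis (no_types, lifting) imageE imageI)
      also have "\<dots> \<longleftrightarrow> pair z a < 0"
        using Delta_pos_neg[OF a] roots_H_neg[OF Delta_pos_roots_H[OF a]] by (auto simp: chamber_def pair_neg)
      finally show ?thesis .
    qed
    then show "{a \<in> Delta_pos. (- a) \<circ> w \<in> Delta_pos} = {a \<in> Delta_pos. pair z a < 0}" by blast
  qed
qed

lemma v_eq: "v z = (THE w. w \<in> reflection_group roots_H \<and> (\<lambda>a. a \<circ> w) ` chamber z = Delta_pos)"
  unfolding v_def W_eq using inversion_set_iff by (metis (no_types, lifting))

lemma v_in_W: "v z \<in> reflection_group roots_H" and v_chamber: "(\<lambda>a. a \<circ> v z) ` chamber z = Delta_pos"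
proof -
  have "v z \<in> reflection_group roots_H \<and> (\<lambda>a. a \<circ> v z) ` chamber z = Delta_pos"
    unfolding v_eq by (rule theI'[OF pos_systems_conjugate_unique[OF subsystem_roots_H pos_system_chamber pos_system_Delta_pos]])
  then show "v z \<in> reflection_group roots_H" "(\<lambda>a. a \<circ> v z) ` chamber z = Delta_pos" by blast+
qed

lemma v_unique:
  assumes "w \<in> reflection_group roots_H" "(\<lambda>a. a \<circ> w) ` chamber z = Delta_pos" shows "v z = w"
  unfolding v_eq
  by (rule the1_equality[OF pos_systems_conjugate_unique[OF subsystem_roots_H pos_system_chamber pos_system_Delta_pos]])
    (use assms in blast)

lemma v_dominant: "v z (dominant z) = z"
  unfolding dominant_def using reflection_group_bij[OF v_in_W, of z] by (simp add: bij_is_surj surj_f_inv_f)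

lemma pair_dominant: "pair (dominant z) (a \<circ> v z) = pair z a"
  by (simp add: pair_comp v_dominant)

lemma h_real_induct [consumes 1, case_names zero step]:
  assumes "x \<in> h_real" "Q 0"
    and "\<And>r a x. a \<in> roots_H \<Longrightarrow> x \<in> h_real \<Longrightarrow> Q x \<Longrightarrow> Q (complex_of_real r *s coroot_of a + x)"
  shows "Q x"
proof -
  interpret R: module "\<lambda>r::real. scale (complex_of_real r)"
    by unfold_locales (simp_all add: scale_right_distrib scale_left_distrib)
  have "x \<in> h_real \<and> Q x" using assms(1) unfolding h_real_def Delta_eq
  proof (induction rule: R.span_induct_alt)
    case base then show ?case using assms(2) by (simp add: R.span_zero)
  next
    case (step c b y)
    then show ?case using assms(3) unfolding h_real_def Delta_eq
      by (auto intro: R.span_add R.span_scale R.span_base)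
  qed
  then show ?thesis by blast
qed

lemma h_real_step: "a \<in> roots_H \<Longrightarrow> x \<in> h_real \<Longrightarrow> x - complex_of_real r *s coroot_of a \<in> h_real"
proof -
  interpret R: module "\<lambda>r::real. scale (complex_of_real r)"
    by unfold_locales (simp_all add: scale_right_distrib scale_left_distrib)
  assume "a \<in> roots_H" "x \<in> h_real"
  then show ?thesis unfolding h_real_def Delta_eq
    by (intro R.span_diff R.span_scale[OF R.span_base]) auto
qed

lemma h_real_in_H: "x \<in> h_real \<Longrightarrow> x \<in> H"
  by (induction rule: h_real_induct) (auto intro: H_closed coroot_in_H)

text \<open>Roots are integral on coroots, hence real on their real span; so \<open>Re\<close> in
  \<open>pair\<close> loses nothing.\<close>

lemma h_real_pair: assumes "x \<in> h_real" "a \<in> roots_H" shows "a x = complex_of_real (pair x a)"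
proof -
  have "Im (a x) = 0" using assms(1)
  proof (induction rule: h_real_induct)
    case zero then show ?case using dual_0[OF roots_H_dual[OF assms(2)]] by simp
  next
    case (step r b x)
    have "a (complex_of_real r *s coroot_of b + x) = complex_of_real r * of_int (cartan_int a b) + a x"
      using step assms(2) h_real_in_H[OF step(2)] cartan_int[OF step(1), of a]
      by (simp add: dual_D(1,2)[OF roots_H_dual[OF assms(2)]] coroot_in_H H_closed)
    then show ?case using step(3) by simp
  qed
  then show ?thesis by (simp add: pair_def complex_eq_iff)
qed

lemma coweights_reflect: assumes x: "x \<in> coweights" and a: "a \<in> roots_H" shows "reflect a x \<in> coweights"
proof -
  have xr: "x \<in> h_real" using x by (simp add: coweights_def)
  have "reflect a x = x - complex_of_real (pair x a) *s coroot_of a"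
    by (simp add: reflection_def h_real_pair[OF xr a])
  then have "reflect a x \<in> h_real" using h_real_step[OF a xr] by simp
  moreover have "pair (reflect a x) b \<in> \<int>" if "b \<in> roots_H" for b
    using x comp_reflect_roots_H[OF that a] unfolding pair_comp[symmetric] coweights_def Delta_eq by blast
  ultimately show ?thesis by (simp add: coweights_def Delta_eq)
qed

lemma coweights_reflection_group: assumes w: "w \<in> reflection_group roots_H" and x: "x \<in> coweights" shows "w x \<in> coweights"
proof -
  have "set as \<subseteq> roots_H \<Longrightarrow> word as x \<in> coweights" for as
    by (induction as) (auto simp: x coweights_reflect)
  then show ?thesis using w by (auto simp: reflection_group_def)
qed

end

section \<open>The involution and its submodules\<close>

locale simple_lie_involution = simple_lie_borel scale bracket H B
  for scale :: "complex \<Rightarrow> 'g::ab_group_add \<Rightarrow> 'g" (infixr \<open>*s\<close> 75) and bracket H B +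
  fixes tau :: 'g
  assumes tau: "tau \<in> X"
begin

section \<open>Levels of roots on \<open>tau\<close>\<close>

abbreviation lev :: "('g \<Rightarrow> complex) \<Rightarrow> real" where
  "lev \<equiv> pair tau"

lemma tau_coweight: "tau \<in> coweights" and tau_h_real: "tau \<in> h_real"
  using tau by (auto simp: X_def coweights_def)

lemma lev_simple: "a \<in> simple_roots \<Longrightarrow> 0 \<le> lev a"
  using tau by (simp add: X_def)

lemma lev_Delta_pos:
  assumes "a \<in> Delta_pos" shows "0 \<le> lev a"
  using half_closed_Delta_pos assms
proof (induction rule: half_closed_induct)
  case (indec a) then show ?case using lev_simple by (simp add: simple_roots_eq)
next
  case (add b c)
  have "lev (b + c) = lev b + lev c" by (rule pair_add)
  then show "0 \<le> lev (b + c)" using add(4,5) by simp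
qed

text \<open>The highest root exceeds \<open>a\<close> by a sum of simple roots, none of which has
  negative level.\<close>

lemma lev_le_2: assumes a: "a \<in> roots_H" shows "lev a \<le> 2"
proof -
  have pos: "0 \<le> lev g" if "g \<in> semigroup_span simple_roots" for g
    using that
  proof induction
    case (base a) then show ?case by (rule lev_simple)
  next
    case (step x a)
    have "lev (x + a) = lev x + lev a" by (rule pair_add)
    then show "0 \<le> lev (x + a)" using step lev_simple[of a] by simp
  qed
  have "nat_comb simple_roots (highest_root - a)" using highest_root_spec a by blast
  then have "highest_root - a = 0 \<or> 0 \<le> lev (highest_root - a)"
    using nat_comb_semigroup_span pos by blast
  then have "lev a \<le> lev highest_root" by (auto simp: pair_diff)
  also have "\<dots> \<le> 2" using tau by (simp add: X_def)
  finally show ?thesis .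
qed

lemma lev_cases: assumes a: "a \<in> roots_H" shows "lev a \<in> {0, 1, 2, -1, -2}"
proof -
  have "lev a \<in> \<int>" using tau_coweight a by (auto simp: coweights_def Delta_eq)
  then obtain n :: int where n: "lev a = of_int n" by (auto elim: Ints_cases)
  have "lev (- a) \<le> 2" by (rule lev_le_2[OF roots_H_neg[OF a]])
  then have "-2 \<le> n" "n \<le> 2" using lev_le_2[OF a] n by (simp_all add: pair_neg)
  then have "n \<in> {0, 1, 2, -1, -2}" by auto
  then show ?thesis using n by auto
qed

definition level0_pos :: "('g \<Rightarrow> complex) set" where "level0_pos = {a \<in> Delta_pos. lev a = 0}"
definition level1 :: "('g \<Rightarrow> complex) set" where "level1 = {a \<in> roots_H. lev a = 1}"
definition level2 :: "('g \<Rightarrow> complex) set" where "level2 = {a \<in> roots_H. lev a = 2}"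
text \<open>The roots of \<open>k\<close>, by \<open>roots_k\<close>: the exponential acts on a root
  space by the sign that the parity of the level determines.\<close>

definition even_roots :: "('g \<Rightarrow> complex) set" where "even_roots = {a \<in> roots_H. lev a \<in> {0, 2, -2}}"

lemma lev_pos_Delta_pos: "a \<in> roots_H \<Longrightarrow> 0 < lev a \<Longrightarrow> a \<in> Delta_pos"
  using Delta_pos_cases[of a] lev_Delta_pos[of "- a"] by (auto simp: pair_neg)

lemma level1_Delta_pos: "a \<in> level1 \<Longrightarrow> a \<in> Delta_pos" and level2_Delta_pos: "a \<in> level2 \<Longrightarrow> a \<in> Delta_pos"
  using lev_pos_Delta_pos by (auto simp: level1_def level2_def)

section \<open>The fixed subalgebra and its Weyl group\<close>

abbreviation exponent :: 'g where "exponent \<equiv> scale (\<i> * complex_of_real pi) tau"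

lemma exponent_in_H: "exponent \<in> H"
  using h_real_in_H[OF tau_h_real] by (simp add: H_closed)

lemma exp_exponent:
  assumes a: "a \<in> roots_H" shows "exp (a exponent) = (if a \<in> even_roots then 1 else - 1)"
proof -
  have "a exponent = \<i> * complex_of_real pi * complex_of_real (lev a)"
    using dual_D(2)[OF roots_H_dual[OF a] h_real_in_H[OF tau_h_real]] h_real_pair[OF tau_h_real a] by simp
  moreover have "exp (- (\<i> * complex_of_real pi)) = - 1"
    using exp_minus[of "\<i> * complex_of_real pi"] by simp
  moreover have "exp (- (\<i> * (complex_of_real pi * 2))) = 1"
    using exp_minus[of "\<i> * (complex_of_real pi * 2)"] by simp
  ultimately show ?thesis using lev_cases[OF a] a by (auto simp: even_roots_def mult.assoc)
qed

lemma wspace_k: "a \<in> insert 0 even_roots \<Longrightarrow> wspace a \<subseteq> k tau"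
  using Ad_exp_wspace[OF exponent_in_H] exp_exponent[of a] by (auto simp: k_def even_roots_def)

lemma wspace_k_even_roots: assumes a: "a \<in> roots_H" and x: "x \<in> wspace a" "x \<in> k tau" "x \<noteq> 0" shows "a \<in> even_roots"
proof (rule ccontr)
  assume "a \<notin> even_roots"
  then have "exp (a exponent) = - 1" using exp_exponent[OF a] by simp
  then have m: "- x = x" using x Ad_exp_wspace[OF exponent_in_H x(1)] by (simp add: k_def)
  have "(1 + 1) *s x = x + x" unfolding scale_left_distrib by simp
  also have "\<dots> = x + - x" by (simp only: m)
  finally have "(1 + 1) *s x = 0" by simp
  then show False using x(3) by simp
qed

lemma root_space_subset: "wspace a \<subseteq> L \<Longrightarrow> root_space L H a = wspace a"
  by (auto simp: root_space_def)

lemma even_roots_neg: "a \<in> even_roots \<Longrightarrow> - a \<in> even_roots"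
  by (auto simp: even_roots_def pair_neg roots_H_neg)

lemma subsystem_even_roots: "subsystem even_roots"
  unfolding subsystem_def
proof (intro conjI ballI impI)
  show "even_roots \<subseteq> roots_H" by (auto simp: even_roots_def)
  fix a assume a: "a \<in> even_roots"
  then show "- a \<in> even_roots" by (rule even_roots_neg)
  fix b assume b: "b \<in> even_roots" and ab: "a + b \<in> roots_H"
  then show "a + b \<in> even_roots" using a lev_cases[OF ab] unfolding even_roots_def mem_Collect_eq pair_add by auto
qed

lemma roots_k: "roots (k tau) H = even_roots"
proof (intro equalityI subsetI)
  fix a assume "a \<in> roots (k tau) H"
  then have a: "a \<in> dual H" "a \<noteq> 0" "root_space (k tau) H a \<noteq> {0}" by (simp_all add: roots_def zero_fun_def)
  have "0 \<in> root_space (k tau) H a" using wspace_k[of 0] zero_in_wspace[of 0] by (auto simp: root_space_def)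
  then obtain x where x: "x \<in> root_space (k tau) H a" "x \<noteq> 0" using a(3) by blast
  then have xg: "x \<in> wspace a" "x \<in> k tau" by (auto simp: root_space_def)
  show "a \<in> even_roots" using wspace_k_even_roots[OF roots_HI[OF a(1,2) xg(1) x(2)] xg x(2)] .
next
  fix a assume a: "a \<in> even_roots"
  then have "a \<in> roots_H" by (simp add: even_roots_def)
  moreover have "root_space (k tau) H a = wspace a" using wspace_k[of a] a by (intro root_space_subset) blast
  ultimately show "a \<in> roots (k tau) H" by (simp add: roots_def)
qed

text \<open>The root spaces of \<open>k\<close> are full root spaces of the algebra, so coroots
  agree. This makes \<open>W_sub\<close> a reflection subgroup of \<open>W\<close>.\<close>

lemma reflection_k: assumes a: "a \<in> even_roots" shows "reflection (k tau) H a = reflect a"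
proof -
  have "root_space (k tau) H a = wspace a" using wspace_k[of a] a by (intro root_space_subset) blast
  moreover have "root_space (k tau) H (- a) = wspace (- a)"
    using wspace_k[of "- a"] even_roots_neg[OF a] by (intro root_space_subset) blast
  moreover have "(\<lambda>x. - a x) = - a" by (simp add: fun_eq_iff)
  ultimately have "coroot (k tau) H a = coroot_of a" unfolding coroot_def by (simp only:)
  then show ?thesis by (simp add: reflection_def fun_eq_iff)
qed

lemma W_sub_eq: "W_sub tau = reflection_group even_roots"
proof -
  have "reflection (k tau) H ` even_roots = reflect ` even_roots" using reflection_k by (intro image_cong) auto
  then show ?thesis unfolding W_sub_def weyl_group_def roots_k
    using generate_reflections[of even_roots] by (auto simp: even_roots_def)
qed

section \<open>Submodules as sets of roots of level 1\<close>

lemma B_stable: "h \<in> H \<Longrightarrow> x \<in> B \<Longrightarrow> bracket h x \<in> B"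
  using borel_facts(2) cartan_subset_borel by blast

lemma B_component:
  assumes "\<And>a. a \<in> insert 0 roots_H \<Longrightarrow> y a \<in> wspace a" "sum y (insert 0 roots_H) \<in> B" "a \<in> roots_H" "y a \<noteq> 0"
  shows "a \<in> Delta_pos"
proof -
  have "y a \<in> B"
    by (rule weight_sum_mem[OF _ insert_roots_H_dual borel_facts(1) B_stable assms(1,2)])
      (use finite_roots_H assms(3) in auto)
  then show ?thesis using wspace_subset_B[OF assms(3) assms(1)] assms(3,4) by (simp add: Delta_pos_iff)
qed

text \<open>The exponential leaves the even roots and \<open>B\<close> the positive ones. Positive
  roots have level at least 0, so levels 0 and 2 remain.\<close>

lemma b_k_subset: "b_k tau \<subseteq> span (\<Union>a\<in>insert 0 (level0_pos \<union> level2). wspace a)"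
proof
  fix x assume x: "x \<in> b_k tau"
  obtain y where y: "\<And>a. a \<in> insert 0 roots_H \<Longrightarrow> y a \<in> wspace a" "x = sum y (insert 0 roots_H)"
    using weight_decomp by blast
  have "Ad_exp exponent (sum y (insert 0 roots_H)) = 1 *s sum y (insert 0 roots_H)" using x y(2) by (simp only: b_k_def k_def) simp
  then have e: "\<forall>a\<in>insert 0 roots_H. exp (a exponent) = 1 \<or> y a = 0"
    using Ad_exp_eq_iff[OF exponent_in_H y(1), of 1] by blast
  have "y a \<in> span (\<Union>a\<in>insert 0 (level0_pos \<union> level2). wspace a)" if a: "a \<in> insert 0 roots_H" for a
  proof (cases "a = 0 \<or> y a = 0")
    case True
    then show ?thesis using y(1)[of 0] span_base[of "y 0" "\<Union>a\<in>insert 0 (level0_pos \<union> level2). wspace a"] by (auto simp only: span_zero UN_insert)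
  next
    case False
    then have aR: "a \<in> roots_H" using a by blast
    have "a \<in> Delta_pos" using B_component[OF y(1) _ aR] x y(2) False by (simp only: b_k_def Int_iff) blast
    moreover have "a \<in> even_roots" using e aR False exp_exponent[OF aR] by (auto split: if_splits)
    ultimately have "a \<in> level0_pos \<union> level2" using lev_Delta_pos[of a] by (auto simp: level0_pos_def level2_def even_roots_def)
    then show ?thesis using y(1)[OF a] by (intro span_base) blast
  qed
  then show "x \<in> span (\<Union>a\<in>insert 0 (level0_pos \<union> level2). wspace a)" unfolding y(2) by (rule span_sum)
qed

lemma b_p_component:
  assumes x: "x \<in> b_p tau" and y: "\<And>a. a \<in> insert 0 roots_H \<Longrightarrow> y a \<in> wspace a" "x = sum y (insert 0 roots_H)"
    and a: "a \<in> insert 0 roots_H" "y a \<noteq> 0"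
  shows "a \<in> level1"
proof -
  have "Ad_exp exponent (sum y (insert 0 roots_H)) = (- 1) *s sum y (insert 0 roots_H)" using x y(2) by (simp only: b_p_def p_def) simp
  then have e: "\<forall>a\<in>insert 0 roots_H. exp (a exponent) = - 1 \<or> y a = 0"
    using Ad_exp_eq_iff[OF exponent_in_H y(1), of "- 1"] by blast
  have "a \<noteq> 0" using e a by auto
  then have aR: "a \<in> roots_H" using a by blast
  have "a \<in> Delta_pos" using B_component[OF y(1) _ aR] x y(2) a by (simp only: b_p_def Int_iff) blast
  moreover have "a \<notin> even_roots" using e aR a exp_exponent[OF aR] by auto
  ultimately show ?thesis using aR lev_Delta_pos[of a] lev_cases[OF aR] by (auto simp: level1_def even_roots_def)
qed

lemma wspace_b_k: "a \<in> insert 0 (level0_pos \<union> level2) \<Longrightarrow> wspace a \<subseteq> b_k tau"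
proof -
  assume a: "a \<in> insert 0 (level0_pos \<union> level2)"
  then have "a \<in> insert 0 even_roots" using Delta_pos_roots_H by (auto simp: level0_pos_def level2_def even_roots_def)
  moreover have "wspace a \<subseteq> B" using a level2_Delta_pos cartan_subset_borel by (auto simp: level0_pos_def Delta_pos_iff wspace_0)
  ultimately show ?thesis using wspace_k by (auto simp: b_k_def)
qed

lemma root_sum_b_p: assumes F: "F \<subseteq> level1" shows "root_sum F \<subseteq> b_p tau"
proof
  fix x assume x: "x \<in> root_sum F"
  have fin: "finite F" using F finite_roots_H finite_subset[of F roots_H] by (auto simp: level1_def)
  obtain y where y: "\<And>a. a \<in> F \<Longrightarrow> y a \<in> wspace a" "x = sum y F"
    using span_weight_sum[OF fin, of x] x unfolding root_sum_def by blast
  have "Ad_exp exponent x = (\<Sum>a\<in>F. exp (a exponent) *s y a)"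
    unfolding y(2) by (rule Ad_exp_weight_sum[OF exponent_in_H fin y(1)])
  also have "\<dots> = (\<Sum>a\<in>F. - y a)"
    using F exp_exponent by (intro sum.cong) (auto simp: level1_def even_roots_def)
  also have "\<dots> = - x" by (simp add: y(2) sum_negf)
  finally have "x \<in> p tau" by (simp add: p_def)
  moreover have "y a \<in> B" if "a \<in> F" for a using y(1)[OF that] that F level1_Delta_pos[of a] by (auto simp: Delta_pos_iff)
  then have "x \<in> B" unfolding y(2) by (intro subspace_sum borel_facts(1))
  ultimately show "x \<in> b_p tau" by (simp add: b_p_def)
qed

text \<open>The roots of \<open>level2\<close> also act from \<open>b_k\<close>, but they raise the
  level to 3, where there are no roots; so the condition concerns \<open>level0_pos\<close>
  alone.\<close>

definition upper_set :: "('g \<Rightarrow> complex) set \<Rightarrow> bool" where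
  "upper_set F \<longleftrightarrow> F \<subseteq> level1 \<and> (\<forall>a\<in>F. \<forall>c\<in>level0_pos. a + c \<in> roots_H \<longrightarrow> a + c \<in> F)"

lemma lev_sum_level1: "a \<in> level1 \<Longrightarrow> c \<in> level0_pos \<Longrightarrow> lev (a + c) = 1" "a \<in> level1 \<Longrightarrow> c \<in> level2 \<Longrightarrow> lev (a + c) = 3"
  by (auto simp: pair_add level0_pos_def level1_def level2_def)

lemma lev_0 [simp]: "lev 0 = 0"
  by (simp add: pair_def)

lemma root_sum_submodule: assumes F: "upper_set F" shows "root_sum F \<in> submodules tau"
proof -
  have FD: "F \<subseteq> level1" using F by (simp add: upper_set_def)
  have "bracket x y \<in> root_sum F" if x: "x \<in> b_k tau" and y: "y \<in> root_sum F" for x y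
  proof (rule span_bracket_closed[of "\<Union>a\<in>insert 0 (level0_pos \<union> level2). wspace a" "\<Union>a\<in>F. wspace a"])
    show "x \<in> span (\<Union>a\<in>insert 0 (level0_pos \<union> level2). wspace a)" using x b_k_subset by blast
    show "y \<in> span (\<Union>a\<in>F. wspace a)" using y by (simp add: root_sum_def)
    show "subspace (root_sum F)" by (simp add: root_sum_def)
    fix x y assume "x \<in> (\<Union>a\<in>insert 0 (level0_pos \<union> level2). wspace a)" "y \<in> (\<Union>a\<in>F. wspace a)"
    then obtain a b where a: "a \<in> insert 0 (level0_pos \<union> level2)" "x \<in> wspace a" and b: "b \<in> F" "y \<in> wspace b" by blast
    have xy: "bracket x y \<in> wspace (b + a)" using bracket_wspace[OF a(2) b(2)] by (simp only: add.commute)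
    have bD: "b \<in> level1" "b \<in> roots_H" using b FD by (auto simp: level1_def)
    show "bracket x y \<in> root_sum F"
    proof (cases "b + a \<in> F")
      case True then show ?thesis using xy unfolding root_sum_def by (intro span_base) blast
    next
      case False
      then have a0: "a \<noteq> 0" using b by auto
      then have "a \<in> roots_H" using a Delta_pos_roots_H by (auto simp: level0_pos_def level2_def)
      then have "b + a \<in> dual H" using bD by (intro dual_closed) (auto dest: roots_H_dual)
      moreover have "b + a \<notin> insert 0 roots_H"
      proof (cases "a \<in> level0_pos")
        case True
        then have "b + a \<noteq> 0" using lev_sum_level1(1)[OF bD(1) True] by auto
        moreover have "b + a \<notin> roots_H" using F b(1) True False by (auto simp: upper_set_def)
        ultimately show ?thesis by blast
      next
        case F2: False
        then have "lev (b + a) = 3" using a a0 lev_sum_level1(2)[OF bD(1)] by blast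
        then show ?thesis using lev_cases[of "b + a"] by (cases "b + a = 0") auto
      qed
      ultimately have "bracket x y = 0" using wspace_trivial xy by blast
      then show ?thesis by (simp add: root_sum_def span_zero)
    qed
  qed
  then show ?thesis unfolding submodules_def using root_sum_b_p[OF FD] by (simp add: root_sum_def)
qed

text \<open>Because \<open>H \<subseteq> b_k tau\<close>, a submodule contains the weight components
  of its elements. These have level 1, and a root space, being a line, lies in \<open>S\<close> as
  soon as it meets \<open>S\<close> outside 0. Nonvanishing brackets make \<open>F\<close>
  upper.\<close>

lemma submodule_root_sum: assumes S: "S \<in> submodules tau" shows "\<exists>F. upper_set F \<and> S = root_sum F"
proof -
  have sub: "subspace S" "S \<subseteq> b_p tau" "\<And>x y. x \<in> b_k tau \<Longrightarrow> y \<in> S \<Longrightarrow> bracket x y \<in> S"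
    using S by (auto simp: submodules_def)
  define F where "F = {a \<in> level1. wspace a \<subseteq> S}"
  have "H \<subseteq> b_k tau" using wspace_b_k[of 0] by (simp add: wspace_0)
  then have stable: "bracket h x \<in> S" if "h \<in> H" "x \<in> S" for h x using that sub(3) by blast
  have comp: "y a \<in> root_sum F"
    if y: "\<And>a. a \<in> insert 0 roots_H \<Longrightarrow> y a \<in> wspace a" "sum y (insert 0 roots_H) \<in> S" "a \<in> insert 0 roots_H" for y a
  proof (cases "y a = 0")
    case True then show ?thesis by (simp add: root_sum_def span_zero)
  next
    case False
    have aD: "a \<in> level1" using b_p_component[OF _ y(1) refl y(3) False] y(2) sub(2) by blast
    then have aR: "a \<in> roots_H" by (simp add: level1_def)
    have "y a \<in> S"
      by (rule weight_sum_mem[OF _ insert_roots_H_dual sub(1) stable y(1,2)]) (use finite_roots_H aR in auto)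
    then have "wspace a \<subseteq> S" using wspace_spanned[OF aR y(1)[OF y(3)] False] subspace_scale[OF sub(1)] by blast
    then have "a \<in> F" using aD by (simp add: F_def)
    then show ?thesis unfolding root_sum_def using y(1)[OF y(3)] by (intro span_base) blast
  qed
  have "S \<subseteq> root_sum F"
  proof
    fix x assume x: "x \<in> S"
    obtain y where y: "\<And>a. a \<in> insert 0 roots_H \<Longrightarrow> y a \<in> wspace a" "x = sum y (insert 0 roots_H)"
      using weight_decomp by blast
    have "subspace (root_sum F)" by (simp add: root_sum_def)
    then show "x \<in> root_sum F" unfolding y(2) using comp[OF y(1)] x y(2) by (intro subspace_sum) blast+
  qed
  moreover have "root_sum F \<subseteq> S" unfolding root_sum_def using sub(1) by (intro span_minimal) (auto simp: F_def)
  ultimately have eq: "S = root_sum F" by blast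
  have "a + c \<in> F" if a: "a \<in> F" and c: "c \<in> level0_pos" and ac: "a + c \<in> roots_H" for a c
  proof -
    have aR: "a \<in> roots_H" and cR: "c \<in> roots_H" using a c Delta_pos_roots_H by (auto simp: F_def level1_def level0_pos_def)
    obtain x y where x: "x \<in> wspace c" "x \<noteq> 0" and y: "y \<in> wspace a" "y \<noteq> 0"
      using roots_H_obtain[OF aR] roots_H_obtain[OF cR] by metis
    have ca: "c + a \<in> roots_H" using ac by (simp only: add.commute)
    have "x \<in> b_k tau" using wspace_b_k[of c] x c by blast
    moreover have "y \<in> S" using a y by (auto simp: F_def)
    ultimately have xy: "bracket x y \<in> S" by (rule sub(3))
    have "wspace (c + a) \<subseteq> S"
      using wspace_spanned[OF ca bracket_wspace[OF x(1) y(1)] bracket_root_spaces_nonzero[OF cR aR ca x y]]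
        subspace_scale[OF sub(1) xy] by blast
    then have "wspace (a + c) \<subseteq> S" by (simp only: add.commute)
    moreover have "a \<in> level1" using a by (simp add: F_def)
    then have "lev (a + c) = 1" using lev_sum_level1(1) c by blast
    ultimately show ?thesis using ac unfolding F_def level1_def by blast
  qed
  then have "upper_set F" by (auto simp: upper_set_def F_def)
  then show ?thesis using eq by blast
qed

lemma submodules_eq: "submodules tau = root_sum ` {F. upper_set F}"
  using root_sum_submodule submodule_root_sum by blast

lemma root_sum_mem:
  assumes F: "F \<subseteq> roots_H" and a: "a \<in> roots_H" and x: "x \<in> wspace a" "x \<noteq> 0" "x \<in> root_sum F"
  shows "a \<in> F"
proof (rule ccontr)
  assume aF: "a \<notin> F"
  have fin: "finite F" using F finite_roots_H finite_subset by blast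
  obtain y where y: "\<And>a. a \<in> F \<Longrightarrow> y a \<in> wspace a" "x = sum y F"
    using span_weight_sum[OF fin, of x] x(3) unfolding root_sum_def by blast
  define z where "z b = (if b = a then - x else y b)" for b
  have "sum z (insert a F) = - x + sum z F" using fin aF by (simp add: z_def)
  also have "sum z F = sum y F" using aF by (intro sum.cong) (auto simp: z_def)
  also have "- x + sum y F = 0" using y(2) by simp
  finally have s: "sum z (insert a F) = 0" .
  have "z a = 0"
  proof (rule weight_sum_zero[OF _ _ _ s])
    show "finite (insert a F)" using fin by simp
    show "insert a F \<subseteq> dual H" using F a roots_H_dual by blast
    show "z b \<in> wspace b" if "b \<in> insert a F" for b
      using that y(1)[of b] x(1) subspace_neg[OF subspace_wspace, of x a] by (cases "b = a") (auto simp: z_def)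
  qed simp
  then show False using x by (simp add: z_def)
qed

lemma root_sum_inj: "inj_on root_sum {F. upper_set F}"
proof (rule inj_onI)
  have sub: "F \<subseteq> G" if "F \<subseteq> roots_H" "G \<subseteq> roots_H" "root_sum F = root_sum G" for F G
  proof
    fix a assume a: "a \<in> F"
    then have aR: "a \<in> roots_H" using that by blast
    obtain x where x: "x \<in> wspace a" "x \<noteq> 0" using roots_H_obtain[OF aR] .
    have "x \<in> root_sum F" unfolding root_sum_def using x(1) a by (intro span_base) blast
    then show "a \<in> G" using root_sum_mem[OF that(2) aR x] that(3) by simp
  qed
  fix F G assume FG: "F \<in> {F. upper_set F}" "G \<in> {F. upper_set F}" and eq: "root_sum F = root_sum G"
  have R: "F \<subseteq> roots_H" "G \<subseteq> roots_H" using FG by (auto simp: upper_set_def level1_def)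
  show "F = G" using sub[OF R eq] sub[OF R(2,1) eq[symmetric]] by blast
qed

text \<open>Root vectors fail to commute when their roots add up to a root. A sum of two roots of
  level 1 has level 2, so it is never the weight 0 and the bracket vanishes in the remaining
  case.\<close>

lemma abelian_root_sum:
  assumes F: "upper_set F"
  shows "abelian (root_sum F) \<longleftrightarrow> (\<forall>a\<in>F. \<forall>b\<in>F. a + b \<notin> roots_H)"
proof
  have FR: "F \<subseteq> roots_H" "F \<subseteq> level1" using F by (auto simp: upper_set_def level1_def)
  assume ab: "abelian (root_sum F)"
  show "\<forall>a\<in>F. \<forall>b\<in>F. a + b \<notin> roots_H"
  proof (intro ballI notI)
    fix a b assume a: "a \<in> F" and b: "b \<in> F" and R: "a + b \<in> roots_H"
    obtain x y where x: "x \<in> wspace a" "x \<noteq> 0" and y: "y \<in> wspace b" "y \<noteq> 0"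
      using roots_H_obtain a b FR by (metis subsetD)
    have "x \<in> root_sum F" "y \<in> root_sum F" unfolding root_sum_def using x y a b by (blast intro: span_base)+
    then have "bracket x y = 0" using ab by (simp add: abelian_def)
    then show False using bracket_root_spaces_nonzero[OF _ _ R x y] a b FR by blast
  qed
next
  have FR: "F \<subseteq> roots_H" "F \<subseteq> level1" using F by (auto simp: upper_set_def level1_def)
  assume n: "\<forall>a\<in>F. \<forall>b\<in>F. a + b \<notin> roots_H"
  have "bracket x y \<in> {0}" if x: "x \<in> root_sum F" and y: "y \<in> root_sum F" for x y
  proof (rule span_bracket_closed[OF _ _ x[unfolded root_sum_def] y[unfolded root_sum_def]])
    fix x y assume "x \<in> (\<Union>a\<in>F. wspace a)" "y \<in> (\<Union>a\<in>F. wspace a)"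
    then obtain a b where a: "a \<in> F" "x \<in> wspace a" and b: "b \<in> F" "y \<in> wspace b" by blast
    have "a \<in> level1" "b \<in> level1" using a b FR(2) by blast+
    then have "lev (a + b) = 2" by (simp add: level1_def pair_add)
    then have "a + b \<noteq> 0" by auto
    then have "a + b \<notin> insert 0 roots_H" using n a b by blast
    moreover have "a + b \<in> dual H" using a b FR by (intro dual_closed) (auto dest: roots_H_dual)
    ultimately show "bracket x y \<in> {0}" using wspace_trivial bracket_wspace[OF a(2) b(2)] by blast
  qed (rule subspace_single_0)
  then show "abelian (root_sum F)" by (simp add: abelian_def)
qed

end

section \<open>The correspondence\<close>

text \<open>These are the possible levels, in increasing order, of three roots with sum
  zero.\<close>

lemma sorted_zero_sum_cases:
  fixes r s t :: real
  assumes "r \<in> {0, 1, 2, -1, -2}" "s \<in> {0, 1, 2, -1, -2}" "t \<in> {0, 1, 2, -1, -2}"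
    and "r + s + t = 0" "r \<le> s" "s \<le> t"
  shows "(r, s, t) \<in> {(0, 0, 0), (-1, 0, 1), (-2, 0, 2), (-2, 1, 1), (-1, -1, 2)}"
proof -
  have t: "t = - r - s" using assms(4) by simp
  show ?thesis using assms(1,2,3,5,6) unfolding t by (elim insertE emptyE) simp_all
qed

context simple_lie_cartan
begin

lemma indecomposables_image:
  assumes w: "bij w"
  shows "indecomposables ((\<lambda>a. a \<circ> w) ` P) = (\<lambda>a. a \<circ> w) ` indecomposables P"
proof -
  show ?thesis
  proof (intro equalityI subsetI)
    fix x assume x: "x \<in> indecomposables ((\<lambda>a. a \<circ> w) ` P)"
    then obtain a where a: "a \<in> P" "x = a \<circ> w" by (auto simp: indecomposables_def)
    have "a \<in> indecomposables P" unfolding indecomposables_def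
    proof (intro CollectI conjI notI)
      assume "\<exists>b\<in>P. \<exists>c\<in>P. a = b + c"
      then obtain b c where bc: "b \<in> P" "c \<in> P" "a = b + c" by blast
      have "x = (b \<circ> w) + (c \<circ> w)" unfolding a(2) bc(3) by (rule add_comp)
      then show False using x bc unfolding indecomposables_def by blast
    qed (rule a)
    then show "x \<in> (\<lambda>a. a \<circ> w) ` indecomposables P" using a by blast
  next
    fix x assume "x \<in> (\<lambda>a. a \<circ> w) ` indecomposables P"
    then obtain a where a: "a \<in> indecomposables P" "x = a \<circ> w" by blast
    show "x \<in> indecomposables ((\<lambda>a. a \<circ> w) ` P)" unfolding indecomposables_def
    proof (intro CollectI conjI notI)
      show "x \<in> (\<lambda>a. a \<circ> w) ` P" using a by (auto simp: indecomposables_def)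
      assume "\<exists>b\<in>(\<lambda>a. a \<circ> w) ` P. \<exists>c\<in>(\<lambda>a. a \<circ> w) ` P. x = b + c"
      then obtain b c where bc: "b \<in> P" "c \<in> P" "x = (b \<circ> w) + (c \<circ> w)" by blast
      then have "a \<circ> w = (b + c) \<circ> w" using a(2) by (simp only: add_comp)
      then have "a = b + c" using comp_bij_cancel[OF w] by blast
      then show False using a(1) bc unfolding indecomposables_def by blast
    qed
  qed
qed

lemma pos_system_Int:
  assumes P: "pos_system roots_H P" and D: "subsystem D" shows "pos_system D (P \<inter> D)"
  using assms unfolding pos_system_def half_closed_def subsystem_def by blast

end

section \<open>The orbit of \<open>tau\<close> and adapted positive systems\<close>

context simple_lie_involution
begin

text \<open>The system \<open>P\<close> of the overview; precomposition with \<open>v z\<close> is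
  the action of its inverse.\<close>

definition pulled_system :: "'g \<Rightarrow> ('g \<Rightarrow> complex) set" where
  "pulled_system z = (\<lambda>a. a \<circ> v z) ` Delta_pos"

definition adapted_systems :: "('g \<Rightarrow> complex) set set" where
  "adapted_systems = {P. pos_system roots_H P \<and> level0_pos \<subseteq> P}"

definition tau_orbit :: "'g set" where
  "tau_orbit = {z \<in> coweights. dominant z = tau}"

lemma bij_v: "bij (v z)"
  using reflection_group_bij[OF v_in_W] by simp

lemma pos_system_reflection_group_image:
  "w \<in> reflection_group roots_H \<Longrightarrow> pos_system roots_H P \<Longrightarrow> pos_system roots_H ((\<lambda>a. a \<circ> w) ` P)"
  using reflection_group_pos_system[OF subsystem_roots_H _ _ _ reflection_group_image_subsystem[OF subsystem_roots_H] subsystem_roots_H] by blast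

lemma pair_tau_orbit: "z \<in> tau_orbit \<Longrightarrow> pair z a = lev (a \<circ> v z)"
  using pair_dominant[of z a] by (simp add: tau_orbit_def)

text \<open>A root of \<open>level0_pos\<close> comes from a root of \<open>chamber z\<close> with
  value 0 on \<open>z\<close>, and for such roots the tie rule of \<open>chamber\<close> is
  positivity.\<close>

lemma pulled_system_adapted_systems: assumes z: "z \<in> tau_orbit" shows "pulled_system z \<in> adapted_systems"
proof -
  have "pos_system roots_H (pulled_system z)"
    unfolding pulled_system_def by (rule pos_system_reflection_group_image[OF v_in_W pos_system_Delta_pos])
  moreover have "level0_pos \<subseteq> pulled_system z"
  proof
    fix c assume c: "c \<in> level0_pos"
    then have "c \<in> (\<lambda>a. a \<circ> v z) ` chamber z" unfolding v_chamber by (simp add: level0_pos_def)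
    then obtain b where b: "b \<in> chamber z" "c = b \<circ> v z" by blast
    have "pair z b = 0" using pair_tau_orbit[OF z, of b] b(2) c by (simp add: level0_pos_def)
    then have "b \<in> Delta_pos" using b(1) by (simp add: chamber_def)
    then show "c \<in> pulled_system z" unfolding pulled_system_def b(2) by (rule imageI)
  qed
  ultimately show ?thesis by (simp add: adapted_systems_def)
qed

text \<open>Since \<open>tau\<close> may have a stabilizer, \<open>w tau\<close> alone does not
  determine \<open>w\<close>. The inclusion of \<open>level0_pos\<close> in \<open>P\<close> ensures
  that \<open>w\<close> sends \<open>chamber z\<close> to \<open>Delta_pos\<close>, hence that
  \<open>v z = w\<close>.\<close>

lemma pulled_system_surj: assumes P: "P \<in> adapted_systems" shows "\<exists>z\<in>tau_orbit. pulled_system z = P"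
proof -
  have pP: "pos_system roots_H P" "level0_pos \<subseteq> P" using P by (auto simp: adapted_systems_def)
  obtain w where w: "w \<in> reflection_group roots_H" "(\<lambda>a. a \<circ> w) ` Delta_pos = P"
    using pos_systems_conjugate[OF subsystem_roots_H pos_system_Delta_pos pP(1)] by blast
  have bw: "bij w" using reflection_group_bij[OF w(1)] by simp
  define z where "z = w tau"
  have pz: "pair z b = lev (b \<circ> w)" for b by (simp add: z_def pair_comp)
  have "b \<circ> w \<in> Delta_pos" if b: "b \<in> chamber z" for b
  proof -
    have R: "b \<circ> w \<in> roots_H" using b reflection_group_roots_H_comp[OF w(1)] by (simp add: chamber_def)
    show ?thesis
    proof (cases "lev (b \<circ> w) > 0")
      case True then show ?thesis by (rule lev_pos_Delta_pos[OF R])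
    next
      case False
      then have l: "lev (b \<circ> w) = 0" "b \<in> Delta_pos" using b by (auto simp: chamber_def pz)
      then have bP: "b \<circ> w \<in> P" using w(2) by blast
      show ?thesis
      proof (rule ccontr)
        assume "b \<circ> w \<notin> Delta_pos"
        then have "- (b \<circ> w) \<in> level0_pos" using Delta_pos_cases[OF R] l(1) by (simp add: level0_pos_def pair_neg)
        then have "- (b \<circ> w) \<in> P" using pP(2) by blast
        then show False using bP pP(1) by (auto simp: pos_system_def half_closed_def)
      qed
    qed
  qed
  then have "(\<lambda>a. a \<circ> w) ` chamber z \<subseteq> Delta_pos" by blast
  then have "(\<lambda>a. a \<circ> w) ` chamber z = Delta_pos"
    by (rule pos_system_subset_eq[OF pos_system_reflection_group_image[OF w(1) pos_system_chamber] pos_system_Delta_pos])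
  then have v: "v z = w" by (rule v_unique[OF w(1)])
  have "dominant z = tau" unfolding dominant_def v by (simp add: z_def bij_is_inj[OF bw])
  then have "z \<in> tau_orbit" using coweights_reflection_group[OF w(1) tau_coweight] by (simp add: tau_orbit_def z_def)
  moreover have "pulled_system z = P" by (simp add: pulled_system_def v w(2))
  ultimately show ?thesis by blast
qed

lemma v_eq_pulled_system:
  assumes "w \<in> reflection_group roots_H" "pulled_system z = (\<lambda>a. a \<circ> w) ` Delta_pos" shows "v z = w"
proof -
  have P: "pos_system roots_H (pulled_system z)"
    unfolding pulled_system_def by (rule pos_system_reflection_group_image[OF v_in_W pos_system_Delta_pos])
  have "(\<lambda>a. a \<circ> v z) ` Delta_pos = pulled_system z" by (simp add: pulled_system_def)
  then show ?thesis
    using pos_systems_conjugate_unique[OF subsystem_roots_H pos_system_Delta_pos P] assms v_in_W[of z] by metis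
qed

lemma tau_orbit_eqI: "z \<in> tau_orbit \<Longrightarrow> z' \<in> tau_orbit \<Longrightarrow> v z = v z' \<Longrightarrow> z = z'"
  using v_dominant[of z] v_dominant[of z'] by (simp add: tau_orbit_def)

lemma pulled_system_inj: "z \<in> tau_orbit \<Longrightarrow> z' \<in> tau_orbit \<Longrightarrow> pulled_system z = pulled_system z' \<Longrightarrow> z = z'"
  using v_eq_pulled_system[OF v_in_W[of z'], of z] tau_orbit_eqI by (simp add: pulled_system_def)

definition tight_systems :: "('g \<Rightarrow> complex) set set" where
  "tight_systems = {P \<in> adapted_systems. indecomposables P \<inter> level2 = {}}"

lemma Z_hat_eq: "Z_hat tau = {z \<in> tau_orbit. pulled_system z \<in> tight_systems}"
proof -
  have "z \<in> Z \<longleftrightarrow> pulled_system z \<in> tight_systems" if z: "z \<in> tau_orbit" for z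
  proof -
    have R: "a \<circ> v z \<in> roots_H" if "a \<in> roots_H" for a using reflection_group_roots_H_comp[OF v_in_W that] .
    have ind: "indecomposables (pulled_system z) = (\<lambda>a. a \<circ> v z) ` simple_roots"
      unfolding pulled_system_def simple_roots_eq by (rule indecomposables_image[OF bij_v])
    have iff: "pair z a \<le> 1 \<longleftrightarrow> a \<circ> v z \<notin> level2" if a: "a \<in> simple_roots" for a
    proof -
      have "a \<in> roots_H" using a Delta_pos_roots_H by (simp add: simple_roots_def)
      then show ?thesis using lev_cases[OF R[of a]] R[of a] pair_tau_orbit[OF z, of a] by (auto simp: level2_def)
    qed
    \<comment> \<open>The values of \<open>z\<close> on roots are levels on \<open>tau\<close>,
      hence at least -2.\<close>
    have "pair z highest_root \<ge> -2"
      using lev_cases[OF R[OF highest_root_in(2)]] pair_tau_orbit[OF z, of highest_root] by auto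
    moreover have "z \<in> coweights" using z by (simp add: tau_orbit_def)
    ultimately have "z \<in> Z \<longleftrightarrow> (\<forall>a\<in>simple_roots. pair z a \<le> 1)" by (simp add: Z_def)
    also have "\<dots> \<longleftrightarrow> indecomposables (pulled_system z) \<inter> level2 = {}" unfolding ind using iff by blast
    finally show ?thesis using pulled_system_adapted_systems[OF z] by (simp add: tight_systems_def)
  qed
  moreover have "z \<in> tau_orbit" if "z \<in> Z" "dominant z = tau" for z using that by (simp add: tau_orbit_def Z_def)
  ultimately show ?thesis unfolding Z_hat_def by (auto simp: tau_orbit_def)
qed

text \<open>The values of \<open>z\<close> on positive roots are the levels of the elements of its
  pulled system; among the five levels only 2 is forbidden in \<open>Z_ab\<close>.\<close>

lemma Z_tilde_eq: "Z_tilde tau = {z \<in> tau_orbit. pulled_system z \<inter> level2 = {}}"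
proof -
  have "z \<in> Z_ab \<longleftrightarrow> pulled_system z \<inter> level2 = {}" if z: "z \<in> tau_orbit" for z
  proof -
    have iff: "pair z a \<in> {0, -1, 1, -2} \<longleftrightarrow> a \<circ> v z \<notin> level2" if a: "a \<in> Delta_pos" for a
      using lev_cases[OF reflection_group_roots_H_comp[OF v_in_W Delta_pos_roots_H[OF a]], of z]
        reflection_group_roots_H_comp[OF v_in_W Delta_pos_roots_H[OF a], of z] pair_tau_orbit[OF z, of a] by (auto simp: level2_def)
    have "z \<in> coweights" using z by (simp add: tau_orbit_def)
    then have "z \<in> Z_ab \<longleftrightarrow> (\<forall>a\<in>Delta_pos. pair z a \<in> {0, -1, 1, -2})" by (simp only: Z_ab_def mem_Collect_eq simp_thms)
    also have "\<dots> \<longleftrightarrow> (\<forall>a\<in>Delta_pos. a \<circ> v z \<notin> level2)" using iff by blast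
    also have "\<dots> \<longleftrightarrow> pulled_system z \<inter> level2 = {}" unfolding pulled_system_def by blast
    finally show ?thesis .
  qed
  moreover have "z \<in> tau_orbit" if "z \<in> Z_ab" "dominant z = tau" for z using that by (simp add: tau_orbit_def Z_ab_def)
  ultimately show ?thesis unfolding Z_tilde_def by (auto simp: tau_orbit_def)
qed

section \<open>Positive systems determined by their part of level 1\<close>

definition root_sums :: "('g \<Rightarrow> complex) set \<Rightarrow> ('g \<Rightarrow> complex) set" where
  "root_sums F = {a \<in> roots_H. \<exists>b\<in>F. \<exists>c\<in>F. a = b + c}"

text \<open>The negative levels are complements of the positive ones, so that exactly one of
  \<open>a\<close> and \<open>- a\<close> is chosen.\<close>

definition completed_system :: "('g \<Rightarrow> complex) set \<Rightarrow> ('g \<Rightarrow> complex) set" where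
  "completed_system F = {a \<in> roots_H. lev a = 0 \<and> a \<in> Delta_pos \<or> lev a = 1 \<and> a \<in> F \<or> lev a = 2 \<and> a \<in> root_sums F \<or>
    lev a = -1 \<and> - a \<notin> F \<or> lev a = -2 \<and> - a \<notin> root_sums F}"

lemma upper_set_level1: "upper_set F \<Longrightarrow> a \<in> F \<Longrightarrow> a \<in> roots_H \<and> lev a = 1"
  by (auto simp: upper_set_def level1_def)

lemma upper_set_add: "upper_set F \<Longrightarrow> a \<in> F \<Longrightarrow> c \<in> Delta_pos \<Longrightarrow> lev c = 0 \<Longrightarrow> a + c \<in> roots_H \<Longrightarrow> a + c \<in> F"
  by (auto simp: upper_set_def level0_pos_def)

lemma root_sums_lev: "upper_set F \<Longrightarrow> a \<in> root_sums F \<Longrightarrow> a \<in> roots_H \<and> lev a = 2"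
  using upper_set_level1 by (auto simp: root_sums_def pair_add)

text \<open>By \<open>root_triple_sum\<close>, \<open>c\<close> can be added to one of the two
  summands, and \<open>F\<close> absorbs it there.\<close>

lemma root_sums_add:
  assumes F: "upper_set F" and a: "a \<in> root_sums F" and c: "c \<in> Delta_pos" "lev c = 0" and ac: "a + c \<in> roots_H"
  shows "a + c \<in> root_sums F"
proof -
  obtain x y where xy: "x \<in> F" "y \<in> F" "a = x + y" "a \<in> roots_H" using a by (auto simp: root_sums_def)
  have R: "x \<in> roots_H" "y \<in> roots_H" "c \<in> roots_H" "lev x = 1" "lev y = 1"
    using upper_set_level1[OF F] xy Delta_pos_roots_H c by auto
  have nz: "x + c \<noteq> 0" "y + c \<noteq> 0"
    using pair_add[of tau x c] pair_add[of tau y c] R c by auto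
  have "x + c \<in> insert 0 roots_H \<or> y + c \<in> insert 0 roots_H"
    using root_triple_sum[OF R(1,2,3)] xy(3,4) ac by simp
  then consider "x + c \<in> roots_H" | "y + c \<in> roots_H" using nz by blast
  then show ?thesis
  proof cases
    case 1
    then have "x + c \<in> F" by (rule upper_set_add[OF F xy(1) c])
    moreover have "a + c = (x + c) + y" unfolding xy(3) by (simp add: ac_simps)
    ultimately show ?thesis using ac xy(2) unfolding root_sums_def by blast
  next
    case 2
    then have "y + c \<in> F" by (rule upper_set_add[OF F xy(2) c])
    moreover have "a + c = x + (y + c)" unfolding xy(3) by (simp add: ac_simps)
    ultimately show ?thesis using ac xy(1) unfolding root_sums_def by blast
  qed
qed

text \<open>As \<open>completed_system F\<close> contains exactly one of \<open>a\<close> and \<open>- a\<close>, it is closed iff no three of its elements sum to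
  zero; the symmetry of this condition leaves five cases for the values on \<open>tau\<close>.\<close>

lemma completed_system_no_zero_sum_aux:
  assumes F: "upper_set F" and f: "f \<in> F" "g \<in> F" and p: "p' \<notin> F" "q \<notin> F" "q \<in> roots_H" "lev p' = 1" "p' \<in> roots_H"
    and eq: "p' + q = f + g" and r: "p' - f \<in> insert 0 roots_H"
  shows False
proof -
  have "p' - f \<noteq> 0" using f p by auto
  then have R: "p' - f \<in> roots_H" using r by blast
  have l: "lev (p' - f) = 0" "lev (- (p' - f)) = 0" using upper_set_level1[OF F f(1)] p by (simp_all add: pair_diff pair_neg)
  \<comment> \<open>Passing from \<open>f\<close> to \<open>p'\<close> adds a root of level 0, and
    passing from \<open>g\<close> to \<open>q\<close> adds its negative. One of the two is positive,
    so \<open>F\<close> would absorb it and contain \<open>p'\<close> or \<open>q\<close>.\<close>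
  have e1: "f + (p' - f) = p'" by simp
  have e2: "g + - (p' - f) = q" using eq by (simp add: algebra_simps)
  consider "p' - f \<in> Delta_pos" | "- (p' - f) \<in> Delta_pos" using Delta_pos_cases[OF R] by blast
  then show False
  proof cases
    case 1 then show ?thesis using upper_set_add[OF F f(1) 1 l(1)] p unfolding e1 by blast
  next
    case 2 then show ?thesis using upper_set_add[OF F f(2) 2 l(2)] p unfolding e2 by blast
  qed
qed

lemma completed_system_no_zero_sum_sorted:
  assumes F: "upper_set F" and x: "x \<in> completed_system F" and y: "y \<in> completed_system F" and z: "z \<in> completed_system F"
    and s: "x + y + z = 0" and le: "lev x \<le> lev y" "lev y \<le> lev z"
  shows False
proof -
  have R: "x \<in> roots_H" "y \<in> roots_H" "z \<in> roots_H" using x y z by (auto simp: completed_system_def)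
  have l: "lev x + lev y + lev z = 0"
    using arg_cong[OF s, of lev] unfolding pair_add lev_0 by simp
  have nx: "- x = y + z" using s by (simp add: add.assoc minus_unique)
  have "(lev x, lev y, lev z) \<in> {(0, 0, 0), (-1, 0, 1), (-2, 0, 2), (-2, 1, 1), (-1, -1, 2)}"
    by (rule sorted_zero_sum_cases[OF lev_cases[OF R(1)] lev_cases[OF R(2)] lev_cases[OF R(3)] l le])
  then consider
      (zero) "lev x = 0" "lev y = 0" "lev z = 0"
    | (one) "lev x = -1" "lev y = 0" "lev z = 1"
    | (two) "lev x = -2" "lev y = 0" "lev z = 2"
    | (pos) "lev x = -2" "lev y = 1" "lev z = 1"
    | (neg) "lev x = -1" "lev y = -1" "lev z = 2" unfolding insert_iff empty_iff prod.inject by blast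
  then show False
  proof cases
    case zero
    then have P: "x \<in> Delta_pos" "y \<in> Delta_pos" "z \<in> Delta_pos" using x y z by (auto simp: completed_system_def)
    have "y + z \<in> Delta_pos" using Delta_pos_add[OF P(2,3)] roots_H_neg[OF R(1)] unfolding nx by blast
    then show False using Delta_pos_neg[OF P(1)] unfolding nx by blast
  next
    case one
    then have yz: "y \<in> Delta_pos" "z \<in> F" "- x \<notin> F" using x y z by (auto simp: completed_system_def)
    have "- x = z + y" using nx by (simp only: add.commute)
    then have "z + y \<in> roots_H" "z + y \<notin> F" using roots_H_neg[OF R(1)] yz(3) by simp_all
    then show False using upper_set_add[OF F yz(2,1) one(2)] by blast
  next
    case two
    then have yz: "y \<in> Delta_pos" "z \<in> root_sums F" "- x \<notin> root_sums F" using x y z by (auto simp: completed_system_def)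
    have "- x = z + y" using nx by (simp only: add.commute)
    then have "z + y \<in> roots_H" "z + y \<notin> root_sums F" using roots_H_neg[OF R(1)] yz(3) by simp_all
    then show False using root_sums_add[OF F yz(2,1) two(2)] by blast
  next
    case pos
    then have yz: "y \<in> F" "z \<in> F" "- x \<notin> root_sums F" using x y z by (auto simp: completed_system_def)
    then show False using roots_H_neg[OF R(1)] nx unfolding root_sums_def by blast
  next
    case neg
    then have xy: "- x \<notin> F" "- y \<notin> F" "z \<in> root_sums F" using x y z by (auto simp: completed_system_def)
    obtain f g where fg: "f \<in> F" "g \<in> F" "z = f + g" using xy(3) by (auto simp: root_sums_def)
    have l1: "lev (- x) = 1" "lev (- y) = 1" using neg by (simp_all add: pair_neg)
    have "- (x + y) = z" using s by (rule minus_unique)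
    then have sum: "- x + - y = f + g" by (simp only: minus_add_distrib fg(3))
    then have sum': "- y + - x = f + g" by (simp only: add.commute)
    have fR: "f \<in> roots_H" "g \<in> roots_H" using upper_set_level1[OF F] fg by auto
    \<comment> \<open>The roots \<open>- x\<close>, \<open>- y\<close> and \<open>- f\<close> add up
      to the root \<open>g\<close>, so \<open>f\<close> differs from \<open>- x\<close> or from
      \<open>- y\<close> by a weight, necessarily of level 0.\<close>
    have "- x + - y \<in> roots_H" using R(3) fg(3) sum by simp
    moreover have "- x + - y + - f = g" using sum by simp
    ultimately have "- x + - f \<in> insert 0 roots_H \<or> - y + - f \<in> insert 0 roots_H"
      using root_triple_sum[OF roots_H_neg[OF R(1)] roots_H_neg[OF R(2)] roots_H_neg[OF fR(1)]] fR(2) by metis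
    then show False
    proof
      assume "- x + - f \<in> insert 0 roots_H"
      then have r: "- x - f \<in> insert 0 roots_H" by (simp only: diff_conv_add_uminus)
      show False by (rule completed_system_no_zero_sum_aux[OF F fg(1,2) xy(1,2) roots_H_neg[OF R(2)] l1(1) roots_H_neg[OF R(1)] sum r])
    next
      assume "- y + - f \<in> insert 0 roots_H"
      then have r: "- y - f \<in> insert 0 roots_H" by (simp only: diff_conv_add_uminus)
      show False by (rule completed_system_no_zero_sum_aux[OF F fg(1,2) xy(2,1) roots_H_neg[OF R(1)] l1(2) roots_H_neg[OF R(2)] sum' r])
    qed
  qed
qed

lemma completed_system_no_zero_sum:
  assumes F: "upper_set F" and x: "x \<in> completed_system F" and y: "y \<in> completed_system F" and z: "z \<in> completed_system F" and s: "x + y + z = 0"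
  shows False
proof -
  have perms: "x + y + z = 0" "x + z + y = 0" "y + x + z = 0" "y + z + x = 0" "z + x + y = 0" "z + y + x = 0"
    using s by (simp_all add: ac_simps)
  consider "lev x \<le> lev y" "lev y \<le> lev z" | "lev x \<le> lev z" "lev z \<le> lev y" | "lev y \<le> lev x" "lev x \<le> lev z"
    | "lev y \<le> lev z" "lev z \<le> lev x" | "lev z \<le> lev x" "lev x \<le> lev y" | "lev z \<le> lev y" "lev y \<le> lev x" by linarith
  then show False
  proof cases
    case 1 then show ?thesis by (rule completed_system_no_zero_sum_sorted[OF F x y z perms(1)])
  next
    case 2 then show ?thesis by (rule completed_system_no_zero_sum_sorted[OF F x z y perms(2)])
  next
    case 3 then show ?thesis by (rule completed_system_no_zero_sum_sorted[OF F y x z perms(3)])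
  next
    case 4 then show ?thesis by (rule completed_system_no_zero_sum_sorted[OF F y z x perms(4)])
  next
    case 5 then show ?thesis by (rule completed_system_no_zero_sum_sorted[OF F z x y perms(5)])
  next
    case 6 then show ?thesis by (rule completed_system_no_zero_sum_sorted[OF F z y x perms(6)])
  qed
qed

lemma completed_system_neg_iff: assumes F: "upper_set F" and a: "a \<in> roots_H" shows "- a \<in> completed_system F \<longleftrightarrow> a \<notin> completed_system F"
proof -
  have 0: "- a \<in> Delta_pos \<longleftrightarrow> a \<notin> Delta_pos" using Delta_pos_cases[OF a] Delta_pos_neg by blast
  consider "lev a = 0" | "lev a = 1" | "lev a = 2" | "lev a = -1" | "lev a = -2" using lev_cases[OF a] by blast
  then show ?thesis by cases (use a roots_H_neg[OF a] 0 in \<open>simp_all add: completed_system_def pair_neg\<close>)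
qed

lemma completed_system_tight_systems: assumes F: "upper_set F" shows "completed_system F \<in> tight_systems" and completed_system_level1: "completed_system F \<inter> level1 = F"
proof -
  have sub: "completed_system F \<subseteq> roots_H" by (auto simp: completed_system_def)
  show level1: "completed_system F \<inter> level1 = F" using upper_set_level1[OF F] by (auto simp: completed_system_def level1_def)
  have "pos_system roots_H (completed_system F)" unfolding pos_system_def half_closed_def
  proof (intro conjI ballI impI)
    fix a assume "a \<in> completed_system F" then show "- a \<notin> completed_system F" using completed_system_neg_iff[OF F] sub by blast
  next
    fix a b assume ab: "a \<in> completed_system F" "b \<in> completed_system F" "a + b \<in> roots_H"
    show "a + b \<in> completed_system F"
    proof (rule ccontr)
      assume "a + b \<notin> completed_system F"
      then have "- (a + b) \<in> completed_system F" using completed_system_neg_iff[OF F ab(3)] by blast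
      moreover have "a + b + - (a + b) = 0" by simp
      ultimately show False using completed_system_no_zero_sum[OF F ab(1,2)] by blast
    qed
  next
    fix a assume "a \<in> roots_H" then show "a \<in> completed_system F \<or> - a \<in> completed_system F" using completed_system_neg_iff[OF F] by blast
  qed (rule sub)+
  moreover have "level0_pos \<subseteq> completed_system F" using Delta_pos_roots_H by (auto simp: level0_pos_def completed_system_def)
  moreover have "indecomposables (completed_system F) \<inter> level2 = {}"
  proof (rule ccontr)
    assume "indecomposables (completed_system F) \<inter> level2 \<noteq> {}"
    then obtain a where a: "a \<in> indecomposables (completed_system F)" "a \<in> level2" by blast
    then have "a \<in> root_sums F" by (auto simp: indecomposables_def completed_system_def level2_def)
    then obtain b c where "b \<in> F" "c \<in> F" "a = b + c" by (auto simp: root_sums_def)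
    then show False using a(1) level1 unfolding indecomposables_def by blast
  qed
  ultimately show "completed_system F \<in> tight_systems" by (simp add: tight_systems_def adapted_systems_def)
qed

text \<open>By tightness an element of \<open>P\<close> of level 2 decomposes in \<open>P\<close>,
  into two elements of level 1 or into one of level 2 and a positive root of level 0. Induction and
  \<open>root_sums_add\<close> reduce the second case to the first, so \<open>P\<close> is known at
  all levels from \<open>P \<inter> level1\<close>.\<close>

lemma tight_systems_facts:
  assumes P: "P \<in> tight_systems"
  shows "upper_set (P \<inter> level1)" "P \<inter> level2 = root_sums (P \<inter> level1)" "P = completed_system (P \<inter> level1)"
proof -
  have pP: "pos_system roots_H P" "half_closed P" "level0_pos \<subseteq> P" "indecomposables P \<inter> level2 = {}" "P \<subseteq> roots_H"
    using P by (auto simp: tight_systems_def adapted_systems_def pos_system_def)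
  have closed: "a + b \<in> P" if "a \<in> P" "b \<in> P" "a + b \<in> roots_H" for a b
    using pP(2) that by (auto simp: half_closed_def)
  have neg: "- a \<in> P \<longleftrightarrow> a \<notin> P" if "a \<in> roots_H" for a
    using pP(1) that by (auto simp: pos_system_def half_closed_def)
  have zero: "a \<in> P \<longleftrightarrow> a \<in> Delta_pos" if a: "a \<in> roots_H" "lev a = 0" for a
  proof
    assume aP: "a \<in> P"
    show "a \<in> Delta_pos"
    proof (rule ccontr)
      assume "a \<notin> Delta_pos"
      then have "- a \<in> level0_pos" using Delta_pos_cases[OF a(1)] a(2) by (simp add: level0_pos_def pair_neg)
      then show False using pP(3) neg[OF a(1)] aP by blast
    qed
  next
    assume "a \<in> Delta_pos" then show "a \<in> P" using pP(3) a by (auto simp: level0_pos_def)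
  qed
  show up: "upper_set (P \<inter> level1)" unfolding upper_set_def
  proof (intro conjI ballI impI)
    fix a c assume a: "a \<in> P \<inter> level1" and c: "c \<in> level0_pos" and ac: "a + c \<in> roots_H"
    have "lev (a + c) = 1" using lev_sum_level1(1) a c by blast
    then show "a + c \<in> P \<inter> level1" using closed[of a c] a c ac pP(3) by (auto simp only: level1_def Int_iff mem_Collect_eq)
  qed simp
  have level2_sub: "a \<in> P \<Longrightarrow> lev a = 2 \<longrightarrow> a \<in> root_sums (P \<inter> level1)" for a
    using pP(2)
  proof (induction rule: half_closed_induct)
    case (indec a)
    then have "a \<in> P" by (simp add: indecomposables_def)
    then show ?case using indec pP(4,5) by (auto simp: level2_def)
  next
    case (add b c)
    have R: "b \<in> roots_H" "c \<in> roots_H" "b + c \<in> roots_H" using add pP(5) by blast+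
    have "b + c \<in> root_sums (P \<inter> level1)" if l: "lev (b + c) = 2"
    proof -
      have "lev b + lev c = 2" using l by (simp only: pair_add)
      \<comment> \<open>Both levels are at most 2, so neither can be negative.\<close>
      then consider "lev b = 1" "lev c = 1" | "lev b = 2" "lev c = 0" | "lev b = 0" "lev c = 2"
        using lev_cases[OF R(1)] lev_cases[OF R(2)] by auto
      then show ?thesis
      proof cases
        case 1
        then have "b \<in> P \<inter> level1" "c \<in> P \<inter> level1" using add(1,2) R by (auto simp: level1_def)
        then show ?thesis using R(3) unfolding root_sums_def by blast
      next
        case 2
        then have "b \<in> root_sums (P \<inter> level1)" "c \<in> Delta_pos" using add zero[OF R(2)] by blast+
        then show ?thesis using root_sums_add[OF up _ _ 2(2) R(3)] by blast
      next
        case 3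
        then have "c \<in> root_sums (P \<inter> level1)" "b \<in> Delta_pos" using add zero[OF R(1)] by blast+
        moreover have "c + b \<in> roots_H" using R(3) by (simp only: add.commute)
        ultimately have "c + b \<in> root_sums (P \<inter> level1)" using root_sums_add[OF up _ _ 3(1)] by blast
        then show ?thesis by (simp only: add.commute)
      qed
    qed
    then show "lev (b + c) = 2 \<longrightarrow> b + c \<in> root_sums (P \<inter> level1)" by blast
  qed
  show psi: "P \<inter> level2 = root_sums (P \<inter> level1)"
  proof
    show "P \<inter> level2 \<subseteq> root_sums (P \<inter> level1)" using level2_sub by (auto simp: level2_def)
    show "root_sums (P \<inter> level1) \<subseteq> P \<inter> level2"
    proof
      fix a assume a: "a \<in> root_sums (P \<inter> level1)"
      then have "a \<in> P" using closed by (auto simp: root_sums_def)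
      then show "a \<in> P \<inter> level2" using root_sums_lev[OF up a] by (simp add: level2_def)
    qed
  qed
  have "a \<in> P \<longleftrightarrow> a \<in> completed_system (P \<inter> level1)" if a: "a \<in> roots_H" for a
  proof -
    have d1: "b \<in> P \<inter> level1 \<longleftrightarrow> b \<in> P" if "b \<in> roots_H" "lev b = 1" for b using that by (simp add: level1_def)
    have d2: "b \<in> root_sums (P \<inter> level1) \<longleftrightarrow> b \<in> P" if "b \<in> roots_H" "lev b = 2" for b
      using that unfolding psi[symmetric] by (simp add: level2_def)
    consider "lev a = 0" | "lev a = 1" | "lev a = 2" | "lev a = -1" | "lev a = -2" using lev_cases[OF a] by blast
    then show ?thesis
    proof cases
      case 1 then show ?thesis using zero[OF a] a by (simp add: completed_system_def)
    next
      case 2 then show ?thesis using d1[OF a] a by (simp add: completed_system_def)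
    next
      case 3 then show ?thesis using d2[OF a] a by (simp add: completed_system_def)
    next
      case 4
      then have "- a \<in> P \<inter> level1 \<longleftrightarrow> - a \<in> P" by (intro d1 roots_H_neg a) (simp add: pair_neg)
      moreover have "a \<in> completed_system (P \<inter> level1) \<longleftrightarrow> - a \<notin> P \<inter> level1" using 4 a by (simp add: completed_system_def del: Int_iff)
      ultimately show ?thesis using neg[OF a] by blast
    next
      case 5
      then have "- a \<in> root_sums (P \<inter> level1) \<longleftrightarrow> - a \<in> P" by (intro d2 roots_H_neg a) (simp add: pair_neg)
      moreover have "a \<in> completed_system (P \<inter> level1) \<longleftrightarrow> - a \<notin> root_sums (P \<inter> level1)" using 5 a by (simp add: completed_system_def)
      ultimately show ?thesis using neg[OF a] by blast
    qed
  qed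
  then show "P = completed_system (P \<inter> level1)" using pP(5) by (auto simp: completed_system_def)
qed

lemma bij_tight_systems_upper_set: "bij_betw (\<lambda>P. P \<inter> level1) tight_systems {F. upper_set F}"
proof (rule bij_betw_byWitness[where f' = completed_system])
  show "\<forall>P\<in>tight_systems. completed_system (P \<inter> level1) = P" by (intro ballI tight_systems_facts(3)[symmetric])
  show "\<forall>F\<in>{F. upper_set F}. completed_system F \<inter> level1 = F" using completed_system_level1 by blast
  show "(\<lambda>P. P \<inter> level1) ` tight_systems \<subseteq> {F. upper_set F}" using tight_systems_facts(1) by blast
  show "completed_system ` {F. upper_set F} \<subseteq> tight_systems" using completed_system_tight_systems by blast
qed

section \<open>The two bijections\<close>

abbreviation submodule_of :: "'g \<Rightarrow> 'g set" where
  "submodule_of z \<equiv> root_sum (W_act (inv_into UNIV (v z)) ` Delta_level z 1)"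

lemma submodule_of_eq: assumes z: "z \<in> tau_orbit" shows "submodule_of z = root_sum (pulled_system z \<inter> level1)"
proof -
  have "W_act (inv_into UNIV (v z)) ` Delta_level z 1 = (\<lambda>a. a \<circ> v z) ` Delta_level z 1"
    by (intro image_cong refl W_act_inv[OF v_in_W])
  also have "\<dots> = pulled_system z \<inter> level1"
    unfolding Delta_level_def pulled_system_def pair_tau_orbit[OF z] level1_def
    using reflection_group_roots_H_comp[OF v_in_W[of z]] Delta_pos_roots_H by auto
  finally show ?thesis by simp
qed

lemma bij_Z_hat: "bij_betw submodule_of (Z_hat tau) (submodules tau)"
proof -
  have 1: "bij_betw pulled_system (Z_hat tau) tight_systems"
    unfolding bij_betw_def
  proof
    show "inj_on pulled_system (Z_hat tau)" unfolding Z_hat_eq using pulled_system_inj by (auto intro!: inj_onI)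
    show "pulled_system ` Z_hat tau = tight_systems" unfolding Z_hat_eq using pulled_system_surj by (auto simp: tight_systems_def)
  qed
  have 2: "bij_betw root_sum {F. upper_set F} (submodules tau)"
    unfolding bij_betw_def submodules_eq using root_sum_inj by simp
  have "bij_betw (root_sum \<circ> ((\<lambda>P. P \<inter> level1) \<circ> pulled_system)) (Z_hat tau) (submodules tau)"
    by (intro bij_betw_trans[OF bij_betw_trans[OF 1 bij_tight_systems_upper_set] 2])
  moreover have "(root_sum \<circ> ((\<lambda>P. P \<inter> level1) \<circ> pulled_system)) z = submodule_of z" if "z \<in> Z_hat tau" for z
    using that submodule_of_eq by (simp add: Z_hat_eq)
  then have "bij_betw (root_sum \<circ> ((\<lambda>P. P \<inter> level1) \<circ> pulled_system)) (Z_hat tau) (submodules tau)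
    = bij_betw submodule_of (Z_hat tau) (submodules tau)" by (rule bij_betw_cong)
  ultimately show ?thesis by (simp only:)
qed

text \<open>The root sums of the level 1 part are at once the level 2 part of a tight system and the
  obstruction to commutativity of the submodule.\<close>

lemma Z_tilde_iff: "z \<in> Z_tilde tau \<longleftrightarrow> z \<in> Z_hat tau \<and> abelian (submodule_of z)"
proof -
  have sub: "pulled_system z \<in> tight_systems" if "z \<in> tau_orbit" "pulled_system z \<inter> level2 = {}"
    using that pulled_system_adapted_systems by (auto simp: tight_systems_def indecomposables_def)
  have "pulled_system z \<inter> level2 = {} \<longleftrightarrow> abelian (submodule_of z)" if z: "z \<in> tau_orbit" "pulled_system z \<in> tight_systems"
  proof -
    let ?F = "pulled_system z \<inter> level1"
    have "abelian (submodule_of z) \<longleftrightarrow> (\<forall>a\<in>?F. \<forall>b\<in>?F. a + b \<notin> roots_H)"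
      unfolding submodule_of_eq[OF z(1)] by (rule abelian_root_sum[OF tight_systems_facts(1)[OF z(2)]])
    also have "\<dots> \<longleftrightarrow> root_sums ?F = {}" unfolding root_sums_def by blast
    also have "\<dots> \<longleftrightarrow> pulled_system z \<inter> level2 = {}" using tight_systems_facts(2)[OF z(2)] by simp
    finally show ?thesis by blast
  qed
  then show ?thesis unfolding Z_hat_eq Z_tilde_eq using sub by blast
qed

lemma bij_Z_tilde: "bij_betw submodule_of (Z_tilde tau) {S \<in> submodules tau. abelian S}"
proof -
  have Zt: "Z_tilde tau = {z \<in> Z_hat tau. abelian (submodule_of z)}" using Z_tilde_iff by blast
  have "inj_on submodule_of (Z_tilde tau)"
    using bij_betw_imp_inj_on[OF bij_Z_hat] by (rule inj_on_subset) (simp add: Zt)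
  moreover have "submodule_of ` Z_tilde tau = {S \<in> submodule_of ` Z_hat tau. abelian S}" unfolding Zt by auto
  ultimately show ?thesis unfolding bij_betw_def bij_betw_imp_surj_on[OF bij_Z_hat] by simp
qed

section \<open>Counting by cosets of the Weyl group of \<open>k\<close>\<close>

definition even_pos_system :: "('g \<Rightarrow> complex) set" where
  "even_pos_system = {a \<in> roots_H. lev a = 0 \<and> a \<in> Delta_pos \<or> lev a = -2}"

text \<open>The completed system of the empty set chooses the whole of level -2 over level 2; its
  even part is the required set, so closure is inherited.\<close>

lemma pos_system_even_pos_system: "pos_system even_roots even_pos_system"
proof -
  have up: "upper_set {}" by (simp add: upper_set_def)
  have "completed_system {} \<in> adapted_systems" using completed_system_tight_systems[OF up] by (simp add: tight_systems_def)
  then have "pos_system even_roots (completed_system {} \<inter> even_roots)" using pos_system_Int[OF _ subsystem_even_roots] by (simp add: adapted_systems_def)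
  moreover have "completed_system {} \<inter> even_roots = even_pos_system" by (auto simp: completed_system_def even_roots_def even_pos_system_def root_sums_def)
  ultimately show ?thesis by simp
qed

lemma even_pos_system_subset_iff: assumes P: "pos_system roots_H P" shows "even_pos_system \<subseteq> P \<longleftrightarrow> P \<in> adapted_systems \<and> P \<inter> level2 = {}"
proof -
  have neg: "- a \<in> P \<longleftrightarrow> a \<notin> P" if "a \<in> roots_H" for a
    using P that by (auto simp: pos_system_def half_closed_def)
  show ?thesis
  proof
    assume E: "even_pos_system \<subseteq> P"
    have "level0_pos \<subseteq> P" using E Delta_pos_roots_H by (auto simp: level0_pos_def even_pos_system_def)
    moreover have "a \<notin> P" if "a \<in> level2" for a
    proof -
      have "- a \<in> even_pos_system" "a \<in> roots_H" using that roots_H_neg by (auto simp: level2_def even_pos_system_def pair_neg)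
      then show ?thesis using E neg by blast
    qed
    ultimately show "P \<in> adapted_systems \<and> P \<inter> level2 = {}" using P by (auto simp: adapted_systems_def)
  next
    assume A: "P \<in> adapted_systems \<and> P \<inter> level2 = {}"
    show "even_pos_system \<subseteq> P"
    proof
      fix a assume a: "a \<in> even_pos_system"
      then have aR: "a \<in> roots_H" by (simp add: even_pos_system_def)
      show "a \<in> P"
      proof (cases "lev a = 0")
        case True then show ?thesis using a A by (auto simp: even_pos_system_def adapted_systems_def level0_pos_def)
      next
        case False
        then have "- a \<in> level2" using a roots_H_neg[OF aR] by (simp add: even_pos_system_def level2_def pair_neg)
        then show ?thesis using A neg[OF aR] by blast
      qed
    qed
  qed
qed

lemma pos_system_Int_even_roots:
  assumes P: "pos_system roots_H P" and E: "even_pos_system \<subseteq> P" shows "P \<inter> even_roots = even_pos_system"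
proof -
  have "even_pos_system \<subseteq> P \<inter> even_roots" using E pos_system_even_pos_system by (auto simp: pos_system_def)
  then show ?thesis using pos_system_subset_eq[OF pos_system_even_pos_system pos_system_Int[OF P subsystem_even_roots]] by blast
qed

lemma even_roots_roots_H: "even_roots \<subseteq> roots_H"
  by (auto simp: even_roots_def)

abbreviation coset :: "('g \<Rightarrow> 'g) \<Rightarrow> ('g \<Rightarrow> 'g) set" where
  "coset u \<equiv> (\<lambda>h. h \<circ> u) ` reflection_group even_roots"

lemma coset_eq: assumes h: "h \<in> reflection_group even_roots" shows "coset (h \<circ> u) = coset u"
proof (intro equalityI subsetI)
  fix x assume "x \<in> coset (h \<circ> u)"
  then obtain g where g: "g \<in> reflection_group even_roots" "x = (g \<circ> h) \<circ> u" by (auto simp: comp_assoc)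
  then show "x \<in> coset u" using reflection_group_comp[OF g(1) h] by blast
next
  fix x assume "x \<in> coset u"
  then obtain g where g: "g \<in> reflection_group even_roots" "x = g \<circ> u" by blast
  obtain h' where h': "h' \<in> reflection_group even_roots" "h' \<circ> h = id" using reflection_group_inverse[OF h even_roots_roots_H] by blast
  have "x = (g \<circ> (h' \<circ> h)) \<circ> u" using g h' by simp
  then have "x = (g \<circ> h') \<circ> (h \<circ> u)" by (simp only: comp_assoc)
  then show "x \<in> coset (h \<circ> u)" using reflection_group_comp[OF g(1) h'(1)] by blast
qed

lemma rcosets_eq: "rcosets\<^bsub>(BijGroup UNIV)\<lparr>carrier := W\<rparr>\<^esub> (W_sub tau) = coset ` reflection_group roots_H"
proof -
  have "W_sub tau #>\<^bsub>(BijGroup UNIV)\<lparr>carrier := W\<rparr>\<^esub> u = coset u" if u: "u \<in> reflection_group roots_H" for u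
  proof -
    have "h \<otimes>\<^bsub>BijGroup UNIV\<^esub> u = h \<circ> u" if "h \<in> reflection_group even_roots" for h
      using reflection_group_bij[OF that even_roots_roots_H] reflection_group_bij[OF u] by (intro BijGroup_UNIV_simps) auto
    then show ?thesis unfolding r_coset_def W_sub_eq by auto
  qed
  then show ?thesis unfolding RCOSETS_def by (auto simp: W_eq)
qed

lemma bij_Z_tilde_cosets: "bij_betw (\<lambda>z. coset (inv_into UNIV (v z))) (Z_tilde tau) (coset ` reflection_group roots_H)"
  unfolding bij_betw_def
proof
  have Zt: "z \<in> tau_orbit" "pos_system roots_H (pulled_system z)" "even_pos_system \<subseteq> pulled_system z" if "z \<in> Z_tilde tau" for z
    using that pulled_system_adapted_systems[of z] even_pos_system_subset_iff[of "pulled_system z"] unfolding Z_tilde_eq adapted_systems_def by auto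
  have inv: "inv_into UNIV (v z) \<in> reflection_group roots_H" for z using reflection_group_inv[OF v_in_W] by simp
  show "inj_on (\<lambda>z. coset (inv_into UNIV (v z))) (Z_tilde tau)"
  proof (rule inj_onI)
    fix z z' assume z: "z \<in> Z_tilde tau" and z': "z' \<in> Z_tilde tau"
      and eq: "coset (inv_into UNIV (v z)) = coset (inv_into UNIV (v z'))"
    have "inv_into UNIV (v z) \<in> coset (inv_into UNIV (v z))"
      using reflection_group_id[of even_roots] by (intro image_eqI[of _ _ id]) auto
    then obtain g where g: "g \<in> reflection_group even_roots" "inv_into UNIV (v z) = g \<circ> inv_into UNIV (v z')" using eq by blast
    have "v z \<circ> (g \<circ> inv_into UNIV (v z')) \<circ> v z' = v z \<circ> inv_into UNIV (v z) \<circ> v z'" by (simp only: g(2))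
    then have "v z \<circ> g \<circ> (inv_into UNIV (v z') \<circ> v z') = (v z \<circ> inv_into UNIV (v z)) \<circ> v z'"
      by (simp only: comp_assoc)
    moreover have "v z \<circ> inv_into UNIV (v z) = id" using bij_v[of z] by (simp add: bij_is_surj surj_iff[symmetric])
    moreover have "inv_into UNIV (v z') \<circ> v z' = id" using bij_v[of z'] by (simp add: bij_is_inj)
    ultimately have vg: "v z \<circ> g = v z'" by (simp only: comp_id id_comp)
    \<comment> \<open>\<open>g\<close> carries the system of \<open>z\<close> to that of
      \<open>z'\<close> and preserves the even roots, and the even part of both systems is
      \<open>even_pos_system\<close>.\<close>
    have "g = id"
    proof (rule reflection_group_preserving_trivial[OF subsystem_even_roots pos_system_even_pos_system g(1)])
      fix b assume b: "b \<in> even_pos_system"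
      then have "b \<in> pulled_system z" using Zt(3)[OF z] by blast
      then obtain a where a: "a \<in> Delta_pos" "b = a \<circ> v z" by (auto simp: pulled_system_def)
      then have "b \<circ> g = a \<circ> v z'" using vg by (simp add: comp_assoc)
      then have "b \<circ> g \<in> pulled_system z'" using a(1) unfolding pulled_system_def by blast
      moreover have "b \<circ> g \<in> even_roots" using b pos_system_even_pos_system reflection_group_subsystem[OF subsystem_even_roots g(1)] by (auto simp: pos_system_def)
      ultimately show "b \<circ> g \<in> even_pos_system" using pos_system_Int_even_roots[OF Zt(2,3)[OF z']] by blast
    qed
    then have "v z = v z'" using vg by simp
    then show "z = z'" using tau_orbit_eqI Zt(1) z z' by blast
  qed
  show "(\<lambda>z. coset (inv_into UNIV (v z))) ` Z_tilde tau = coset ` reflection_group roots_H"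
  proof (intro equalityI subsetI)
    fix C assume "C \<in> (\<lambda>z. coset (inv_into UNIV (v z))) ` Z_tilde tau"
    then show "C \<in> coset ` reflection_group roots_H" using inv by blast
  next
    fix C assume "C \<in> coset ` reflection_group roots_H"
    then obtain u where u: "u \<in> reflection_group roots_H" "C = coset u" by blast
    have iu: "inv_into UNIV u \<in> reflection_group roots_H" and bu: "bij u" using reflection_group_inv[OF u(1)] reflection_group_bij[OF u(1)] by auto
    define Q where "Q = (\<lambda>a. a \<circ> inv_into UNIV u) ` Delta_pos"
    have Q: "pos_system roots_H Q" unfolding Q_def by (rule pos_system_reflection_group_image[OF iu pos_system_Delta_pos])
    \<comment> \<open>The group of \<open>k\<close> moves the even part of \<open>Q\<close> to
      \<open>even_pos_system\<close>; this changes \<open>u\<close> only within its coset.\<close>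
    obtain h where h: "h \<in> reflection_group even_roots" "(\<lambda>a. a \<circ> h) ` (Q \<inter> even_roots) = even_pos_system"
      using pos_systems_conjugate[OF subsystem_even_roots pos_system_Int[OF Q subsystem_even_roots] pos_system_even_pos_system] by blast
    have hR: "h \<in> reflection_group roots_H" using h(1) reflection_group_mono[OF even_roots_roots_H] by blast
    define P where "P = (\<lambda>a. a \<circ> h) ` Q"
    have P: "pos_system roots_H P" unfolding P_def by (rule pos_system_reflection_group_image[OF hR Q])
    have "even_pos_system \<subseteq> P" unfolding h(2)[symmetric] P_def by blast
    then have PA: "P \<in> adapted_systems" "P \<inter> level2 = {}" unfolding even_pos_system_subset_iff[OF P] by simp_all
    obtain z where z: "z \<in> tau_orbit" "pulled_system z = P" using pulled_system_surj[OF PA(1)] by blast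
    then have zt: "z \<in> Z_tilde tau" using PA(2) by (simp add: Z_tilde_eq)
    have "P = (\<lambda>a. a \<circ> (inv_into UNIV u \<circ> h)) ` Delta_pos" by (simp add: P_def Q_def image_image comp_assoc)
    then have v: "v z = inv_into UNIV u \<circ> h" using v_eq_pulled_system[OF reflection_group_comp[OF iu hR]] z(2) by blast
    have bh: "bij h" using reflection_group_bij[OF hR] by simp
    \<comment> \<open>The inverse of \<open>v z\<close> differs from \<open>u\<close> by a left
      factor from the group of \<open>k\<close>, so both lie in the same coset.\<close>
    have "inv_into UNIV (v z) = inv_into UNIV h \<circ> u"
      unfolding v using bu bh by (simp add: o_inv_distrib bij_imp_bij_inv inv_inv_eq)
    moreover have "inv_into UNIV h \<in> reflection_group even_roots" by (rule reflection_group_inv[OF h(1) even_roots_roots_H])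
    ultimately have "coset (inv_into UNIV (v z)) = C" using coset_eq u(2) by simp
    then show "C \<in> (\<lambda>z. coset (inv_into UNIV (v z))) ` Z_tilde tau" using zt by blast
  qed
qed

lemma card_abelian: "card {S \<in> submodules tau. abelian S} = weyl_index tau"
  unfolding weyl_index_def rcosets_eq
  by (rule trans[OF bij_betw_same_card[OF bij_Z_tilde, symmetric] bij_betw_same_card[OF bij_Z_tilde_cosets]])

theorem submodules_correspondence:
  "bij_betw submodule_of (Z_hat tau) (submodules tau) \<and> Z_tilde tau \<subseteq> Z_hat tau \<and>
   bij_betw submodule_of (Z_tilde tau) {S \<in> submodules tau. abelian S} \<and>
   card {S \<in> submodules tau. abelian S} = weyl_index tau"
proof (intro conjI)
  show "Z_tilde tau \<subseteq> Z_hat tau" using Z_tilde_iff by blast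
qed (rule bij_Z_hat bij_Z_tilde card_abelian)+

end

theorem proposition3p10:
  fixes scale :: "complex \<Rightarrow> 'g::ab_group_add \<Rightarrow> 'g"
    and bracket :: "'g \<Rightarrow> 'g \<Rightarrow> 'g"
    and H B :: "'g set" and \<tau> :: 'g
  assumes "simple_lie_borel scale bracket H B"
    and "\<tau> \<in> simple_lie_borel.X scale bracket H B"
  shows "(bij_betw (\<lambda>z. simple_lie_borel.root_sum scale bracket H
             (simple_lie_borel.W_act (inv_into UNIV (simple_lie_borel.v scale bracket H B z)) `
                simple_lie_borel.Delta_level scale bracket H B z 1))
           (simple_lie_borel.Z_hat scale bracket H B \<tau>)
           (simple_lie_borel.submodules scale bracket B \<tau>))
    \<and> (simple_lie_borel.Z_tilde scale bracket H B \<tau>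
           \<subseteq> simple_lie_borel.Z_hat scale bracket H B \<tau>)
    \<and> (bij_betw (\<lambda>z. simple_lie_borel.root_sum scale bracket H
             (simple_lie_borel.W_act (inv_into UNIV (simple_lie_borel.v scale bracket H B z)) `
                simple_lie_borel.Delta_level scale bracket H B z 1))
           (simple_lie_borel.Z_tilde scale bracket H B \<tau>)
           {S \<in> simple_lie_borel.submodules scale bracket B \<tau>.
              complex_lie_algebra.abelian bracket S})
    \<and> (card {S \<in> simple_lie_borel.submodules scale bracket B \<tau>.
              complex_lie_algebra.abelian bracket S}
           = simple_lie_borel.weyl_index scale bracket H \<tau>)"
proof -
  have "simple_lie_involution scale bracket H B \<tau>"
    by (intro simple_lie_involution.intro simple_lie_involution_axioms.intro assms)
  then show ?thesis by (rule simple_lie_involution.submodules_correspondence)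
qed

end
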